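(* Let $(G,G^+)$ be a rank $n$ ordered directed free abelian group with Riesz interpolation. Then there exists an inductive system of ordered groups (indexed by the positive integers) \[ (\mathbb{Z}^n,\mathbb{Z}_{\geq 0}^n) \xrightarrow{\phi_1^2} (\mathbb{Z}^n,\mathbb{Z}_{\geq 0}^n) \xrightarrow{\phi_2^3} \cdots \] whose inductive limit is $(G,G^+)\otimes_{\mathbb{Z}}(\mathbb{Q},\mathbb{Q}_{\geq 0})$.
   Context: An ordered (abelian) group is an abelian group $G$ with a subset $G^+\subseteq G$ (the positive cone) such that $0\in G^+$, $G^+\cap(-G^+)=\{0\}$ and $G^++G^+\subseteq G^+$. The order is $x\le y$ iff $y-x\in G^+$. It is directed if for all $x,y\in G$ there is $z\in G$ with $x\le z$ and $y\le z$. It has Riesz interpolation if whenever $a_1,a_2,c_1,c_2\in G$ satisfy $a_i\le c_j$ for all $i,j\in\{1,2\}$, there is $b\in G$ with $a_i\le b\le c_j$ for all $i,j\in\{1,2\}$. Arrows between ordered groups are the group homomorphisms sending positive cone into positive cone. The inductive limit of a system $((G_\alpha,G_\alpha^+),(\phi_\alpha^\beta))$ is $(G,G^+)$, where $G$ is the inductive limit of abelian groups with canonical maps $\phi_\alpha^\infty:G_\alpha\to G$, and $G^+=\bigcup_\alpha\phi_\alpha^\infty(G_\alpha^+)$. "Is" is understood up to isomorphism of ordered groups. The tensor product $(G,G^+)\otimes_{\mathbb{Z}}(H,H^+)$ of ordered abelian groups is the abelian group $G\otimes_{\mathbb{Z}}H$ with positive cone consisting of all finite sums of elements $g\otimes h$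 with $g\in G^+$ and $h\in H^+$. *)

theory Defs
  imports "HOL-Algebra.Algebra"
begin

record 'a ordgroup = "'a monoid" +
  pos_cone :: "'a set" (\<open>Pos\<index>\<close>)

definition with_cone :: "('a, 'm) monoid_scheme \<Rightarrow> 'a set \<Rightarrow> 'a ordgroup" where
  "with_cone G P =
     \<lparr>carrier = carrier G, monoid.mult = monoid.mult G, one = one G, pos_cone = P\<rparr>"

locale ordered_group = comm_group G for G :: "('a, 'm) ordgroup_scheme" (structure) +
  assumes Pos_subset: "Pos \<subseteq> carrier G"
    and one_Pos: "\<one> \<in> Pos"
    and Pos_antisym: "Pos \<inter> m_inv G ` Pos = {\<one>}"
    and Pos_closed: "Pos <#> Pos \<subseteq> Pos"

definition ord_le :: "('a, 'm) ordgroup_scheme \<Rightarrow> 'a \<Rightarrow> 'a \<Rightarrow> bool" (infix \<open>\<sqsubseteq>\<index>\<close> 50) where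
  "x \<sqsubseteq>\<^bsub>G\<^esub> y \<longleftrightarrow> y \<otimes>\<^bsub>G\<^esub> inv\<^bsub>G\<^esub> x \<in> Pos\<^bsub>G\<^esub>"

definition directed_group :: "('a, 'm) ordgroup_scheme \<Rightarrow> bool" where
  "directed_group G \<longleftrightarrow>
     (\<forall>x\<in>carrier G. \<forall>y\<in>carrier G. \<exists>z\<in>carrier G. x \<sqsubseteq>\<^bsub>G\<^esub> z \<and> y \<sqsubseteq>\<^bsub>G\<^esub> z)"

definition riesz_interpolation :: "('a, 'm) ordgroup_scheme \<Rightarrow> bool" where
  "riesz_interpolation G \<longleftrightarrow>
     (\<forall>a\<^sub>1\<in>carrier G. \<forall>a\<^sub>2\<in>carrier G. \<forall>c\<^sub>1\<in>carrier G. \<forall>c\<^sub>2\<in>carrier G.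
        (\<forall>a\<in>{a\<^sub>1, a\<^sub>2}. \<forall>c\<in>{c\<^sub>1, c\<^sub>2}. a \<sqsubseteq>\<^bsub>G\<^esub> c) \<longrightarrow>
        (\<exists>b\<in>carrier G. (\<forall>a\<in>{a\<^sub>1, a\<^sub>2}. a \<sqsubseteq>\<^bsub>G\<^esub> b) \<and> (\<forall>c\<in>{c\<^sub>1, c\<^sub>2}. b \<sqsubseteq>\<^bsub>G\<^esub> c)))"

definition free_abelian_of_rank :: "nat \<Rightarrow> ('a, 'm) monoid_scheme \<Rightarrow> bool" where
  "free_abelian_of_rank n G \<longleftrightarrow> G \<cong> free_Abelian_group {..<n}"

definition ord_hom ::
  "('a, 'm) ordgroup_scheme \<Rightarrow> ('b, 'k) ordgroup_scheme \<Rightarrow> ('a \<Rightarrow> 'b) set" where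
  "ord_hom G H = {f \<in> hom G H. f ` Pos\<^bsub>G\<^esub> \<subseteq> Pos\<^bsub>H\<^esub>}"

definition ord_isomorphic ::
  "('a, 'm) ordgroup_scheme \<Rightarrow> ('b, 'k) ordgroup_scheme \<Rightarrow> bool" (infix \<open>\<cong>\<^sub>o\<close> 60) where
  "G \<cong>\<^sub>o H \<longleftrightarrow> (\<exists>f \<in> iso G H. f ` Pos\<^bsub>G\<^esub> = Pos\<^bsub>H\<^esub>)"

definition int_power :: "nat \<Rightarrow> (nat \<Rightarrow> int) ordgroup" where
  "int_power n =
     with_cone (product_group {..<n} (\<lambda>_. integer_group))
       {x \<in> {..<n} \<rightarrow>\<^sub>E UNIV. \<forall>i<n. 0 \<le> x i}"

definition rat_ordgroup :: "rat ordgroup" where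
  "rat_ordgroup = \<lparr>carrier = UNIV, monoid.mult = (+), one = 0, pos_cone = {0..}\<rparr>"


text \<open>All groups of a system share one element type; their carriers may differ. The maps are given for all
  pairs of comparable indices and are only constrained on the carriers.\<close>

locale inductive_system =
  fixes I :: "'i::order set"
    and G :: "'i \<Rightarrow> ('a, 'm) ordgroup_scheme"
    and \<phi> :: "'i \<Rightarrow> 'i \<Rightarrow> 'a \<Rightarrow> 'a"
  assumes index_nonempty: "I \<noteq> {}"
    and index_directed: "\<lbrakk>\<alpha> \<in> I; \<beta> \<in> I\<rbrakk> \<Longrightarrow> \<exists>\<gamma>\<in>I. \<alpha> \<le> \<gamma> \<and> \<beta> \<le> \<gamma>"
    and ordered: "\<alpha> \<in> I \<Longrightarrow> ordered_group (G \<alpha>)"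
    and arrow: "\<lbrakk>\<alpha> \<in> I; \<beta> \<in> I; \<alpha> \<le> \<beta>\<rbrakk> \<Longrightarrow> \<phi> \<alpha> \<beta> \<in> ord_hom (G \<alpha>) (G \<beta>)"
    and arrow_id: "\<lbrakk>\<alpha> \<in> I; x \<in> carrier (G \<alpha>)\<rbrakk> \<Longrightarrow> \<phi> \<alpha> \<alpha> x = x"
    and arrow_comp: "\<lbrakk>\<alpha> \<in> I; \<beta> \<in> I; \<gamma> \<in> I; \<alpha> \<le> \<beta>; \<beta> \<le> \<gamma>; x \<in> carrier (G \<alpha>)\<rbrakk>
                       \<Longrightarrow> \<phi> \<beta> \<gamma> (\<phi> \<alpha> \<beta> x) = \<phi> \<alpha> \<gamma> x"

definition lim_rel ::
  "'i::order set \<Rightarrow> ('i \<Rightarrow> ('a, 'm) ordgroup_scheme) \<Rightarrow> ('i \<Rightarrow> 'i \<Rightarrow> 'a \<Rightarrow> 'a)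
     \<Rightarrow> (('i \<times> 'a) \<times> ('i \<times> 'a)) set" where
  "lim_rel I G \<phi> =
     {((\<alpha>, x), (\<beta>, y)). \<alpha> \<in> I \<and> \<beta> \<in> I \<and> x \<in> carrier (G \<alpha>) \<and> y \<in> carrier (G \<beta>) \<and>
        (\<exists>\<gamma>\<in>I. \<alpha> \<le> \<gamma> \<and> \<beta> \<le> \<gamma> \<and> \<phi> \<alpha> \<gamma> x = \<phi> \<beta> \<gamma> y)}"

definition lim_map ::
  "'i::order set \<Rightarrow> ('i \<Rightarrow> ('a, 'm) ordgroup_scheme) \<Rightarrow> ('i \<Rightarrow> 'i \<Rightarrow> 'a \<Rightarrow> 'a)
     \<Rightarrow> 'i \<Rightarrow> 'a \<Rightarrow> ('i \<times> 'a) set" where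
  "lim_map I G \<phi> \<alpha> x = lim_rel I G \<phi> `` {(\<alpha>, x)}"

text \<open>In an inductive system any two classes have representatives over a common index, all
  such choices give the same product class, and the classes of all the units coincide. Hence the
  unions in the product and in the unit below are unions of copies of one single class.\<close>

definition inductive_limit ::
  "'i::order set \<Rightarrow> ('i \<Rightarrow> ('a, 'm) ordgroup_scheme) \<Rightarrow> ('i \<Rightarrow> 'i \<Rightarrow> 'a \<Rightarrow> 'a)
     \<Rightarrow> ('i \<times> 'a) set ordgroup" where
  "inductive_limit I G \<phi> =
     \<lparr>carrier = (SIGMA \<alpha>:I. carrier (G \<alpha>)) // lim_rel I G \<phi>,
      monoid.mult = (\<lambda>A B. \<Union>{lim_map I G \<phi> \<gamma> (x \<otimes>\<^bsub>G \<gamma>\<^esub> y) |\<gamma> x y. (\<gamma>, x) \<in> A \<and> (\<gamma>, y) \<in> B}),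
      one = (\<Union>\<alpha>\<in>I. lim_map I G \<phi> \<alpha> \<one>\<^bsub>G \<alpha>\<^esub>),
      pos_cone = (\<Union>\<alpha>\<in>I. lim_map I G \<phi> \<alpha> ` Pos\<^bsub>G \<alpha>\<^esub>)\<rparr>"


definition tensor_relators ::
  "('a, 'm) monoid_scheme \<Rightarrow> ('b, 'k) monoid_scheme \<Rightarrow> ('a \<times> 'b \<Rightarrow>\<^sub>0 int) set" where
  "tensor_relators G H =
     {frag_of (x \<otimes>\<^bsub>G\<^esub> x', y) - (frag_of (x, y) + frag_of (x', y))
        |x x' y. x \<in> carrier G \<and> x' \<in> carrier G \<and> y \<in> carrier H} \<union>
     {frag_of (x, y \<otimes>\<^bsub>H\<^esub> y') - (frag_of (x, y) + frag_of (x, y'))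
        |x y y'. x \<in> carrier G \<and> y \<in> carrier H \<and> y' \<in> carrier H}"

definition tensor_kernel ::
  "('a, 'm) monoid_scheme \<Rightarrow> ('b, 'k) monoid_scheme \<Rightarrow> ('a \<times> 'b \<Rightarrow>\<^sub>0 int) set" where
  "tensor_kernel G H =
     generate (free_Abelian_group (carrier G \<times> carrier H)) (tensor_relators G H)"

definition tensor_group ::
  "('a, 'm) monoid_scheme \<Rightarrow> ('b, 'k) monoid_scheme \<Rightarrow> ('a \<times> 'b \<Rightarrow>\<^sub>0 int) set monoid" where
  "tensor_group G H = free_Abelian_group (carrier G \<times> carrier H) Mod tensor_kernel G H"

definition pure_tensor ::
  "('a, 'm) monoid_scheme \<Rightarrow> ('b, 'k) monoid_scheme \<Rightarrow> 'a \<Rightarrow> 'b \<Rightarrow> ('a \<times> 'b \<Rightarrow>\<^sub>0 int) set" where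
  "pure_tensor G H x y =
     tensor_kernel G H #>\<^bsub>free_Abelian_group (carrier G \<times> carrier H)\<^esub> frag_of (x, y)"

definition tensor_product ::
  "('a, 'm) ordgroup_scheme \<Rightarrow> ('b, 'k) ordgroup_scheme \<Rightarrow> ('a \<times> 'b \<Rightarrow>\<^sub>0 int) set ordgroup" where
  "tensor_product G H =
     with_cone (tensor_group G H)
       {\<Otimes>\<^bsub>tensor_group G H\<^esub>i\<in>{..<k}. pure_tensor G H (g i) (h i)
          |k (g :: nat \<Rightarrow> 'a) (h :: nat \<Rightarrow> 'b). (\<forall>i<k. g i \<in> Pos\<^bsub>G\<^esub> \<and> h i \<in> Pos\<^bsub>H\<^esub>)}"

end

theory Submission
  imports Defs "HOL-Library.Function_Algebras"
begin

text \<open>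
  After tensoring with the rationals, the group becomes a rational vector space \<open>V\<close> of dimension \<open>n\<close>
  with a countable cone \<open>P\<close> that generates \<open>V\<close> and has Riesz decomposition. It suffices to put any
  finite \<open>F \<subseteq> P\<close> into a simplicial cone spanned by a basis of \<open>V\<close> in \<open>P\<close>: iterating along an
  enumeration of \<open>P\<close> and clearing denominators exhausts \<open>P\<close> by the positive cones of copies of \<open>\<int>\<^sup>n\<close>,
  and the inductive limit of injective maps is a union.

  If \<open>P\<close> has a proper nonzero order ideal \<open>I\<close>, solve the problem in \<open>V / I\<close> and \<open>I\<close> by induction;
  Riesz decomposition allows to shrink the lifts of the generators from \<open>V / I\<close> until the remainders of
  the elements of \<open>F\<close> are positive elements of \<open>I\<close>. Quotients are avoided by allowing cones that contain
  a linear subspace.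

  If there is no such ideal, the positive real functionals on \<open>V\<close> form a lattice cone, spanned by a
  finite family of pairwise disjoint functionals \<open>f\<^sub>i\<close>, and \<open>v\<close> is positive as soon as all \<open>f\<^sub>i v\<close> are.
  Disjointness yields \<open>x\<^sub>j \<in> P\<close> with \<open>f\<^sub>i x\<^sub>j\<close> close to a multiple of the identity matrix. The coordinates
  of elements of \<open>F\<close> along the \<open>x\<^sub>j\<close> are then positive. The missing directions are filled by vectors on
  which all \<open>f\<^sub>i\<close> are tiny; one of the \<open>x\<^sub>j\<close> is replaced by a small simplex around it in these directions.
\<close>

section \<open>Cones and positive functionals\<close>

text \<open>The functionals of a cone without ideals cannot serve as coordinates, for two reasons.
  They are real and in general irrational, and there may be fewer of them than n: Q + Q sqrt 2,
  ordered as a subset of the reals, has n = 2 but up to scaling a single positive functional. A dual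
  basis is therefore replaced by vectors of V whose matrix of values is only close to the identity,
  and strict inequalities absorb the error. In the directions that the functionals do not control,
  coordinates are made small instead: a basis vector is multiplied by a large N and corrected by a
  rational combination of the x_j, so that the functionals are tiny on the result no matter how
  large N is. All stages have the same rank n because the finite set to be covered can first be
  enlarged to span V; at most n generators that span V form a basis. Tensoring with the rationals
  enters at the last moment: the coordinates of finitely many vectors in such a basis are fractions,
  and dividing the basis by a common denominator makes them integers.\<close>

locale rat_space = vector_space scale
  for scale :: "rat \<Rightarrow> 'v::ab_group_add \<Rightarrow> 'v" (infixr \<open>*\<^sub>Q\<close> 75)
begin

definition cone :: "'v set \<Rightarrow> bool" where
  "cone P \<longleftrightarrow> 0 \<in> P \<and> (\<forall>x\<in>P. \<forall>y\<in>P. x + y \<in> P) \<and> (\<forall>r x. 0 \<le> r \<longrightarrow> x \<in> P \<longrightarrow> r *\<^sub>Q x \<in> P)"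

text \<open>For a cone this is the largest linear subspace inside it: the elements that the preorder
  given by P identifies with 0. Rank is measured modulo this subspace.\<close>

definition lineality :: "'v set \<Rightarrow> 'v set" where
  "lineality P = {x \<in> P. - x \<in> P}"

text \<open>Riesz decomposition. Writing y \<le> z for z - y in P, a positive c \<le> a + b splits
  as x + (c - x) with 0 \<le> x \<le> a and 0 \<le> c - x \<le> b.\<close>

definition riesz :: "'v set \<Rightarrow> bool" where
  "riesz P \<longleftrightarrow> (\<forall>a\<in>P. \<forall>b\<in>P. \<forall>c\<in>P. a + b - c \<in> P \<longrightarrow>
     (\<exists>x\<in>P. a - x \<in> P \<and> c - x \<in> P \<and> b - (c - x) \<in> P))"

definition gen :: "'v set \<Rightarrow> 'v set" where
  "gen P = {x - y |x y. x \<in> P \<and> y \<in> P}"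

text \<open>Linear independence in the quotient by a subspace L. The family is indexed, so
  repetitions modulo L are excluded.\<close>

definition indep_mod :: "'v set \<Rightarrow> nat \<Rightarrow> (nat \<Rightarrow> 'v) \<Rightarrow> bool" where
  "indep_mod L k b \<longleftrightarrow> (\<forall>c. (\<Sum>i<k. c i *\<^sub>Q b i) \<in> L \<longrightarrow> (\<forall>i<k. c i = 0))"

text \<open>For a cone this amounts to dim (\<open>gen P\<close> / \<open>lineality P\<close>) \<le>
  m. Only families inside P are counted because the bases have to be found inside P.\<close>

definition rank_le :: "'v set \<Rightarrow> nat \<Rightarrow> bool" where
  "rank_le P m \<longleftrightarrow> (\<forall>k b. (\<forall>i<k. b i \<in> P) \<longrightarrow> indep_mod (lineality P) k b \<longrightarrow> k \<le> m)"

definition in_cone :: "'v set \<Rightarrow> nat \<Rightarrow> (nat \<Rightarrow> 'v) \<Rightarrow> 'v \<Rightarrow> bool" where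
  "in_cone L k b p \<longleftrightarrow> (\<exists>c. (\<forall>i<k. 0 \<le> c i) \<and> p - (\<Sum>i<k. c i *\<^sub>Q b i) \<in> L)"

lemma cone_zero: "cone P \<Longrightarrow> 0 \<in> P"
  and cone_add: "cone P \<Longrightarrow> x \<in> P \<Longrightarrow> y \<in> P \<Longrightarrow> x + y \<in> P"
  and cone_scale: "cone P \<Longrightarrow> 0 \<le> r \<Longrightarrow> x \<in> P \<Longrightarrow> r *\<^sub>Q x \<in> P"
  by (auto simp: cone_def)

lemma cone_sum: "cone P \<Longrightarrow> (\<And>i. i \<in> A \<Longrightarrow> f i \<in> P) \<Longrightarrow> sum f A \<in> P"
  by (induction A rule: infinite_finite_induct) (auto intro: cone_zero cone_add)

lemma cone_scale_iff: "cone P \<Longrightarrow> 0 < r \<Longrightarrow> r *\<^sub>Q x \<in> P \<longleftrightarrow> x \<in> P"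
  using cone_scale[of P "inverse r" "r *\<^sub>Q x"] cone_scale[of P r x] by auto

lemma rieszE:
  assumes "riesz P" "a \<in> P" "b \<in> P" "c \<in> P" "a + b - c \<in> P"
  obtains x where "x \<in> P" "a - x \<in> P" "c - x \<in> P" "b - (c - x) \<in> P"
  using assms unfolding riesz_def by blast

lemma subspace_gen:
  assumes "cone P" shows "subspace (gen P)"
proof (rule subspaceI)
  show "0 \<in> gen P" using cone_zero[OF assms] by (force simp: gen_def)
next
  fix x y assume "x \<in> gen P" "y \<in> gen P"
  then obtain a b c d where h: "x = a - b" "y = c - d" "a \<in> P" "b \<in> P" "c \<in> P" "d \<in> P"
    by (auto simp: gen_def)
  then have "x + y = (a + c) - (b + d)" by simp
  then show "x + y \<in> gen P" using h cone_add[OF assms] unfolding gen_def by blast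
next
  fix r x assume "x \<in> gen P"
  then obtain a b where h: "x = a - b" "a \<in> P" "b \<in> P" by (auto simp: gen_def)
  show "r *\<^sub>Q x \<in> gen P"
  proof (cases "0 \<le> r")
    case True
    then have "r *\<^sub>Q x = r *\<^sub>Q a - r *\<^sub>Q b" by (simp add: h scale_right_diff_distrib)
    then show ?thesis using h True cone_scale[OF assms] unfolding gen_def by blast
  next
    case False
    then have "r *\<^sub>Q x = (-r) *\<^sub>Q b - (-r) *\<^sub>Q a" by (simp add: h scale_right_diff_distrib)
    moreover have "0 \<le> -r" using False by simp
    ultimately show ?thesis using h cone_scale[OF assms] unfolding gen_def by blast
  qed
qed

lemma cone_subset_gen: "cone P \<Longrightarrow> P \<subseteq> gen P"
  using cone_zero[of P] by (force simp: gen_def)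

lemma subspace_lineality:
  assumes "cone P" shows "subspace (lineality P)"
proof (rule subspaceI)
  show "0 \<in> lineality P" using cone_zero[OF assms] by (simp add: lineality_def)
next
  fix x y assume "x \<in> lineality P" "y \<in> lineality P"
  then show "x + y \<in> lineality P"
    using cone_add[OF assms, of x y] cone_add[OF assms, of "-x" "-y"] by (simp add: lineality_def)
next
  fix r x assume "x \<in> lineality P"
  then show "r *\<^sub>Q x \<in> lineality P"
    using cone_scale[OF assms, of r x] cone_scale[OF assms, of r "-x"]
      cone_scale[OF assms, of "-r" x] cone_scale[OF assms, of "-r" "-x"]
    by (cases "0 \<le> r") (auto simp: lineality_def)
qed

end

text \<open>By \<open>unit\<close>, every positive element outside the lineality space is an order
  unit, so no order ideal lies strictly between \<open>lineality P\<close> and \<open>gen P\<close>.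
  The element \<open>u\<close> is a fixed order unit for normalizing functionals.\<close>

locale simple_cone = rat_space scale
  for scale :: "rat \<Rightarrow> 'v::ab_group_add \<Rightarrow> 'v" (infixr \<open>*\<^sub>Q\<close> 75) +
  fixes P :: "'v set" and u :: 'v
  assumes cone: "cone P" and riesz: "riesz P"
    and u_pos: "u \<in> P" and u_strict: "- u \<notin> P"
    and unit: "p \<in> P \<Longrightarrow> - p \<notin> P \<Longrightarrow> q \<in> P \<Longrightarrow> \<exists>r\<ge>0. r *\<^sub>Q p - q \<in> P"
begin

text \<open>Additivity is enough, since homogeneity over the rationals follows. Outside
  \<open>gen P\<close> the values are arbitrary, so functionals are compared on P only.\<close>

definition pos_functional :: "('v \<Rightarrow> real) \<Rightarrow> bool" where
  "pos_functional f \<longleftrightarrow> (\<forall>x\<in>gen P. \<forall>y\<in>gen P. f (x + y) = f x + f y) \<and> (\<forall>p\<in>P. 0 \<le> f p)"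

lemma pos_functional_add: "pos_functional f \<Longrightarrow> x \<in> gen P \<Longrightarrow> y \<in> gen P \<Longrightarrow> f (x + y) = f x + f y"
  and pos_functional_nonneg: "pos_functional f \<Longrightarrow> p \<in> P \<Longrightarrow> 0 \<le> f p"
  by (auto simp: pos_functional_def)

lemmas gen_subspace = subspace_gen[OF cone]

lemma P_gen: "p \<in> P \<Longrightarrow> p \<in> gen P"
  using cone_subset_gen[OF cone] by blast

lemma pos_functional_scale:
  assumes f: "pos_functional f" and x: "x \<in> gen P"
  shows "f (r *\<^sub>Q x) = of_rat r * f x"
proof -
  have z: "f 0 = 0" using pos_functional_add[OF f, of 0 0] subspace_0[OF gen_subspace] by simp
  have nat: "f (of_nat m *\<^sub>Q y) = of_nat m * f y" if y: "y \<in> gen P" for m y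
    by (induction m)
      (auto simp: z algebra_simps pos_functional_add[OF f] y subspace_scale[OF gen_subspace y])
  have neg: "f (- y) = - f y" if y: "y \<in> gen P" for y
    using pos_functional_add[OF f y subspace_neg[OF gen_subspace y]] z by simp
  have int: "f (of_int m *\<^sub>Q y) = of_int m * f y" if y: "y \<in> gen P" for m y
  proof (cases m rule: int_cases2)
    case (nonneg n) then show ?thesis using nat[OF y, of n] by simp
  next
    case (nonpos n) then show ?thesis
      using nat[OF y, of n] neg[OF subspace_scale[OF gen_subspace y, of "of_nat n"]] by simp
  qed
  obtain a b where r: "r = of_int a / of_int b" "b > 0"
    by (metis Fract_of_int_quotient Rat_cases)
  have "of_int b * f (r *\<^sub>Q x) = f (of_int b *\<^sub>Q r *\<^sub>Q x)"
    using int[OF subspace_scale[OF gen_subspace x, of r], of b] by simp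
  also have "of_int b *\<^sub>Q r *\<^sub>Q x = of_int a *\<^sub>Q x" using r by simp
  also have "f \<dots> = of_int a * f x" by (rule int[OF x])
  finally have "f (r *\<^sub>Q x) = (of_int a / of_int b) * f x" using r(2) by (simp add: field_simps)
  moreover have "real_of_rat r = of_int a / of_int b" by (simp add: r(1) of_rat_divide)
  ultimately show ?thesis by simp
qed

lemma pos_functional_0: "pos_functional f \<Longrightarrow> f 0 = 0"
  using pos_functional_scale[of f 0 0] subspace_0[OF gen_subspace] by simp

lemma pos_functional_neg: "pos_functional f \<Longrightarrow> x \<in> gen P \<Longrightarrow> f (- x) = - f x"
  using pos_functional_scale[of f x "-1"] by simp

lemma pos_functional_diff: "pos_functional f \<Longrightarrow> x \<in> gen P \<Longrightarrow> y \<in> gen P \<Longrightarrow> f (x - y) = f x - f y"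
  using pos_functional_add[of f x "-y"] pos_functional_neg[of f y] subspace_neg[OF gen_subspace, of y] by simp

lemma pos_functional_sum:
  assumes "pos_functional f" "\<And>i. i \<in> A \<Longrightarrow> b i \<in> gen P"
  shows "f (\<Sum>i\<in>A. c i *\<^sub>Q b i) = (\<Sum>i\<in>A. of_rat (c i) * f (b i))"
  using assms(2)
proof (induction A rule: infinite_finite_induct)
  case (insert i A)
  have "f (\<Sum>j\<in>insert i A. c j *\<^sub>Q b j) = f (c i *\<^sub>Q b i + (\<Sum>j\<in>A. c j *\<^sub>Q b j))"
    using insert by simp
  also have "\<dots> = f (c i *\<^sub>Q b i) + f (\<Sum>j\<in>A. c j *\<^sub>Q b j)"
    using insert by (intro pos_functional_add assms(1) subspace_scale subspace_sum gen_subspace) auto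
  finally show ?case using insert by (simp add: pos_functional_scale assms(1))
qed (simp_all add: pos_functional_0 assms)

lemma pos_functional_mono: "pos_functional f \<Longrightarrow> p \<in> P \<Longrightarrow> q \<in> P \<Longrightarrow> q - p \<in> P \<Longrightarrow> f p \<le> f q"
  using pos_functional_nonneg[of f "q - p"] pos_functional_diff[of f q p] P_gen by fastforce

lemma pos_functional_lineality: "pos_functional f \<Longrightarrow> p \<in> lineality P \<Longrightarrow> f p = 0"
  using pos_functional_nonneg[of f p] pos_functional_nonneg[of f "-p"] pos_functional_neg[of f p] P_gen
  by (fastforce simp: lineality_def)

lemma pos_functional_unit_pos:
  assumes "pos_functional f" "f u > 0" "p \<in> P" "- p \<notin> P" shows "f p > 0"
proof -
  obtain r where r: "r \<ge> 0" "r *\<^sub>Q p - u \<in> P" using unit[OF assms(3,4) u_pos] by blast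
  have "f u \<le> f (r *\<^sub>Q p)" using r assms cone_scale[OF cone] u_pos by (intro pos_functional_mono) auto
  then have "0 < of_rat r * f p" using assms P_gen by (simp add: pos_functional_scale)
  then show ?thesis using r pos_functional_nonneg[OF assms(1,3)]
    by (metis less_eq_real_def mult_zero_right order_less_irrefl)
qed

text \<open>Some multiple of the order unit \<open>u\<close> dominates p. Hence vanishing at
  \<open>u\<close> serves below as the test for the zero functional.\<close>

lemma pos_functional_zero:
  assumes "pos_functional f" "f u = 0" "p \<in> P" shows "f p = 0"
proof -
  obtain r where r: "r \<ge> 0" "r *\<^sub>Q u - p \<in> P" using unit[OF u_pos u_strict assms(3)] by blast
  have "f p \<le> f (r *\<^sub>Q u)" using r assms cone_scale[OF cone] u_pos by (intro pos_functional_mono) auto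
  then have "f p \<le> 0" using assms u_pos P_gen by (simp add: pos_functional_scale)
  then show ?thesis using pos_functional_nonneg[OF assms(1,3)] by simp
qed

lemma pos_functional_plus: "pos_functional f \<Longrightarrow> pos_functional g \<Longrightarrow> pos_functional (\<lambda>x. f x + g x)"
  by (auto simp: pos_functional_def)

lemma pos_functional_zero_fun: "pos_functional (\<lambda>x. 0)"
  by (auto simp: pos_functional_def)

lemma pos_functional_times: "pos_functional f \<Longrightarrow> 0 \<le> c \<Longrightarrow> pos_functional (\<lambda>x. c * f x)"
  by (auto simp: pos_functional_def algebra_simps)

lemma pos_functional_sum_fun: "(\<And>i. i \<in> A \<Longrightarrow> pos_functional (f i)) \<Longrightarrow> pos_functional (\<lambda>x. \<Sum>i\<in>A. f i x)"
  by (induction A rule: infinite_finite_induct) (auto intro: pos_functional_plus pos_functional_zero_fun)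

lemma pos_functional_minus: "pos_functional f \<Longrightarrow> pos_functional g \<Longrightarrow> (\<And>p. p \<in> P \<Longrightarrow> g p \<le> f p) \<Longrightarrow> pos_functional (\<lambda>x. f x - g x)"
  by (auto simp: pos_functional_def)

text \<open>If p - q = p' - q', then p + q' = p' + q, so additivity on P makes F p - F q depend on p
  - q only. This turns suprema over order intervals, which make sense on P alone, into
  functionals.\<close>

lemma pos_functional_extend:
  assumes add: "\<And>p q. p \<in> P \<Longrightarrow> q \<in> P \<Longrightarrow> F (p + q) = F p + F q"
    and nonneg: "\<And>p. p \<in> P \<Longrightarrow> 0 \<le> F p"
  obtains f where "pos_functional f" "\<And>p. p \<in> P \<Longrightarrow> f p = F p"
proof -
  have "\<exists>r. \<forall>p q. p \<in> P \<longrightarrow> q \<in> P \<longrightarrow> x = p - q \<longrightarrow> r = F p - F q" if x: "x \<in> gen P" for x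
  proof -
    obtain p q where pq: "p \<in> P" "q \<in> P" "x = p - q" using x by (auto simp: gen_def)
    have "F p - F q = F p' - F q'" if "p' \<in> P" "q' \<in> P" "x = p' - q'" for p' q'
    proof -
      have "p + q' = p' + q" using pq that by (simp add: algebra_simps)
      then show ?thesis using add[of p q'] add[of p' q] pq that by simp
    qed
    then show ?thesis by blast
  qed
  then obtain f where f: "\<And>x p q. x \<in> gen P \<Longrightarrow> p \<in> P \<Longrightarrow> q \<in> P \<Longrightarrow> x = p - q \<Longrightarrow> f x = F p - F q"
    by metis
  have F0: "F 0 = 0" using add[of 0 0] cone_zero[OF cone] by simp
  have fP: "f p = F p" if "p \<in> P" for p
    using f[of p p 0] that cone_zero[OF cone] F0 P_gen by simp
  have "f (x + y) = f x + f y" if xy: "x \<in> gen P" "y \<in> gen P" for x y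
  proof -
    obtain a b c d where h: "x = a - b" "y = c - d" "a \<in> P" "b \<in> P" "c \<in> P" "d \<in> P"
      using xy by (auto simp: gen_def)
    have "f (x + y) = F (a + c) - F (b + d)"
      using h xy by (intro f) (auto intro: cone_add[OF cone] subspace_add[OF gen_subspace])
    then show ?thesis using h xy f[of x a b] f[of y c d] add by simp
  qed
  then have "pos_functional f" using fP nonneg by (simp add: pos_functional_def)
  then show ?thesis using fP that by blast
qed

text \<open>The positive part of f - g in the lattice of functionals. The last clause is the
  Riesz-Kantorovich formula, y p = sup of f q - g q over 0 \<le> q \<le> p, in approximate form; it
  later supplies the separating elements.\<close>

definition pos_part :: "('v \<Rightarrow> real) \<Rightarrow> ('v \<Rightarrow> real) \<Rightarrow> ('v \<Rightarrow> real) \<Rightarrow> bool" where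
  "pos_part f g y \<longleftrightarrow> pos_functional y \<and> (\<forall>p\<in>P. f p - g p \<le> y p) \<and>
     (\<forall>z. pos_functional z \<longrightarrow> (\<forall>p\<in>P. f p - g p \<le> z p) \<longrightarrow> (\<forall>p\<in>P. y p \<le> z p)) \<and>
     (\<forall>p\<in>P. \<forall>e>0. \<exists>q\<in>P. p - q \<in> P \<and> y p - e < f q - g q)"

lemma pos_partD:
  assumes "pos_part f g y"
  shows "pos_functional y" "\<And>p. p \<in> P \<Longrightarrow> f p - g p \<le> y p"
    "\<And>z p. pos_functional z \<Longrightarrow> (\<And>p. p \<in> P \<Longrightarrow> f p - g p \<le> z p) \<Longrightarrow> p \<in> P \<Longrightarrow> y p \<le> z p"
    "\<And>p e. p \<in> P \<Longrightarrow> 0 < e \<Longrightarrow> \<exists>q\<in>P. p - q \<in> P \<and> y p - e < f q - g q"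
  using assms by (auto simp: pos_part_def)

text \<open>By Riesz decomposition, the supremum of \<open>f - g\<close> over the order interval \<open>[0, p]\<close> is additive in \<open>p\<close>.\<close>
lemma ex_pos_part:
  assumes f: "pos_functional f" and g: "pos_functional g"
  obtains y where "pos_part f g y"
proof -
  define D where "D p = (\<lambda>q. f q - g q) ` {q \<in> P. p - q \<in> P}" for p
  have ub: "d \<le> z p" if "pos_functional z" "\<And>p. p \<in> P \<Longrightarrow> f p - g p \<le> z p" "p \<in> P" "d \<in> D p" for d z p
    using that pos_functional_mono[OF that(1)] by (fastforce simp: D_def)
  have fub: "d \<le> f p" if "p \<in> P" "d \<in> D p" for d p
    by (rule ub[OF f _ that]) (use pos_functional_nonneg[OF g] in auto)
  have bdd: "bdd_above (D p)" if "p \<in> P" for p using fub[OF that] by (auto simp: bdd_above_def)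
  have zeroD: "0 \<in> D p" if "p \<in> P" for p
    using that cone_zero[OF cone] pos_functional_0[OF f] pos_functional_0[OF g] by (force simp: D_def)
  have selfD: "f p - g p \<in> D p" if "p \<in> P" for p
    using that cone_zero[OF cone] by (force simp: D_def)
  define Y where "Y p = Sup (D p)" for p
  have upper: "d \<le> Y p" if "p \<in> P" "d \<in> D p" for d p
    unfolding Y_def using that bdd by (intro cSup_upper) auto
  have least: "Y p \<le> c" if "p \<in> P" "\<And>d. d \<in> D p \<Longrightarrow> d \<le> c" for p c
    unfolding Y_def using that zeroD by (intro cSup_least) auto
  have approx: "\<exists>q\<in>P. p - q \<in> P \<and> Y p - e < f q - g q" if "p \<in> P" "0 < e" for p e
  proof -
    have "\<exists>d\<in>D p. Y p - e < d"
      unfolding Y_def using that zeroD by (intro less_cSupD) auto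
    then show ?thesis by (auto simp: D_def)
  qed
  have Yadd: "Y (a + b) = Y a + Y b" if a: "a \<in> P" and b: "b \<in> P" for a b
  proof (rule antisym)
    show "Y (a + b) \<le> Y a + Y b"
    proof (rule least)
      show "a + b \<in> P" using a b by (rule cone_add[OF cone])
      fix d assume "d \<in> D (a + b)"
      then obtain c where c: "c \<in> P" "a + b - c \<in> P" "d = f c - g c" by (auto simp: D_def)
      obtain x where x: "x \<in> P" "a - x \<in> P" "c - x \<in> P" "b - (c - x) \<in> P"
        using rieszE[OF riesz a b c(1,2)] .
      have "f x - g x \<le> Y a" "f (c - x) - g (c - x) \<le> Y b"
        using x a b by (auto intro!: upper simp: D_def)
      moreover have "d = (f x - g x) + (f (c - x) - g (c - x))"
        using c x P_gen by (simp add: pos_functional_diff f g)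
      ultimately show "d \<le> Y a + Y b" by simp
    qed
  next
    show "Y a + Y b \<le> Y (a + b)"
    proof (rule field_le_epsilon)
      fix e :: real assume "0 < e"
      then obtain q q' where q: "q \<in> P" "a - q \<in> P" "Y a - e/2 < f q - g q"
        and q': "q' \<in> P" "b - q' \<in> P" "Y b - e/2 < f q' - g q'"
        using approx[OF a, of "e/2"] approx[OF b, of "e/2"] by auto
      have "f (q + q') - g (q + q') \<in> D (a + b)"
        using q q' cone_add[OF cone, of q q'] cone_add[OF cone, of "a - q" "b - q'"]
        by (auto simp: D_def add_diff_add)
      then have "f (q + q') - g (q + q') \<le> Y (a + b)"
        using a b by (intro upper cone_add[OF cone])
      then show "Y a + Y b \<le> Y (a + b) + e"
        using q q' P_gen pos_functional_add[OF f, of q q'] pos_functional_add[OF g, of q q'] by (simp add: field_simps)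
    qed
  qed
  obtain y where y: "pos_functional y" "\<And>p. p \<in> P \<Longrightarrow> y p = Y p"
    using pos_functional_extend[of Y] Yadd upper zeroD by blast
  have "y p \<le> z p" if "pos_functional z" "\<forall>p\<in>P. f p - g p \<le> z p" "p \<in> P" for z p
    using that y ub[of z] least by (metis (no_types, lifting))
  then have "pos_part f g y" using y upper selfD approx by (simp add: pos_part_def)
  then show ?thesis by (rule that)
qed

end

text \<open>Let C be the largest of the |c j|. Applying the matrix changes each entry of c by at
  most k e C, and k e \<le> 1/2 gives C \<le> W + C/2, that is C \<le> 2 W. Coordinates are thus
  close to functional values.\<close>

lemma near_identity:
  fixes a :: "nat \<Rightarrow> nat \<Rightarrow> real"
  assumes a: "\<And>i j. i < k \<Longrightarrow> j < k \<Longrightarrow> \<bar>a i j - (if i = j then 1 else 0)\<bar> \<le> e"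
    and e: "real k * e \<le> 1 / 2"
    and W: "\<And>i. i < k \<Longrightarrow> \<bar>\<Sum>j<k. c j * a i j\<bar> \<le> W"
    and i: "i < k"
  shows "\<bar>c i - (\<Sum>j<k. c j * a i j)\<bar> \<le> 2 * real k * e * W"
proof -
  define C where "C = Max ((\<lambda>j. \<bar>c j\<bar>) ` {..<k})"
  have C: "\<bar>c j\<bar> \<le> C" if "j < k" for j unfolding C_def using that by (intro Max_ge) auto
  have "C \<in> (\<lambda>j. \<bar>c j\<bar>) ` {..<k}" unfolding C_def using i by (intro Max_in) auto
  then obtain m where m: "m < k" "C = \<bar>c m\<bar>" by auto
  have C0: "0 \<le> C" using m by simp
  have e0: "0 \<le> e" using a[OF i i] by simp
  have diff: "\<bar>c j - (\<Sum>l<k. c l * a j l)\<bar> \<le> real k * e * C" if j: "j < k" for j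
  proof -
    have "c j = (\<Sum>l<k. c l * (if j = l then 1 else 0))" using j by (simp add: if_distrib cong: if_cong)
    then have "c j - (\<Sum>l<k. c l * a j l) = (\<Sum>l<k. c l * ((if j = l then 1 else 0) - a j l))"
      by (simp add: sum_subtractf algebra_simps)
    also have "\<bar>\<dots>\<bar> \<le> (\<Sum>l<k. \<bar>c l * ((if j = l then 1 else 0) - a j l)\<bar>)" by (rule sum_abs)
    also have "\<dots> \<le> (\<Sum>l<k. C * e)"
    proof (rule sum_mono)
      fix l assume "l \<in> {..<k}"
      then show "\<bar>c l * ((if j = l then 1 else 0) - a j l)\<bar> \<le> C * e"
        using a[OF j, of l] C[of l] C0 unfolding abs_mult
        by (intro mult_mono) (auto simp: abs_minus_commute)
    qed
    finally show ?thesis by (simp add: algebra_simps)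
  qed
  have "real k * e * C \<le> (1/2) * C" using e C0 by (intro mult_right_mono) auto
  then have "C \<le> 2 * W" using diff[OF m(1)] W[OF m(1)] m(2) by linarith
  then have "real k * e * C \<le> real k * e * (2 * W)" using e0 by (intro mult_left_mono) auto
  then show ?thesis using diff[OF i] by simp
qed

section \<open>Separation of a point from a cone\<close>

context rat_space begin

lemma cone_adjoin:
  assumes "cone M" shows "cone {m + t *\<^sub>Q x |m t. m \<in> M \<and> 0 \<le> t}" (is "cone ?N")
  unfolding cone_def
proof (intro conjI ballI allI impI)
  show "0 \<in> ?N" using cone_zero[OF assms] by (intro CollectI exI[of _ 0]) simp
next
  fix y z assume "y \<in> ?N" "z \<in> ?N"
  then obtain m t n s where "y = m + t *\<^sub>Q x" "z = n + s *\<^sub>Q x" "m \<in> M" "n \<in> M" "0 \<le> t" "0 \<le> s"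
    by blast
  then show "y + z \<in> ?N" using cone_add[OF assms, of m n]
    by (intro CollectI exI[of _ "m + n"] exI[of _ "t + s"]) (simp add: algebra_simps scale_left_distrib)
next
  fix r :: rat and y assume "0 \<le> r" "y \<in> ?N"
  then obtain m t where "y = m + t *\<^sub>Q x" "m \<in> M" "0 \<le> t" by blast
  then show "r *\<^sub>Q y \<in> ?N" using cone_scale[OF assms \<open>0 \<le> r\<close>, of m] \<open>0 \<le> r\<close>
    by (intro CollectI exI[of _ "r *\<^sub>Q m"] exI[of _ "r * t"]) (simp add: scale_right_distrib)
qed

end

context simple_cone begin

text \<open>Zorn's lemma gives a cone M in \<open>gen P\<close> that contains P and -v and is
  maximal with -u not in M. Maximality makes the preorder of M total, and f x is the cut sup {r. r u
  \<le> x} in this preorder. Since -v is in M, f v \<le> 0.\<close>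

lemma hahn_banach:
  assumes v: "v \<in> gen P" "v \<notin> P"
  obtains f where "pos_functional f" "f u = 1" "f v \<le> 0"
proof -
  define \<A> where "\<A> = {M. cone M \<and> P \<subseteq> M \<and> M \<subseteq> gen P \<and> - v \<in> M \<and> - u \<notin> M}"
  have adjoin: "{m + t *\<^sub>Q x |m t. m \<in> M \<and> 0 \<le> t} \<in> \<A>"
    if "cone M" "P \<subseteq> M" "M \<subseteq> gen P" "x \<in> gen P" "- v \<in> {m + t *\<^sub>Q x |m t. m \<in> M \<and> 0 \<le> t}"
      "- u \<notin> {m + t *\<^sub>Q x |m t. m \<in> M \<and> 0 \<le> t}" for M x
  proof -
    have "m \<in> {m + t *\<^sub>Q x |m t. m \<in> M \<and> 0 \<le> t}" if "m \<in> M" for m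
      using that by (intro CollectI exI[of _ m] exI[of _ 0]) simp
    moreover have "m + t *\<^sub>Q x \<in> gen P" if "m \<in> M" for m t
      using that \<open>M \<subseteq> gen P\<close> \<open>x \<in> gen P\<close> subspace_add[OF gen_subspace] subspace_scale[OF gen_subspace]
      by blast
    ultimately show ?thesis unfolding \<A>_def using that cone_adjoin[OF that(1), of x] by blast
  qed
  have "{m + t *\<^sub>Q (- v) |m t. m \<in> P \<and> 0 \<le> t} \<in> \<A>"
  proof (rule adjoin)
    show "cone P" "P \<subseteq> P" "P \<subseteq> gen P" "- v \<in> gen P"
      using cone cone_subset_gen v subspace_neg[OF gen_subspace] by auto
    show "- v \<in> {m + t *\<^sub>Q (- v) |m t. m \<in> P \<and> 0 \<le> t}"
      using cone_zero[OF cone] by (intro CollectI exI[of _ 0] exI[of _ 1]) simp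
    \<comment> \<open>If -u = m - t v, then t v = m + u is positive. For t > 0 this puts v into P,
      and for t = 0 it puts -u into P.\<close>
    show "- u \<notin> {m + t *\<^sub>Q (- v) |m t. m \<in> P \<and> 0 \<le> t}"
    proof
      assume "- u \<in> {m + t *\<^sub>Q (- v) |m t. m \<in> P \<and> 0 \<le> t}"
      then obtain m t where mt: "- u = m + t *\<^sub>Q (- v)" "m \<in> P" "0 \<le> t" by blast
      have "t *\<^sub>Q v = m - (m + t *\<^sub>Q (- v))" by simp
      also have "\<dots> = m + u" using mt(1) by (metis diff_minus_eq_add)
      finally have "t *\<^sub>Q v = m + u" .
      then have "t *\<^sub>Q v \<in> P" using mt u_pos cone_add[OF cone] by simp
      moreover have "t \<noteq> 0" using mt u_strict by auto
      ultimately show False using v mt(3) cone_scale_iff[OF cone, of t v] by simp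
    qed
  qed
  then have "\<A> \<noteq> {}" by blast
  moreover have "\<Union>\<C> \<in> \<A>" if "\<C> \<noteq> {}" "subset.chain \<A> \<C>" for \<C>
  proof -
    have C: "M \<in> \<A>" if "M \<in> \<C>" for M using that \<open>subset.chain \<A> \<C>\<close> by (auto simp: subset.chain_def)
    have "x + y \<in> \<Union>\<C>" if xy: "x \<in> \<Union>\<C>" "y \<in> \<Union>\<C>" for x y
    proof -
      obtain M N where MN: "M \<in> \<C>" "N \<in> \<C>" "x \<in> M" "y \<in> N" using xy by blast
      then have "M \<subseteq> N \<or> N \<subseteq> M" using \<open>subset.chain \<A> \<C>\<close> by (auto simp: subset.chain_def)
      then have "\<exists>K\<in>\<C>. x \<in> K \<and> y \<in> K" using MN by blast
      then show ?thesis using C cone_add unfolding \<A>_def by blast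
    qed
    moreover have "0 \<in> \<Union>\<C>" using that(1) C cone_zero unfolding \<A>_def by blast
    moreover have "r *\<^sub>Q x \<in> \<Union>\<C>" if "x \<in> \<Union>\<C>" "0 \<le> r" for x r
      using that C cone_scale unfolding \<A>_def by blast
    ultimately have "cone (\<Union>\<C>)" by (simp add: cone_def)
    then show ?thesis using that(1) C unfolding \<A>_def by blast
  qed
  ultimately obtain M where M: "M \<in> \<A>" and max: "\<And>N. N \<in> \<A> \<Longrightarrow> M \<subseteq> N \<Longrightarrow> N = M"
    using subset_Zorn_nonempty[of \<A>] by blast
  have cM: "cone M" and PM: "P \<subseteq> M" and MU: "M \<subseteq> gen P" and vM: "- v \<in> M" and uM: "- u \<notin> M"
    using M by (auto simp: \<A>_def)
  have neg_u: "t *\<^sub>Q u \<notin> M" if "t < 0" for t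
  proof
    assume "t *\<^sub>Q u \<in> M"
    then have "(- t) *\<^sub>Q (- u) \<in> M" by simp
    then show False using that uM cone_scale_iff[OF cM, of "-t" "-u"] by simp
  qed
  \<comment> \<open>If neither x nor -x were in M, adjoining either of them would bring in -u.
    Eliminating x from the two resulting expressions gives a negative multiple of u inside
    M.\<close>
  have total: "x \<in> M \<or> - x \<in> M" if x: "x \<in> gen P" for x
  proof (rule ccontr)
    assume n: "\<not> (x \<in> M \<or> - x \<in> M)"
    have ex: "\<exists>m t. m \<in> M \<and> 0 < t \<and> - u = m + t *\<^sub>Q y" if y: "y \<in> gen P" "y \<notin> M" for y
    proof -
      let ?N = "{m + t *\<^sub>Q y |m t. m \<in> M \<and> 0 \<le> t}"
      have sub: "M \<subseteq> ?N"
      proof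
        fix m assume "m \<in> M" then show "m \<in> ?N" by (intro CollectI exI[of _ m] exI[of _ 0]) simp
      qed
      have "y \<in> ?N" using cone_zero[OF cM] by (intro CollectI exI[of _ 0] exI[of _ 1]) simp
      then have "?N \<notin> \<A>" using max[of ?N] sub y by blast
      then have "- u \<in> ?N" using adjoin[OF cM PM MU y(1)] sub vM by blast
      then obtain m t where "m \<in> M" "0 \<le> t" "- u = m + t *\<^sub>Q y" by blast
      moreover have "t \<noteq> 0" using calculation uM by auto
      ultimately show ?thesis by force
    qed
    obtain m t where 1: "m \<in> M" "0 < t" "- u = m + t *\<^sub>Q x" using ex[OF x] n by blast
    obtain l s where 2: "l \<in> M" "0 < s" "- u = l + s *\<^sub>Q (- x)"
      using ex[OF subspace_neg[OF gen_subspace x]] n by blast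
    have "(- (s + t)) *\<^sub>Q u = s *\<^sub>Q (- u) + t *\<^sub>Q (- u)" by (simp add: scale_left_distrib scale_left_diff_distrib)
    also have "\<dots> = s *\<^sub>Q (m + t *\<^sub>Q x) + t *\<^sub>Q (l + s *\<^sub>Q (- x))" using 1(3) 2(3) by metis
    also have "\<dots> = s *\<^sub>Q m + t *\<^sub>Q l" by (simp add: algebra_simps scale_right_distrib)
    also have "\<dots> \<in> M" using 1 2 by (intro cone_add[OF cM] cone_scale[OF cM]) auto
    finally have "(- (s + t)) *\<^sub>Q u \<in> M" .
    then show False using neg_u[of "- (s + t)"] 1 2 by simp
  qed
  define D where "D x = real_of_rat ` {r. x - r *\<^sub>Q u \<in> M}" for x
  define f :: "'v \<Rightarrow> real" where "f x = Sup (D x)" for x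
  have order: "r \<le> s" if "x - r *\<^sub>Q u \<in> M" "s *\<^sub>Q u - x \<in> M" for x r s
  proof -
    have "(s - r) *\<^sub>Q u = (x - r *\<^sub>Q u) + (s *\<^sub>Q u - x)" by (simp add: scale_left_diff_distrib)
    then have "(s - r) *\<^sub>Q u \<in> M" using that cone_add[OF cM] by metis
    then show ?thesis using neg_u[of "s - r"] by force
  qed
  have bounds: "\<exists>r. r *\<^sub>Q u - x \<in> M" if x: "x \<in> gen P" for x
  proof -
    obtain a b where ab: "x = a - b" "a \<in> P" "b \<in> P" using x by (auto simp: gen_def)
    obtain r where "r *\<^sub>Q u - a \<in> P" using unit[OF u_pos u_strict ab(2)] by blast
    then have "(r *\<^sub>Q u - a) + b \<in> M" using PM ab cone_add[OF cM] by blast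
    moreover have "r *\<^sub>Q u - x = (r *\<^sub>Q u - a) + b" by (simp add: ab(1))
    ultimately show ?thesis by metis
  qed
  have bdd: "bdd_above (D x)" if x: "x \<in> gen P" for x
  proof -
    obtain s where "s *\<^sub>Q u - x \<in> M" using bounds[OF x] by blast
    then have "d \<le> of_rat s" if "d \<in> D x" for d
      using that order by (auto simp: D_def of_rat_less_eq)
    then show ?thesis by (auto simp: bdd_above_def)
  qed
  have nonempty: "D x \<noteq> {}" if x: "x \<in> gen P" for x
  proof -
    obtain s where "s *\<^sub>Q u - (- x) \<in> M" using bounds[OF subspace_neg[OF gen_subspace x]] by blast
    then have "x - (- s) *\<^sub>Q u \<in> M" by (simp add: add.commute)
    then have "of_rat (- s) \<in> D x" unfolding D_def by blast
    then show ?thesis by blast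
  qed
  have lower: "of_rat r \<le> f x" if "x \<in> gen P" "x - r *\<^sub>Q u \<in> M" for r x
    unfolding f_def using that bdd by (intro cSup_upper) (auto simp: D_def)
  have upper: "f x \<le> of_rat s" if "x \<in> gen P" "s *\<^sub>Q u - x \<in> M" for s x
    unfolding f_def using that order nonempty by (intro cSup_least) (auto simp: D_def of_rat_less_eq)
  have above: "s *\<^sub>Q u - x \<in> M" if "x \<in> gen P" "f x < of_rat s" for x s
    using total[of "x - s *\<^sub>Q u"] lower[OF that(1), of s] that P_gen[OF u_pos]
      subspace_diff[OF gen_subspace] subspace_scale[OF gen_subspace] by fastforce
  have below: "x - s *\<^sub>Q u \<in> M" if "x \<in> gen P" "of_rat s < f x" for x s
    using total[of "x - s *\<^sub>Q u"] upper[OF that(1), of s] that P_gen[OF u_pos]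
      subspace_diff[OF gen_subspace] subspace_scale[OF gen_subspace] by fastforce
  have add: "f (x + y) = f x + f y" if x: "x \<in> gen P" and y: "y \<in> gen P" for x y
  proof (rule antisym)
    have xy: "x + y \<in> gen P" using x y by (rule subspace_add[OF gen_subspace])
    show "f (x + y) \<le> f x + f y"
    proof (rule field_le_epsilon)
      fix e :: real assume "0 < e"
      then obtain r s where rs: "f x < of_rat r" "of_rat r < f x + e/2" "f y < of_rat s" "of_rat s < f y + e/2"
        using of_rat_dense[of "f x" "f x + e/2"] of_rat_dense[of "f y" "f y + e/2"] by auto
      have "(r *\<^sub>Q u - x) + (s *\<^sub>Q u - y) \<in> M" using above[OF x] above[OF y] rs cone_add[OF cM] by blast
      then have "(r + s) *\<^sub>Q u - (x + y) \<in> M" by (simp add: scale_left_distrib algebra_simps)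
      then show "f (x + y) \<le> f x + f y + e" using upper[OF xy] rs by (fastforce simp: of_rat_add)
    qed
    show "f x + f y \<le> f (x + y)"
    proof (rule field_le_epsilon)
      fix e :: real assume "0 < e"
      then obtain r s where rs: "f x - e/2 < of_rat r" "of_rat r < f x" "f y - e/2 < of_rat s" "of_rat s < f y"
        using of_rat_dense[of "f x - e/2" "f x"] of_rat_dense[of "f y - e/2" "f y"] by auto
      have "(x - r *\<^sub>Q u) + (y - s *\<^sub>Q u) \<in> M" using below[OF x] below[OF y] rs cone_add[OF cM] by blast
      then have "(x + y) - (r + s) *\<^sub>Q u \<in> M" by (simp add: scale_left_distrib algebra_simps)
      then show "f x + f y \<le> f (x + y) + e" using lower[OF xy] rs by (fastforce simp: of_rat_add)
    qed
  qed
  have "0 \<le> f p" if "p \<in> P" for p using lower[of p 0] that PM P_gen by auto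
  then have "pos_functional f" using add by (simp add: pos_functional_def)
  moreover have "f u = 1"
    using lower[of u 1] upper[of u 1] P_gen[OF u_pos] cone_zero[OF cM] by simp
  moreover have "f v \<le> 0" using upper[of v 0] v vM by simp
  ultimately show ?thesis using that by blast
qed

text \<open>The infimum of f and g is zero: for a positive functional m, \<open>m u = 0\<close>
  already means that m vanishes on P.\<close>

definition disj :: "('v \<Rightarrow> real) \<Rightarrow> ('v \<Rightarrow> real) \<Rightarrow> bool" where
  "disj f g \<longleftrightarrow> (\<forall>m. pos_functional m \<longrightarrow> (\<forall>p\<in>P. m p \<le> f p) \<longrightarrow> (\<forall>p\<in>P. m p \<le> g p) \<longrightarrow> m u = 0)"

definition disj_family :: "nat \<Rightarrow> (nat \<Rightarrow> 'v \<Rightarrow> real) \<Rightarrow> bool" where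
  "disj_family k f \<longleftrightarrow> (\<forall>i<k. pos_functional (f i) \<and> 0 < f i u) \<and> (\<forall>i<k. \<forall>j<k. i \<noteq> j \<longrightarrow> disj (f i) (f j))"

lemma disj_mono:
  assumes "disj f g" "\<And>p. p \<in> P \<Longrightarrow> f' p \<le> f p" "\<And>p. p \<in> P \<Longrightarrow> g' p \<le> g p"
  shows "disj f' g'"
  unfolding disj_def
proof (intro allI impI)
  fix m assume "pos_functional m" "\<forall>p\<in>P. m p \<le> f' p" "\<forall>p\<in>P. m p \<le> g' p"
  then show "m u = 0" using assms(1)[unfolded disj_def, rule_format, of m] assms(2,3)
    by (meson order_trans)
qed

lemma disj_sym: "disj f g \<Longrightarrow> disj g f"
  by (auto simp: disj_def)

text \<open>y and y' are the positive and negative parts of f - g. A common minorant m could be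
  subtracted from y while keeping it above f - g, so minimality of y gives m u = 0.\<close>

lemma pos_neg_disj:
  assumes f: "pos_functional f" and g: "pos_functional g"
  obtains y y' where "pos_functional y" "pos_functional y'" "disj y y'" "\<And>p. p \<in> P \<Longrightarrow> y p - y' p = f p - g p"
    "\<And>p. p \<in> P \<Longrightarrow> y p \<le> f p" "\<And>p. p \<in> P \<Longrightarrow> y' p \<le> g p"
proof -
  obtain y where "pos_part f g y" using ex_pos_part[OF f g] .
  note y = pos_partD[OF this]
  have yf: "y p \<le> f p" if "p \<in> P" for p
    using y(3)[OF f _ that] pos_functional_nonneg[OF g] by simp
  define y' where "y' x = (y x + g x) - f x" for x
  have y': "pos_functional y'" unfolding y'_def using y(1,2)
    by (intro pos_functional_minus pos_functional_plus f g) (auto simp: algebra_simps)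
  have "disj y y'"
    unfolding disj_def
  proof (intro allI impI)
    fix m assume m: "pos_functional m" "\<forall>p\<in>P. m p \<le> y p" "\<forall>p\<in>P. m p \<le> y' p"
    have "y u \<le> y u - m u"
      by (rule y(3)[OF pos_functional_minus[OF y(1) m(1)]]) (use m u_pos in \<open>auto simp: y'_def\<close>)
    then show "m u = 0" using pos_functional_nonneg[OF m(1) u_pos] by simp
  qed
  then show ?thesis using y y' yf by (intro that[of y y']) (auto simp: y'_def)
qed

text \<open>Let m \<le> f lie below g a + h, with h the sum over A. The positive part of m - g a
  lies below h and below m, hence is zero by induction; what is left of m lies below g a and below
  f.\<close>

lemma disj_sum:
  assumes "finite A" "\<And>i. i \<in> A \<Longrightarrow> pos_functional (g i)" "\<And>i. i \<in> A \<Longrightarrow> disj f (g i)"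
  shows "disj f (\<lambda>x. \<Sum>i\<in>A. g i x)"
  using assms
proof (induction A)
  case empty
  show ?case unfolding disj_def using pos_functional_nonneg u_pos by (auto intro: antisym)
next
  case (insert a A)
  let ?h = "\<lambda>x. \<Sum>i\<in>A. g i x"
  have h: "pos_functional ?h" using insert by (intro pos_functional_sum_fun) auto
  show ?case unfolding disj_def
  proof (intro allI impI)
    fix m assume m: "pos_functional m" "\<forall>p\<in>P. m p \<le> f p" "\<forall>p\<in>P. m p \<le> (\<Sum>i\<in>insert a A. g i p)"
    have ga: "pos_functional (g a)" using insert by simp
    obtain y where "pos_part m (g a) y" using ex_pos_part[OF m(1) ga] .
    note y = pos_partD[OF this]
    have ym: "y p \<le> m p" if "p \<in> P" for p
      using y(3)[OF m(1) _ that] pos_functional_nonneg[of "g a"] insert by simp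
    have yh: "y p \<le> ?h p" if "p \<in> P" for p
      using y(3)[OF h _ that] m(3) insert by (simp add: algebra_simps)
    have "disj f ?h" using insert by blast
    then have "y u = 0"
      unfolding disj_def using y(1) ym yh m(2) by (meson order_trans)
    moreover have "pos_functional (\<lambda>x. m x - y x)" using m y ym by (intro pos_functional_minus)
    then have "m u - y u = 0"
      using insert.prems(2)[of a] m y pos_functional_nonneg[OF y(1)] unfolding disj_def
      by (smt (verit, best) insertI1)
    ultimately show "m u = 0" by simp
  qed
qed

text \<open>As f j is disjoint from the sum g of the others, the positive part of f j - g takes the
  same value at u as f j. Its approximation clause gives q with 0 \<le> q \<le> u and f j q - g q >
  f j u - e. So f j q is within e of f j u, and every other f i q is below e.\<close>

lemma separators:
  assumes fam: "disj_family k f" and e: "0 < e"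
  obtains x where "\<And>j. j < k \<Longrightarrow> x j \<in> P" "\<And>i j. i < k \<Longrightarrow> j < k \<Longrightarrow> \<bar>f i (x j) - (if i = j then f i u else 0)\<bar> \<le> e"
proof -
  have "\<exists>q\<in>P. \<forall>i<k. \<bar>f i q - (if i = j then f i u else 0)\<bar> \<le> e" if j: "j < k" for j
  proof -
    define g where "g = (\<lambda>x. \<Sum>i\<in>{..<k}-{j}. f i x)"
    have pos_functional: "pos_functional (f i)" if "i < k" for i using fam that by (simp add: disj_family_def)
    have g: "pos_functional g" unfolding g_def using pos_functional by (intro pos_functional_sum_fun) auto
    have dis: "disj (f j) g" unfolding g_def using fam j by (intro disj_sum) (auto simp: disj_family_def)
    obtain y where "pos_part (f j) g y" using ex_pos_part[OF pos_functional[OF j] g] .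
    note y = pos_partD[OF this]
    have yf: "y p \<le> f j p" if "p \<in> P" for p
      using y(3)[OF pos_functional[OF j] _ that] pos_functional_nonneg[OF g] by simp
    have "pos_functional (\<lambda>x. f j x - y x)" using y yf pos_functional[OF j] by (intro pos_functional_minus)
    moreover have "\<forall>p\<in>P. f j p - y p \<le> f j p" using pos_functional_nonneg[OF y(1)] by simp
    moreover have "\<forall>p\<in>P. f j p - y p \<le> g p" using y(2) by (simp add: algebra_simps)
    ultimately have "f j u - y u = 0" using dis unfolding disj_def by blast
    then obtain q where q: "q \<in> P" "u - q \<in> P" "f j u - e < f j q - g q"
      using y(4)[OF u_pos e] by auto
    have fu: "f j q \<le> f j u" using q u_pos pos_functional[OF j] by (intro pos_functional_mono) auto
    have gq: "f i q \<le> g q" if "i < k" "i \<noteq> j" for i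
      unfolding g_def using that pos_functional_nonneg[OF pos_functional q(1)]
      by (intro member_le_sum[of i _ "\<lambda>i. f i q"]) auto
    have "\<bar>f i q - (if i = j then f i u else 0)\<bar> \<le> e" if "i < k" for i
      using gq[OF that] fu q(3) pos_functional_nonneg[OF g q(1)] pos_functional_nonneg[OF pos_functional[OF that] q(1)] by auto
    then show ?thesis using q(1) by blast
  qed
  then obtain x where "\<And>j. j < k \<Longrightarrow> x j \<in> P \<and> (\<forall>i<k. \<bar>f i (x j) - (if i = j then f i u else 0)\<bar> \<le> e)"
    by metis
  then show ?thesis by (intro that[of x]) auto
qed

end

section \<open>Maximal disjoint families\<close>

text \<open>An exact solution would be real in general, so w is approached by iterated correction.
  If the residual is at most E, round it to rationals with error E/8 and add these to the
  coefficients. The new residual is at most E/8 + (9/8) E/4 < E/2.\<close>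

lemma near_identity_approx:
  fixes a :: "nat \<Rightarrow> nat \<Rightarrow> real" and w :: "nat \<Rightarrow> real"
  assumes a: "\<And>i j. i < k \<Longrightarrow> j < k \<Longrightarrow> \<bar>a i j - (if i = j then 1 else 0)\<bar> \<le> e"
    and e: "real k * e \<le> 1 / 4" and eta: "0 < eta"
  obtains r :: "nat \<Rightarrow> rat" where "\<And>i. i < k \<Longrightarrow> \<bar>w i - (\<Sum>j<k. of_rat (r j) * a i j)\<bar> \<le> eta"
proof -
  define D where "D = 1 + (\<Sum>i<k. \<bar>w i\<bar>)"
  have D: "0 < D" by (simp add: D_def add_pos_nonneg sum_nonneg)
  have step: "\<exists>r. \<forall>i<k. \<bar>w i - (\<Sum>j<k. of_rat (r j) * a i j)\<bar> \<le> D / 2 ^ t" for t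
  proof (induction t)
    case 0
    have "\<bar>w i\<bar> \<le> D" if "i < k" for i
      using that member_le_sum[of i "{..<k}" "\<lambda>i. \<bar>w i\<bar>"] by (simp add: D_def)
    then show ?case by (intro exI[of _ "\<lambda>_. 0"]) simp
  next
    case (Suc t)
    then obtain r where r: "\<forall>i<k. \<bar>w i - (\<Sum>j<k. of_rat (r j) * a i j)\<bar> \<le> D / 2 ^ t" by blast
    define E where "E = D / 2 ^ t"
    define v where "v i = w i - (\<Sum>j<k. of_rat (r j) * a i j)" for i
    have E: "0 < E" using D by (simp add: E_def)
    have v: "\<bar>v i\<bar> \<le> E" if "i < k" for i using r that by (simp add: v_def E_def)
    have "\<exists>q. \<bar>v i - of_rat q\<bar> \<le> E / 8" for i
      using of_rat_dense[of "v i - E/8" "v i + E/8"] E by (smt (verit) divide_pos_pos)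
    then obtain q where q: "\<And>i. \<bar>v i - of_rat (q i)\<bar> \<le> E / 8" by metis
    have "\<bar>w i - (\<Sum>j<k. of_rat (r j + q j) * a i j)\<bar> \<le> E / 2" if i: "i < k" for i
    proof -
      have "of_rat (q i) = (\<Sum>j<k. of_rat (q j) * (if i = j then 1 else 0) :: real)"
        using i by (simp add: if_distrib cong: if_cong)
      then have "w i - (\<Sum>j<k. of_rat (r j + q j) * a i j)
          = (v i - of_rat (q i)) - (\<Sum>j<k. of_rat (q j) * (a i j - (if i = j then 1 else 0)))"
        by (simp add: v_def of_rat_add algebra_simps sum.distrib sum_subtractf)
      moreover have "\<bar>\<Sum>j<k. of_rat (q j) * (a i j - (if i = j then 1 else 0))\<bar> \<le> (\<Sum>j<k. 9/8 * E * e)"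
      proof (rule order_trans[OF sum_abs sum_mono])
        fix j assume "j \<in> {..<k}"
        then have "j < k" by simp
        have "\<bar>real_of_rat (q j)\<bar> \<le> 9/8 * E" using q[of j] v[OF \<open>j < k\<close>] by linarith
        then show "\<bar>real_of_rat (q j) * (a i j - (if i = j then 1 else 0))\<bar> \<le> 9/8 * E * e"
          unfolding abs_mult using a[OF i \<open>j < k\<close>] E by (intro mult_mono) auto
      qed
      moreover have "(\<Sum>j<k. 9/8 * E * e) \<le> 9/8 * E * (1/4)"
        using e E mult_left_mono[OF e, of "9/8 * E"] by (simp add: algebra_simps)
      ultimately show ?thesis using q[of i] E by linarith
    qed
    then show ?case by (intro exI[of _ "\<lambda>j. r j + q j"]) (simp add: E_def mult.commute)
  qed
  obtain t :: nat where t: "D / eta < 2 ^ t" using real_arch_pow[of 2 "D / eta"] by auto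
  then have "D / 2 ^ t \<le> eta" using eta by (simp add: field_simps)
  then show ?thesis using step[of t] that by (meson order_trans)
qed

context rat_space begin

text \<open>The rank bound provides a largest independent family in P that extends x. Any further p
  in P makes it dependent, with a nonzero coefficient at p itself.\<close>

lemma indep_extend:
  assumes P: "cone P" and rank: "rank_le P m"
    and x: "\<And>i. i < k \<Longrightarrow> x i \<in> P" and ind: "indep_mod (lineality P) k x"
  obtains d b where "k \<le> d" "d \<le> m" "\<And>i. i < d \<Longrightarrow> b i \<in> P" "\<And>i. i < k \<Longrightarrow> b i = x i"
    "indep_mod (lineality P) d b"
    "\<And>p. p \<in> P \<Longrightarrow> \<exists>c. p - (\<Sum>i<d. c i *\<^sub>Q b i) \<in> lineality P"
proof -
  let ?L = "lineality P"
  define Q where "Q d \<longleftrightarrow> (\<exists>b. k \<le> d \<and> (\<forall>i<d. b i \<in> P) \<and> (\<forall>i<k. b i = x i) \<and> indep_mod ?L d b)" for d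
  have "Q k" using x ind by (auto simp: Q_def)
  moreover have "\<forall>d. Q d \<longrightarrow> d \<le> m" using rank by (auto simp: Q_def rank_le_def)
  ultimately obtain d where "Q d" and dmax: "\<And>d'. Q d' \<Longrightarrow> d' \<le> d"
    using ex_has_greatest_nat[of Q k "\<lambda>d. d" "Suc m"] by (auto simp: less_Suc_eq_le)
  then obtain b where b: "k \<le> d" "\<And>i. i < d \<Longrightarrow> b i \<in> P" "\<And>i. i < k \<Longrightarrow> b i = x i" "indep_mod ?L d b"
    unfolding Q_def by metis
  have "\<exists>c. p - (\<Sum>i<d. c i *\<^sub>Q b i) \<in> ?L" if p: "p \<in> P" for p
  proof -
    have "\<not> Q (Suc d)" using dmax[of "Suc d"] by auto
    moreover have "k \<le> Suc d" "\<forall>i<Suc d. (b(d := p)) i \<in> P" "\<forall>i<k. (b(d := p)) i = x i"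
      using b p by (auto simp: less_Suc_eq)
    ultimately have "\<not> indep_mod ?L (Suc d) (b(d := p))" unfolding Q_def by blast
    then obtain c where c: "(\<Sum>i<Suc d. c i *\<^sub>Q (b(d := p)) i) \<in> ?L" "\<exists>i<Suc d. c i \<noteq> 0"
      by (auto simp: indep_mod_def)
    have sum: "(\<Sum>i<Suc d. c i *\<^sub>Q (b(d := p)) i) = (\<Sum>i<d. c i *\<^sub>Q b i) + c d *\<^sub>Q p" by simp
    have "c d \<noteq> 0"
    proof
      assume "c d = 0"
      then have "\<forall>i<d. c i = 0" using c(1) b(4) sum by (simp add: indep_mod_def)
      then show False using c(2) \<open>c d = 0\<close> by (auto simp: less_Suc_eq)
    qed
    moreover have "inverse (c d) *\<^sub>Q ((\<Sum>i<d. c i *\<^sub>Q b i) + c d *\<^sub>Q p) \<in> ?L"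
      using c(1) unfolding sum by (rule subspace_scale[OF subspace_lineality[OF P]])
    ultimately have "p - (\<Sum>i<d. (- inverse (c d) * c i) *\<^sub>Q b i) \<in> ?L"
      by (simp add: scale_right_distrib scale_sum_right sum_negf add.commute)
    then show ?thesis by (rule exI[of _ "\<lambda>i. - inverse (c d) * c i"])
  qed
  moreover have "d \<le> m" using \<open>Q d\<close> rank by (auto simp: Q_def rank_le_def)
  ultimately show ?thesis by (intro that[OF b(1) _ b(2,3,4)])
qed

end

context simple_cone begin

lemma disj_family_extend:
  assumes "disj_family k f" "pos_functional h" "0 < h u" "\<And>i. i < k \<Longrightarrow> disj h (f i)"
  shows "disj_family (Suc k) (f(k := h))"
  using assms(1-3) assms(4) assms(4)[THEN disj_sym] by (auto simp: disj_family_def less_Suc_eq)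

text \<open>Disjointness from the other members is inherited by everything below f i, so two
  disjoint pieces of f i can take its place. This produces the contradictions to maximality.\<close>

lemma disj_family_split:
  assumes fam: "disj_family k f" and i: "i < k" and y: "pos_functional y" "0 < y u" "\<And>p. p \<in> P \<Longrightarrow> y p \<le> f i p"
    and y': "pos_functional y'" "0 < y' u" "\<And>p. p \<in> P \<Longrightarrow> y' p \<le> f i p" and d: "disj y y'"
  shows "disj_family (Suc k) ((f(i := y))(k := y'))"
proof (rule disj_family_extend)
  have disj: "disj (f i) (f j)" if "j < k" "j \<noteq> i" for j using fam i that by (auto simp: disj_family_def)
  have "disj y (f j)" "disj y' (f j)" if "j < k" "j \<noteq> i" for j
    using disj_mono[OF disj[OF that]] y y' by auto
  then show "disj_family k (f(i := y))" "\<And>j. j < k \<Longrightarrow> disj y' ((f(i := y)) j)"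
    using fam y d disj_sym by (auto simp: disj_family_def)
qed (use y' in auto)

text \<open>With r = g u / f i u, the positive and negative parts of g - r f i agree at u. If they
  were nonzero, they would split f i into two disjoint functionals and give a larger family. The
  larger family does not contain f i, which is why maximality refers to the number of members and
  not to inclusion.\<close>

lemma maximal_family_atom:
  assumes fam: "disj_family k f" and max: "\<And>f'. \<not> disj_family (Suc k) f'" and i: "i < k"
    and g: "pos_functional g" "\<And>p. p \<in> P \<Longrightarrow> g p \<le> f i p" and p: "p \<in> P"
  shows "g p = g u / f i u * f i p"
proof -
  define r where "r = g u / f i u"
  have fi: "pos_functional (f i)" "0 < f i u" using fam i by (auto simp: disj_family_def)
  have r: "0 \<le> r" "r \<le> 1" using g fi u_pos pos_functional_nonneg[OF g(1) u_pos] by (auto simp: r_def)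
  have rf: "pos_functional (\<lambda>x. r * f i x)" using fi r by (intro pos_functional_times)
  obtain y y' where y: "pos_functional y" "pos_functional y'" "disj y y'" "\<And>p. p \<in> P \<Longrightarrow> y p - y' p = g p - r * f i p"
    "\<And>p. p \<in> P \<Longrightarrow> y p \<le> g p" "\<And>p. p \<in> P \<Longrightarrow> y' p \<le> r * f i p"
    using pos_neg_disj[OF g(1) rf] by blast
  have eq: "y u = y' u" using y(4)[OF u_pos] fi by (simp add: r_def)
  have rf1: "r * f i q \<le> f i q" if "q \<in> P" for q
    using mult_right_mono[OF r(2) pos_functional_nonneg[OF fi(1) that]] by simp
  have "\<not> (0 < y u)"
  proof
    assume "0 < y u"
    then have "disj_family (Suc k) ((f(i := y))(k := y'))"
      using y eq order_trans[OF y(5) g(2)] order_trans[OF y(6) rf1]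
      by (intro disj_family_split[OF fam i]) simp_all
    then show False using max by blast
  qed
  then have "y u = 0" "y' u = 0" using eq pos_functional_nonneg[OF y(1) u_pos] by auto
  then show ?thesis using y(4)[OF p] pos_functional_zero[OF y(1) _ p] pos_functional_zero[OF y(2) _ p] by (simp add: r_def)
qed

text \<open>What remains after subtracting the largest multiple of the atom \<open>f i\<close> has no common part with it.\<close>
lemma maximal_family_peel:
  assumes fam: "disj_family k f" and max: "\<And>f'. \<not> disj_family (Suc k) f'" and g: "pos_functional g"
    and i: "i \<le> k"
  shows "\<exists>c h. pos_functional h \<and> (\<forall>j<i. 0 \<le> c j \<and> disj h (f j)) \<and> (\<forall>p\<in>P. g p = (\<Sum>j<i. c j * f j p) + h p)"
  using i
proof (induction i)
  case 0
  show ?case using g by (intro exI[of _ "\<lambda>_. 0"] exI[of _ g]) auto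
next
  case (Suc i)
  then obtain c h where h: "pos_functional h" "\<forall>j<i. 0 \<le> c j \<and> disj h (f j)" "\<forall>p\<in>P. g p = (\<Sum>j<i. c j * f j p) + h p"
    by auto
  have fi: "pos_functional (f i)" "0 < f i u" using fam Suc.prems by (auto simp: disj_family_def)
  define T where "T = {t. 0 \<le> t \<and> (\<forall>p\<in>P. t * f i p \<le> h p)}"
  define t where "t = Sup T"
  have bdd: "bdd_above T"
    by (rule bdd_aboveI[of _ "h u / f i u"]) (use fi u_pos in \<open>auto simp: T_def field_simps\<close>)
  have T0: "0 \<in> T" using pos_functional_nonneg[OF h(1)] by (simp add: T_def)
  have t0: "0 \<le> t" unfolding t_def using T0 bdd by (rule cSup_upper)
  have tf: "t * f i p \<le> h p" if p: "p \<in> P" for p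
  proof (cases "f i p = 0")
    case True
    then show ?thesis using pos_functional_nonneg[OF h(1) p] by simp
  next
    case False
    then have "0 < f i p" using pos_functional_nonneg[OF fi(1) p] by simp
    moreover have "t \<le> h p / f i p" unfolding t_def
      using T0 calculation p by (intro cSup_least) (auto simp: T_def field_simps)
    ultimately show ?thesis by (simp add: field_simps)
  qed
  define h' where "h' x = h x - t * f i x" for x
  have h': "pos_functional h'" unfolding h'_def using h(1) fi t0 tf by (intro pos_functional_minus pos_functional_times)
  have h'h: "h' p \<le> h p" if "p \<in> P" for p
    using mult_nonneg_nonneg[OF t0 pos_functional_nonneg[OF fi(1) that]] by (simp add: h'_def)
  have "disj h' (f i)" unfolding disj_def
  proof (intro allI impI)
    fix m assume m: "pos_functional m" "\<forall>p\<in>P. m p \<le> h' p" "\<forall>p\<in>P. m p \<le> f i p"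
    \<comment> \<open>The common minorant m lies below the atom, so it is s times f i. Then t + s
      belongs to T, and t = Sup T forces s = 0.\<close>
    define s where "s = m u / f i u"
    have s: "0 \<le> s" using pos_functional_nonneg[OF m(1) u_pos] fi by (simp add: s_def)
    have "m p = s * f i p" if "p \<in> P" for p
      unfolding s_def using maximal_family_atom[OF fam max _ m(1) _ that] Suc.prems m(3) by simp
    then have "(t + s) * f i p \<le> h p" if "p \<in> P" for p
      using m(2) that by (auto simp: h'_def algebra_simps)
    then have "t + s \<in> T" using s t0 by (simp add: T_def)
    then have "t + s \<le> t" unfolding t_def using bdd by (rule cSup_upper)
    then show "m u = 0" using s fi by (simp add: s_def field_simps)
  qed
  moreover have "disj h' (f j)" if "j < i" for j
    using disj_mono[of h "f j" h' "f j"] h(2) that h'h by auto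
  moreover have h'eq: "h p = h' p + t * f i p" for p by (simp add: h'_def)
  ultimately show ?case using h h' t0
    by (intro exI[of _ "c(i := t)"] exI[of _ h']) (auto simp: less_Suc_eq h'eq)
qed

text \<open>Otherwise some g with g u = 1 and g v \<le> 0 separates v from P. Peeling writes g as a
  nonnegative combination of the f j plus a rest disjoint from all of them, which is zero by
  maximality. Since all f j v are positive, every coefficient vanishes, and so does g u.\<close>

lemma maximal_family_criterion:
  assumes fam: "disj_family k f" and max: "\<And>f'. \<not> disj_family (Suc k) f'"
    and v: "v \<in> gen P" and pos: "\<And>i. i < k \<Longrightarrow> 0 < f i v"
  shows "v \<in> P"
proof (rule ccontr)
  assume "v \<notin> P"
  then obtain g where g: "pos_functional g" "g u = 1" "g v \<le> 0" using hahn_banach[OF v] by blast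
  obtain c h where h: "pos_functional h" "\<And>j. j < k \<Longrightarrow> 0 \<le> c j" "\<And>j. j < k \<Longrightarrow> disj h (f j)"
    "\<And>p. p \<in> P \<Longrightarrow> g p = (\<Sum>j<k. c j * f j p) + h p"
    using maximal_family_peel[OF fam max g(1), of k] by blast
  have "h u = 0"
    using disj_family_extend[OF fam h(1) _ h(3)] max pos_functional_nonneg[OF h(1) u_pos] by fastforce
  then have gP: "g p = (\<Sum>j<k. c j * f j p)" if "p \<in> P" for p
    using h(4)[OF that] pos_functional_zero[OF h(1) _ that] by simp
  have f: "pos_functional (f j)" if "j < k" for j using fam that by (simp add: disj_family_def)
  obtain a b where ab: "v = a - b" "a \<in> P" "b \<in> P" using v by (auto simp: gen_def)
  have "g v = (\<Sum>j<k. c j * f j v)"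
    using ab P_gen f by (simp add: pos_functional_diff g(1) gP right_diff_distrib sum_subtractf)
  moreover have terms: "0 \<le> c j * f j v" if "j < k" for j using that h(2) pos by (simp add: order_less_imp_le)
  ultimately have "(\<Sum>j<k. c j * f j v) = 0" using g(3) sum_nonneg[of "{..<k}" "\<lambda>j. c j * f j v"] by simp
  then have "c j * f j v = 0" if "j < k" for j
    using that terms by (subst (asm) sum_nonneg_eq_0_iff) auto
  then have "c j = 0" if "j < k" for j using that pos by fastforce
  then have "g u = 0" using gP[OF u_pos] by simp
  then show False using g(2) by simp
qed

lemma separators_normalized:
  assumes fam: "disj_family k f" and e: "0 < e"
  obtains x where "\<And>j. j < k \<Longrightarrow> x j \<in> P"
    "\<And>i j. i < k \<Longrightarrow> j < k \<Longrightarrow> \<bar>f i (x j) / f i u - (if i = j then 1 else 0)\<bar> \<le> e"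
proof -
  define \<mu> where "\<mu> = Min (insert 1 ((\<lambda>i. f i u) ` {..<k}))"
  have fu: "0 < f i u" if "i < k" for i using fam that by (simp add: disj_family_def)
  then have "0 < \<mu>" by (auto simp: \<mu>_def)
  then obtain x where x: "\<And>j. j < k \<Longrightarrow> x j \<in> P"
    "\<And>i j. i < k \<Longrightarrow> j < k \<Longrightarrow> \<bar>f i (x j) - (if i = j then f i u else 0)\<bar> \<le> e * \<mu>"
    using separators[OF fam, of "e * \<mu>"] e by auto
  have "\<bar>f i (x j) / f i u - (if i = j then 1 else 0)\<bar> \<le> e" if ij: "i < k" "j < k" for i j
  proof -
    have "f i (x j) / f i u - (if i = j then 1 else 0) = (f i (x j) - (if i = j then f i u else 0)) / f i u"
      using fu[OF ij(1)] by (simp add: field_simps)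
    also have "\<bar>\<dots>\<bar> \<le> e * \<mu> / f i u"
      using fu[OF ij(1)] x(2)[OF ij] by (simp add: abs_divide divide_right_mono)
    also have "\<dots> \<le> e"
      using fu[OF ij(1)] ij e by (auto simp: \<mu>_def field_simps intro!: mult_left_mono Min_le)
    finally show ?thesis .
  qed
  then show ?thesis using that x by blast
qed

text \<open>The functionals vanish on the lineality space and their matrix of values is invertible,
  in the form of \<open>near_identity\<close> with W = 0.\<close>

lemma near_dual_indep:
  assumes f: "\<And>i. i < k \<Longrightarrow> pos_functional (f i)" and x: "\<And>j. j < k \<Longrightarrow> x j \<in> P"
    and a: "\<And>i j. i < k \<Longrightarrow> j < k \<Longrightarrow> \<bar>f i (x j) - (if i = j then 1 else 0)\<bar> \<le> e"
    and e: "real k * e \<le> 1 / 2"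
  shows "indep_mod (lineality P) k x"
  unfolding indep_mod_def
proof (intro allI impI)
  fix c i assume c: "(\<Sum>j<k. c j *\<^sub>Q x j) \<in> lineality P" and i: "i < k"
  have "(\<Sum>j<k. of_rat (c j) * f l (x j)) = 0" if "l < k" for l
    using pos_functional_lineality[OF f[OF that] c] pos_functional_sum[OF f[OF that], of "{..<k}" x c] x P_gen by auto
  then have "\<bar>real_of_rat (c i) - (\<Sum>j<k. of_rat (c j) * f i (x j))\<bar> \<le> 2 * real k * e * 0"
    by (intro near_identity[OF a e _ i]) auto
  then show "c i = 0" using i \<open>\<And>l. l < k \<Longrightarrow> (\<Sum>j<k. of_rat (c j) * f l (x j)) = 0\<close> by simp
qed

text \<open>Separating elements for k disjoint functionals are k independent elements of P. This
  bound is what makes a largest disjoint family exist.\<close>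

lemma disj_family_bound:
  assumes "disj_family k f" "rank_le P m" shows "k \<le> m"
proof (cases "k = 0")
  case False
  then obtain x where x: "\<And>j. j < k \<Longrightarrow> x j \<in> P"
    "\<And>i j. i < k \<Longrightarrow> j < k \<Longrightarrow> \<bar>f i (x j) / f i u - (if i = j then 1 else 0)\<bar> \<le> 1 / (2 * real k)"
    using separators_normalized[OF assms(1), of "1 / (2 * real k)"] by auto
  have "pos_functional (\<lambda>x. f i x / f i u)" if "i < k" for i
    using pos_functional_times[of "f i" "inverse (f i u)"] assms(1) that
    by (simp add: disj_family_def divide_inverse_commute order_less_imp_le)
  then have "indep_mod (lineality P) k x"
    using False by (intro near_dual_indep[of k "\<lambda>i x. f i x / f i u", OF _ x]) auto
  then show ?thesis using x(1) assms(2) unfolding rank_le_def by blast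
qed simp

lemma maximal_family_exists:
  assumes "rank_le P m"
  obtains k f where "0 < k" "k \<le> m" "disj_family k f" "\<forall>f'. \<not> disj_family (Suc k) f'"
proof -
  \<comment> \<open>Separating -u from P gives a first functional; hence the maximal family is not
    empty and has an index 0.\<close>
  obtain f where f: "pos_functional f" "f u = 1"
    using hahn_banach[of "- u"] u_strict subspace_neg[OF gen_subspace P_gen[OF u_pos]] by blast
  then have "disj_family 1 (\<lambda>_. f)" by (simp add: disj_family_def)
  then have "\<exists>f. disj_family 1 f" by blast
  moreover have "\<forall>k. (\<exists>f. disj_family k f) \<longrightarrow> k \<le> m" using disj_family_bound[OF _ assms] by blast
  ultimately have "\<exists>k. (\<exists>f. disj_family k f) \<and> (\<forall>l. (\<exists>f. disj_family l f) \<longrightarrow> l \<le> k)"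
    using ex_has_greatest_nat[of "\<lambda>k. \<exists>f. disj_family k f" 1 "\<lambda>k. k" "Suc m"]
    by (simp only: less_Suc_eq_le)
  then obtain k where k: "\<exists>f. disj_family k f" "\<forall>l. (\<exists>f. disj_family l f) \<longrightarrow> l \<le> k"
    by blast
  moreover have "1 \<le> k" using k \<open>\<exists>f. disj_family 1 f\<close> by blast
  moreover have "\<not> disj_family (Suc k) f'" for f' using k(2) by fastforce
  ultimately show ?thesis using that disj_family_bound[OF _ assms] by (metis One_nat_def Suc_le_eq)
qed

end

section \<open>Simple cones\<close>

context simple_cone begin

text \<open>The order of the choices matters: \<open>\<mu>\<close> and K from the values on F, then
  the precision e of the x j, the size \<open>\<eta>\<close> allowed on the filling vectors, the
  tolerance \<open>\<sigma>\<close> for coordinates along them, the factor N, and only then these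
  vectors themselves. As \<open>\<eta>\<close> does not depend on N, enlarging N shrinks the
  coordinates without spoiling positivity.\<close>

lemma finite_subset_in_cone:
  assumes rank: "rank_le P m" and F: "finite F" "F \<subseteq> P"
  obtains d b where "d \<le> m" "\<And>i. i < d \<Longrightarrow> b i \<in> P" "\<And>p. p \<in> F \<Longrightarrow> in_cone (lineality P) d b p"
proof -
  let ?L = "lineality P"
  obtain k f where k: "0 < k" and fam: "disj_family k f" and max: "\<forall>f'. \<not> disj_family (Suc k) f'"
    using maximal_family_exists[OF rank] by metis
  have fpf: "pos_functional (f i)" and fu: "0 < f i u" if "i < k" for i
    using fam that by (auto simp: disj_family_def)
  define g where "g i v = f i v / f i u" for i v
  have g: "pos_functional (g i)" if "i < k" for i
    using pos_functional_times[OF fpf[OF that], of "inverse (f i u)"] fu[OF that] that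
    by (simp add: g_def[abs_def] divide_inverse_commute order_less_imp_le)
  have gpos: "0 < g i p" if "i < k" "p \<in> P" "- p \<notin> P" for i p
    using pos_functional_unit_pos[OF fpf fu] that fu by (simp add: g_def)
  have crit: "v \<in> P" if "v \<in> gen P" "\<And>i. i < k \<Longrightarrow> 0 < g i v" for v
  proof (rule maximal_family_criterion[OF fam])
    show "0 < f i v" if "i < k" for i
      using \<open>\<And>i. i < k \<Longrightarrow> 0 < g i v\<close>[OF that] fu[OF that] by (simp add: g_def zero_less_divide_iff)
  qed (use max that in auto)
  \<comment> \<open>Elements of F in the lineality space need only zero coefficients. On the others
    all functionals are strictly positive, so \<open>\<mu>\<close> below is positive.\<close>
  define F' where "F' = {p \<in> F. - p \<notin> P}"
  have F': "finite F'" "\<And>p. p \<in> F' \<Longrightarrow> p \<in> P" "\<And>p. p \<in> F' \<Longrightarrow> - p \<notin> P" using F by (auto simp: F'_def)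
  define T where "T = (\<lambda>(i, p). g i p) ` ({..<k} \<times> F')"
  have T: "finite T" using F' by (simp add: T_def)
  define \<mu> where "\<mu> = Min (insert 1 T)"
  define K where "K = Max (insert 0 T)"
  have \<mu>: "0 < \<mu>" using T gpos F' by (auto simp: \<mu>_def T_def)
  have \<mu>1: "\<mu> \<le> 1" using T by (simp add: \<mu>_def)
  have K: "0 \<le> K" using T by (simp add: K_def)
  have gT: "g i p \<in> T" if "i < k" "p \<in> F'" for i p
    using that unfolding T_def by (intro image_eqI[of _ _ "(i, p)"]) auto
  have gF: "\<mu> \<le> g i p" "g i p \<le> K" if "i < k" "p \<in> F'" for i p
    using gT[OF that] T by (auto simp: \<mu>_def K_def)
  \<comment> \<open>Makes the error 2 k e W of \<open>near_identity\<close> equal to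
    \<open>\<mu>\<close>/4 for W = K + 1, the bound on the functionals for the part of p along the x
    j.\<close>
  define e where "e = \<mu> / (8 * real k * (K + 1))"
  have e: "0 < e" using \<mu> k K by (simp add: e_def)
  have ek': "2 * real k * e * (K + 1) = \<mu> / 4"
  proof -
    have "8 * real k * (K + 1) \<noteq> 0" using k K by simp
    then have "e * (8 * real k * (K + 1)) = \<mu>" unfolding e_def by (rule nonzero_eq_divide_eq[THEN iffD1]) simp
    then show ?thesis by (simp add: algebra_simps)
  qed
  have "real k * e \<le> real k * e * (K + 1)" using K e mult_left_mono[of 1 "K + 1" "real k * e"] by simp
  then have ek: "real k * e \<le> 1 / 4" using ek' \<mu>1 by linarith
  obtain x where xP: "\<And>j. j < k \<Longrightarrow> x j \<in> P"
    and "\<And>i j. i < k \<Longrightarrow> j < k \<Longrightarrow> \<bar>f i (x j) / f i u - (if i = j then 1 else 0)\<bar> \<le> e"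
    using separators_normalized[OF fam e] by blast
  then have xa: "\<bar>g i (x j) - (if i = j then 1 else 0)\<bar> \<le> e" if "i < k" "j < k" for i j
    using that by (simp add: g_def)
  have ind: "indep_mod ?L k x" by (rule near_dual_indep[of k g, OF g xP xa]) (use ek in auto)
  obtain d b where d: "k \<le> d" "d \<le> m" and bP: "\<And>i. i < d \<Longrightarrow> b i \<in> P" and bx: "\<And>i. i < k \<Longrightarrow> b i = x i"
    and span: "\<And>p. p \<in> P \<Longrightarrow> \<exists>c. p - (\<Sum>i<d. c i *\<^sub>Q b i) \<in> ?L"
    using indep_extend[OF cone rank xP ind] by metis
  define J where "J = {k..<d}"
  define s where "s = d - k"
  have J: "finite J" "card J = s" by (auto simp: J_def s_def)
  have split: "(\<Sum>i<d. h i) = h 0 + (\<Sum>i\<in>{1..<k}. h i) + (\<Sum>i\<in>J. h i)" for h :: "nat \<Rightarrow> 'v"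
  proof -
    have "{..<d} = insert 0 {1..<k} \<union> J" using d k by (auto simp: J_def)
    moreover have "insert 0 {1..<k} \<inter> J = {}" using k by (auto simp: J_def)
    ultimately show ?thesis using J by (simp add: sum.union_disjoint)
  qed
  have split_k: "(\<Sum>i<k. h i) = h 0 + (\<Sum>i\<in>{1..<k}. h i)" for h :: "nat \<Rightarrow> 'v"
  proof -
    have "{..<k} = insert 0 {1..<k}" using k by auto
    then show ?thesis by simp
  qed
  obtain cc where cc: "\<And>p. p \<in> P \<Longrightarrow> p - (\<Sum>i<d. cc p i *\<^sub>Q b i) \<in> ?L" using span by metis
  have x0: "- x 0 \<notin> P"
  proof
    assume "- x 0 \<in> P"
    then have "x 0 \<in> ?L" using xP k by (simp add: lineality_def)
    then have "g 0 (x 0) = 0" using pos_functional_lineality g k by blast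
    moreover have "1 * e \<le> real k * e" using k e by (intro mult_right_mono) auto
    ultimately show False using xa[OF k k] ek by simp
  qed
  \<comment> \<open>(s + 1) \<open>\<eta>\<close> is half of the least of 1 and the g i (x 0).
    Adding one z j to x 0, or subtracting the sum of all s of them, then keeps every functional
    positive.\<close>
  define \<eta> where "\<eta> = Min (insert 1 ((\<lambda>i. g i (x 0)) ` {..<k})) / (2 * (real s + 1))"
  have "0 < Min (insert 1 ((\<lambda>i. g i (x 0)) ` {..<k}))" using gpos[OF _ xP[OF k] x0] by auto
  then have \<eta>: "0 < \<eta>" by (simp add: \<eta>_def)
  have \<eta>_eq: "2 * ((real s + 1) * \<eta>) = Min (insert 1 ((\<lambda>i. g i (x 0)) ` {..<k}))"
  proof -
    have "2 * (real s + 1) \<noteq> 0" by (simp add: add_nonneg_eq_0_iff)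
    then have "\<eta> * (2 * (real s + 1)) = Min (insert 1 ((\<lambda>i. g i (x 0)) ` {..<k}))"
      unfolding \<eta>_def by (rule nonzero_eq_divide_eq[THEN iffD1]) simp
    then show ?thesis by (simp add: algebra_simps)
  qed
  have \<eta>_le: "2 * ((real s + 1) * \<eta>) \<le> y" if "y \<in> insert 1 ((\<lambda>i. g i (x 0)) ` {..<k})" for y
    unfolding \<eta>_eq using that by (intro Min_le) auto
  have \<eta>_s: "0 < (real s + 1) * \<eta>" using \<eta> by (intro mult_pos_pos) auto
  have \<eta>_x0: "(real s + 1) * \<eta> < g i (x 0)" if "i < k" for i
    using \<eta>_le[of "g i (x 0)"] that \<eta>_s by simp
  have \<eta>1: "\<eta> \<le> 1"
  proof -
    have "1 * \<eta> \<le> (real s + 1) * \<eta>" using \<eta> by (intro mult_right_mono) auto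
    then show ?thesis using \<eta>_le[OF insertI1] \<eta>_s by linarith
  qed
  \<comment> \<open>Bounds the sum of the |E j| below. C 0 will be at least \<open>\<mu>\<close>/2,
    so after removing the sum of the E j at least \<open>\<mu>\<close>/4 = (s + 1)
    \<open>\<sigma>\<close> is left, which is \<open>\<sigma>\<close> for each of the s + 1 vertices
    of the simplex.\<close>
  define \<sigma> where "\<sigma> = \<mu> / (4 * (real s + 1))"
  have \<sigma>: "0 < \<sigma>" using \<mu> by (simp add: \<sigma>_def)
  have \<sigma>_eq: "4 * (real s * \<sigma>) + 4 * \<sigma> = \<mu>"
  proof -
    have "4 * (real s + 1) \<noteq> 0" by (simp add: add_nonneg_eq_0_iff)
    then have "\<sigma> * (4 * (real s + 1)) = \<mu>"
      unfolding \<sigma>_def by (rule nonzero_eq_divide_eq[THEN iffD1]) simp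
    then show ?thesis by (simp add: algebra_simps)
  qed
  have s\<sigma>: "0 \<le> real s * \<sigma>" using \<sigma> by simp
  define B where "B = (\<Sum>p\<in>F'. \<Sum>j\<in>J. \<bar>real_of_rat (cc p j)\<bar>)"
  obtain N :: nat where N: "B / \<sigma> < real N" using reals_Archimedean2 by blast
  have B0: "0 \<le> B" by (auto simp: B_def intro!: sum_nonneg)
  have N0: "0 < N" using order_le_less_trans[OF divide_nonneg_pos[OF B0 \<sigma>] N] by simp
  have "\<exists>r. \<forall>i<k. \<bar>g i (of_nat N *\<^sub>Q b j) - (\<Sum>l<k. of_rat (r l) * g i (x l))\<bar> \<le> \<eta>" for j
    using near_identity_approx[of k "\<lambda>i l. g i (x l)" e \<eta> "\<lambda>i. g i (of_nat N *\<^sub>Q b j)"] xa ek \<eta> by metis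
  then obtain r where r: "\<And>j i. i < k \<Longrightarrow> \<bar>g i (of_nat N *\<^sub>Q b j) - (\<Sum>l<k. of_rat (r j l) * g i (x l))\<bar> \<le> \<eta>"
    by metis
  \<comment> \<open>Modulo the span of the x l this is a nonzero multiple of b j, so no direction is
    lost, while the choice of r keeps all functionals within \<open>\<eta>\<close> of 0.\<close>
  define z where "z j = of_nat N *\<^sub>Q b j - (\<Sum>l<k. r j l *\<^sub>Q x l)" for j
  have xsum: "(\<Sum>l<k. c l *\<^sub>Q x l) \<in> gen P" for c
    using P_gen xP by (intro subspace_sum[OF gen_subspace] subspace_scale[OF gen_subspace]) auto
  have zg: "z j \<in> gen P" if "j \<in> J" for j
    unfolding z_def using that P_gen bP xsum
    by (intro subspace_diff[OF gen_subspace] subspace_scale[OF gen_subspace]) (auto simp: J_def)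
  have gz: "\<bar>g i (z j)\<bar> \<le> \<eta>" if "i < k" "j \<in> J" for i j
  proof -
    have "of_nat N *\<^sub>Q b j \<in> gen P"
      using that bP P_gen by (intro subspace_scale[OF gen_subspace]) (auto simp: J_def)
    then have "g i (z j) = g i (of_nat N *\<^sub>Q b j) - g i (\<Sum>l<k. r j l *\<^sub>Q x l)"
      unfolding z_def using xsum by (intro pos_functional_diff g that)
    also have "g i (\<Sum>l<k. r j l *\<^sub>Q x l) = (\<Sum>l<k. of_rat (r j l) * g i (x l))"
      using xP P_gen by (intro pos_functional_sum g that) auto
    finally show ?thesis using r[OF that(1), of j] by simp
  qed
  txt \<open>All functionals are so small on the \<open>z j\<close> that \<open>x 0 + z j\<close> and \<open>x 0 - \<Sum> z j\<close> stay positive. The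
    simplex with these vertices contains \<open>x 0\<close> plus any small combination of the \<open>z j\<close>; the coordinates
    of \<open>F\<close> along the \<open>z j\<close> are small because of the factor \<open>N\<close>.\<close>
  define b' where "b' j = (if j = 0 then x 0 - (\<Sum>l\<in>J. z l) else if j < k then x j else x 0 + z j)" for j
  have b'P: "b' j \<in> P" if j: "j < d" for j
  proof -
    have x0g: "x 0 \<in> gen P" using xP k P_gen by blast
    have zs: "(\<Sum>l\<in>J. z l) \<in> gen P" using zg by (intro subspace_sum[OF gen_subspace])
    consider "j = 0" | "0 < j" "j < k" | "j \<in> J"
      unfolding J_def using j by (metis atLeastLessThan_iff leI neq0_conv)
    then show ?thesis
    proof cases
      case 1
      have "x 0 - (\<Sum>l\<in>J. z l) \<in> P"
      proof (rule crit)
        show "x 0 - (\<Sum>l\<in>J. z l) \<in> gen P" using x0g zs by (rule subspace_diff[OF gen_subspace])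
        fix i assume i: "i < k"
        have "g i (\<Sum>l\<in>J. z l) = (\<Sum>l\<in>J. g i (z l))"
          using pos_functional_sum[OF g[OF i], of J z "\<lambda>_. 1"] zg by simp
        also have "\<dots> \<le> (\<Sum>l\<in>J. \<eta>)" using gz[OF i] by (intro sum_mono) (simp add: abs_le_iff)
        also have "\<dots> = real s * \<eta>" using J by simp
        finally show "0 < g i (x 0 - (\<Sum>l\<in>J. z l))"
          using \<eta>_x0[OF i] \<eta> by (simp add: pos_functional_diff[OF g[OF i] x0g zs] algebra_simps)
      qed
      then show ?thesis using 1 by (simp add: b'_def)
    next
      case 2
      then show ?thesis using xP by (simp add: b'_def)
    next
      case 3
      have "x 0 + z j \<in> P"
      proof (rule crit)
        show "x 0 + z j \<in> gen P" using x0g zg[OF 3] by (rule subspace_add[OF gen_subspace])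
        fix i assume i: "i < k"
        have "1 * \<eta> \<le> (real s + 1) * \<eta>" using \<eta> by (intro mult_right_mono) auto
        then show "0 < g i (x 0 + z j)"
          using \<eta>_x0[OF i] gz[OF i 3] unfolding pos_functional_add[OF g[OF i] x0g zg[OF 3]] by linarith
      qed
      then show ?thesis using 3 k by (simp add: b'_def J_def)
    qed
  qed
  have "in_cone ?L d b' p" if p: "p \<in> F" for p
  proof (cases "p \<in> F'")
    case False
    then have "p \<in> ?L" using p F by (auto simp: F'_def lineality_def)
    then show ?thesis unfolding in_cone_def by (intro exI[of _ "\<lambda>_. 0"]) simp
  next
    case True
    \<comment> \<open>E and C are the coordinates of p along the z j and the x l, modulo the
      lineality space, after each b j with j in J has been expressed through z j.\<close>
    define E where "E j = cc p j / of_nat N" for j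
    define C where "C l = cc p l + (\<Sum>j\<in>J. E j * r j l)" for l
    have bz: "cc p j *\<^sub>Q b j = E j *\<^sub>Q z j + (\<Sum>l<k. (E j * r j l) *\<^sub>Q x l)" for j
      using N0 by (simp add: z_def E_def scale_right_diff_distrib scale_sum_right)
    have "(\<Sum>i<d. cc p i *\<^sub>Q b i) = (\<Sum>l<k. cc p l *\<^sub>Q x l) + (\<Sum>j\<in>J. cc p j *\<^sub>Q b j)"
      using bx k unfolding split split_k by simp
    also have "(\<Sum>j\<in>J. cc p j *\<^sub>Q b j) = (\<Sum>j\<in>J. E j *\<^sub>Q z j) + (\<Sum>j\<in>J. \<Sum>l<k. (E j * r j l) *\<^sub>Q x l)"
      by (simp add: bz sum.distrib)
    also have "(\<Sum>j\<in>J. \<Sum>l<k. (E j * r j l) *\<^sub>Q x l) = (\<Sum>l<k. (\<Sum>j\<in>J. E j * r j l) *\<^sub>Q x l)"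
      by (subst sum.swap) (simp add: scale_sum_left)
    finally have comb: "(\<Sum>i<d. cc p i *\<^sub>Q b i) = (\<Sum>l<k. C l *\<^sub>Q x l) + (\<Sum>j\<in>J. E j *\<^sub>Q z j)"
      by (simp add: C_def scale_left_distrib sum.distrib algebra_simps)
    \<comment> \<open>Weight t0 on x 0 - \<Sum> z and weight t0 + E j on x 0 + z j leave exactly E j
      along z j. The total weight (s + 1) t0 + \<Sum> E has to be C 0.\<close>
    define t0 where "t0 = (C 0 - (\<Sum>j\<in>J. E j)) / of_nat (Suc s)"
    define t where "t l = (if l = 0 then t0 else if l < k then C l else t0 + E l)" for l
    have C0: "C 0 = t0 + of_nat s * t0 + (\<Sum>j\<in>J. E j)"
    proof -
      have "t0 * of_nat (Suc s) = C 0 - (\<Sum>j\<in>J. E j)" unfolding t0_def by (simp del: of_nat_Suc)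
      then show ?thesis by (simp add: algebra_simps)
    qed
    have "(\<Sum>l<d. t l *\<^sub>Q b' l) = t0 *\<^sub>Q (x 0 - (\<Sum>l\<in>J. z l)) + (\<Sum>l\<in>{1..<k}. C l *\<^sub>Q x l)
        + (\<Sum>j\<in>J. (t0 + E j) *\<^sub>Q (x 0 + z j))"
    proof -
      have "(\<Sum>j\<in>J. t j *\<^sub>Q b' j) = (\<Sum>j\<in>J. (t0 + E j) *\<^sub>Q (x 0 + z j))"
        using k by (intro sum.cong) (auto simp: t_def b'_def J_def)
      then show ?thesis unfolding split by (simp add: t_def b'_def)
    qed
    also have "(\<Sum>j\<in>J. (t0 + E j) *\<^sub>Q (x 0 + z j))
        = (of_nat s * t0 + (\<Sum>j\<in>J. E j)) *\<^sub>Q x 0 + t0 *\<^sub>Q (\<Sum>j\<in>J. z j) + (\<Sum>j\<in>J. E j *\<^sub>Q z j)"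
      using J by (simp add: scale_left_distrib scale_right_distrib sum.distrib scale_sum_right
          scale_sum_left algebra_simps flip: scale_scale) (simp add: sum_constant_scale)
    finally have "(\<Sum>l<d. t l *\<^sub>Q b' l) = C 0 *\<^sub>Q x 0 + (\<Sum>l\<in>{1..<k}. C l *\<^sub>Q x l) + (\<Sum>j\<in>J. E j *\<^sub>Q z j)"
      unfolding C0 by (simp add: scale_left_distrib scale_right_diff_distrib algebra_simps)
    then have eq: "(\<Sum>l<d. t l *\<^sub>Q b' l) = (\<Sum>i<d. cc p i *\<^sub>Q b i)" unfolding comb split_k by simp
    have sE: "(\<Sum>j\<in>J. \<bar>real_of_rat (E j)\<bar>) \<le> \<sigma>"
    proof -
      have "(\<Sum>j\<in>J. \<bar>real_of_rat (cc p j)\<bar>) \<le> B"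
        unfolding B_def using True F' by (intro member_le_sum[of p F'] sum_nonneg) auto
      also have "B \<le> \<sigma> * real N" using N \<sigma> by (simp add: field_simps)
      finally show ?thesis using N0
        by (simp add: E_def of_rat_divide abs_divide flip: sum_divide_distrib) (simp add: field_simps)
    qed
    \<comment> \<open>g i p is at least \<open>\<mu>\<close>. Dropping the part along the z j costs
      at most \<open>\<sigma>\<close> \<le> \<open>\<mu>\<close>/4, and passing from functional
      values to coordinates costs another \<open>\<mu>\<close>/4.\<close>
    have C_lower: "\<mu> / 2 \<le> real_of_rat (C i)" if i: "i < k" for i
    proof -
      have w: "\<bar>g l p - (\<Sum>j<k. of_rat (C j) * g l (x j))\<bar> \<le> \<sigma>" if l: "l < k" for l
      proof -
        have pg: "p \<in> gen P" using F'(2)[OF True] P_gen by blast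
        have bg: "(\<Sum>i<d. cc p i *\<^sub>Q b i) \<in> gen P"
          using P_gen bP by (intro subspace_sum[OF gen_subspace] subspace_scale[OF gen_subspace]) auto
        have "g l p = g l (\<Sum>i<d. cc p i *\<^sub>Q b i)"
          using pos_functional_lineality[OF g[OF l] cc[OF F'(2)[OF True]]] pos_functional_diff[OF g[OF l] pg bg] by simp
        also have "\<dots> = g l (\<Sum>j<k. C j *\<^sub>Q x j) + g l (\<Sum>j\<in>J. E j *\<^sub>Q z j)"
          unfolding comb using xP P_gen zg
          by (intro pos_functional_add[OF g[OF l]] subspace_sum[OF gen_subspace] subspace_scale[OF gen_subspace]) auto
        also have "g l (\<Sum>j<k. C j *\<^sub>Q x j) = (\<Sum>j<k. of_rat (C j) * g l (x j))"
          using xP P_gen by (intro pos_functional_sum[OF g[OF l]]) auto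
        also have "g l (\<Sum>j\<in>J. E j *\<^sub>Q z j) = (\<Sum>j\<in>J. of_rat (E j) * g l (z j))"
          using zg by (intro pos_functional_sum[OF g[OF l]]) auto
        finally have "\<bar>g l p - (\<Sum>j<k. of_rat (C j) * g l (x j))\<bar> = \<bar>\<Sum>j\<in>J. of_rat (E j) * g l (z j)\<bar>" by simp
        also have "\<dots> \<le> (\<Sum>j\<in>J. \<bar>real_of_rat (E j)\<bar> * 1)"
        proof (rule order_trans[OF sum_abs sum_mono])
          fix j assume "j \<in> J"
          then have "\<bar>g l (z j)\<bar> \<le> 1" using gz[OF l] \<eta>1 by (meson order_trans)
          then show "\<bar>real_of_rat (E j) * g l (z j)\<bar> \<le> \<bar>real_of_rat (E j)\<bar> * 1"
            unfolding abs_mult by (rule mult_left_mono) simp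
        qed
        finally show ?thesis using sE by simp
      qed
      have \<sigma>4: "\<sigma> \<le> \<mu> / 4" using \<sigma>_eq s\<sigma> by linarith
      have W: "\<bar>\<Sum>j<k. of_rat (C j) * g l (x j)\<bar> \<le> K + 1" if l: "l < k" for l
        using w[OF l] gF[OF l True] \<sigma>4 \<mu> \<mu>1 by linarith
      have "\<bar>real_of_rat (C i) - (\<Sum>j<k. of_rat (C j) * g i (x j))\<bar> \<le> 2 * real k * e * (K + 1)"
        by (rule near_identity[OF xa _ W i]) (use ek in auto)
      then show ?thesis using w[OF i] gF[OF i True] \<sigma>4 unfolding ek' by linarith
    qed
    have t_nonneg: "0 \<le> real_of_rat (t l)" if l: "l < d" for l
    proof -
      have Es: "\<bar>\<Sum>j\<in>J. real_of_rat (E j)\<bar> \<le> \<sigma>" using order_trans[OF sum_abs sE] .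
      have t0: "(real s + 1) * real_of_rat t0 = real_of_rat (C 0) - (\<Sum>j\<in>J. real_of_rat (E j))"
      proof -
        have "of_nat (Suc s) * t0 = C 0 - (\<Sum>j\<in>J. E j)" unfolding t0_def by (simp del: of_nat_Suc)
        from arg_cong[OF this, of real_of_rat] show ?thesis
          by (simp add: of_rat_mult of_rat_add of_rat_diff of_rat_sum add.commute)
      qed
      then have t0': "(real s + 1) * \<sigma> \<le> (real s + 1) * real_of_rat t0"
        using C_lower[OF k] Es \<sigma>_eq \<sigma> s\<sigma> unfolding distrib_right by linarith
      then have t0\<sigma>: "\<sigma> \<le> real_of_rat t0" by (rule mult_left_le_imp_le) simp
      consider "l = 0" | "0 < l" "l < k" | "l \<in> J"
        unfolding J_def using l by (metis atLeastLessThan_iff leI neq0_conv)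
      then show ?thesis
      proof cases
        case 1
        then have t: "t l = t0" by (simp add: t_def)
        show ?thesis unfolding t using t0\<sigma> \<sigma> by linarith
      next
        case 2
        then have t: "t l = C l" by (simp add: t_def)
        show ?thesis unfolding t using C_lower[OF 2(2)] \<mu> by linarith
      next
        case 3
        have "\<bar>real_of_rat (E l)\<bar> \<le> \<sigma>"
          using sE member_le_sum[of l J "\<lambda>j. \<bar>real_of_rat (E j)\<bar>"] 3 J by simp
        moreover have "real_of_rat (t l) = real_of_rat t0 + real_of_rat (E l)"
          using 3 k by (simp add: t_def J_def of_rat_add)
        ultimately show ?thesis using t0\<sigma> by linarith
      qed
    qed
    show ?thesis unfolding in_cone_def
      using t_nonneg cc[OF F'(2)[OF True]] eq by (intro exI[of _ t]) auto
  qed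
  then show ?thesis using that[of d b'] d(2) b'P by blast
qed

end

section \<open>Order ideals and induction on the rank\<close>

lemma sum_lessThan_append: "(\<Sum>i<k + l. f i) = (\<Sum>i<k. f i) + (\<Sum>i<l. f (k + i))"
  for f :: "nat \<Rightarrow> 'a::comm_monoid_add"
  by (induction l) (simp_all add: add.assoc)

context rat_space begin

lemma rank_leD:
  "rank_le P m \<Longrightarrow> indep_mod (lineality P) k b \<Longrightarrow> \<forall>i<k. b i \<in> P \<Longrightarrow> k \<le> m"
  by (simp add: rank_le_def)

text \<open>The last clause says that I is directed: v = (v + w) - w is a difference of positive
  elements of I. It lets an error in I be compensated by a positive element of I.\<close>

definition order_ideal :: "'v set \<Rightarrow> 'v set \<Rightarrow> bool" where
  "order_ideal P I \<longleftrightarrow> subspace I \<and> (\<forall>x\<in>P. \<forall>y\<in>I. y - x \<in> P \<longrightarrow> x \<in> I) \<and> (\<forall>v\<in>I. \<exists>w\<in>P \<inter> I. v + w \<in> P)"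

text \<open>This is P + I, the preimage in V of the image of P in V / I.\<close>

definition quotient_cone :: "'v set \<Rightarrow> 'v set \<Rightarrow> 'v set" where
  "quotient_cone P I = {v. \<exists>i\<in>I. v + i \<in> P}"

lemma order_idealD:
  assumes "order_ideal P I"
  shows "subspace I" "\<And>x y. x \<in> P \<Longrightarrow> y \<in> I \<Longrightarrow> y - x \<in> P \<Longrightarrow> x \<in> I"
    "\<And>v. v \<in> I \<Longrightarrow> \<exists>w\<in>P \<inter> I. v + w \<in> P"
  using assms by (auto simp: order_ideal_def)

text \<open>The union of the order intervals from -r p to r p is the order ideal generated by p; the
  multiples of p witness that it is directed.\<close>

lemma principal_order_ideal:
  assumes P: "cone P" and p: "p \<in> P"
  shows "order_ideal P {v. \<exists>r\<ge>0. r *\<^sub>Q p - v \<in> P \<and> r *\<^sub>Q p + v \<in> P}" (is "order_ideal P ?I")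
  unfolding order_ideal_def
proof (intro conjI ballI impI)
  show "subspace ?I"
  proof (rule subspaceI)
    show "0 \<in> ?I" using cone_zero[OF P] by (intro CollectI exI[of _ 0]) simp
  next
    fix x y assume "x \<in> ?I" "y \<in> ?I"
    then obtain r s where "0 \<le> r" "r *\<^sub>Q p - x \<in> P" "r *\<^sub>Q p + x \<in> P" "0 \<le> s" "s *\<^sub>Q p - y \<in> P" "s *\<^sub>Q p + y \<in> P"
      by blast
    then have "(r *\<^sub>Q p - x) + (s *\<^sub>Q p - y) \<in> P" "(r *\<^sub>Q p + x) + (s *\<^sub>Q p + y) \<in> P"
      by (blast intro: cone_add[OF P])+
    then show "x + y \<in> ?I"
      using \<open>0 \<le> r\<close> \<open>0 \<le> s\<close> by (intro CollectI exI[of _ "r + s"]) (simp add: scale_left_distrib algebra_simps)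
  next
    fix c x assume "x \<in> ?I"
    then obtain r where r: "0 \<le> r" "r *\<^sub>Q p - x \<in> P" "r *\<^sub>Q p + x \<in> P" by blast
    have "(\<bar>c\<bar> * r) *\<^sub>Q p - c *\<^sub>Q x \<in> P \<and> (\<bar>c\<bar> * r) *\<^sub>Q p + c *\<^sub>Q x \<in> P"
    proof (cases "0 \<le> c")
      case True
      then show ?thesis
        using cone_scale[OF P True r(2)] cone_scale[OF P True r(3)]
        by (simp add: scale_right_distrib scale_right_diff_distrib)
    next
      case False
      then have c: "0 \<le> - c" by simp
      show ?thesis
        using cone_scale[OF P c r(2)] cone_scale[OF P c r(3)] False
        by (simp add: scale_right_distrib scale_right_diff_distrib)
    qed
    then show "c *\<^sub>Q x \<in> ?I" using r(1) by (intro CollectI exI[of _ "\<bar>c\<bar> * r"]) simp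
  qed
next
  fix x y assume x: "x \<in> P" and "y \<in> ?I" "y - x \<in> P"
  then obtain r where r: "0 \<le> r" "r *\<^sub>Q p - y \<in> P" by blast
  have "(r *\<^sub>Q p - y) + (y - x) \<in> P" using r \<open>y - x \<in> P\<close> by (intro cone_add[OF P])
  moreover have "r *\<^sub>Q p + x \<in> P" using x p r by (intro cone_add[OF P] cone_scale[OF P])
  ultimately show "x \<in> ?I" using r by (intro CollectI exI[of _ r]) simp
next
  fix v assume "v \<in> ?I"
  then obtain r where r: "0 \<le> r" "r *\<^sub>Q p + v \<in> P" by blast
  have rp: "r *\<^sub>Q p \<in> P" using r p cone_scale[OF P] by blast
  have "r *\<^sub>Q p \<in> ?I"
    using r cone_zero[OF P] cone_add[OF P rp rp] by (intro CollectI exI[of _ r]) simp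
  then show "\<exists>w\<in>P \<inter> ?I. v + w \<in> P" using r rp by (intro bexI[of _ "r *\<^sub>Q p"]) (auto simp: add.commute)
qed

lemma lineality_subset_ideal:
  assumes "cone P" "order_ideal P I" shows "lineality P \<subseteq> I"
  using order_idealD(2)[OF assms(2), of _ 0] subspace_0[OF order_idealD(1)[OF assms(2)]]
  by (auto simp: lineality_def)

lemma subset_quotient_cone: "order_ideal P I \<Longrightarrow> P \<subseteq> quotient_cone P I"
  using subspace_0[OF order_idealD(1)] by (force simp: quotient_cone_def)

lemma cone_quotient:
  assumes P: "cone P" and I: "order_ideal P I" shows "cone (quotient_cone P I)"
  unfolding cone_def
proof (intro conjI ballI allI impI)
  note sub = order_idealD(1)[OF I]
  show "0 \<in> quotient_cone P I" using subset_quotient_cone[OF I] cone_zero[OF P] by blast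
  fix x y assume "x \<in> quotient_cone P I" "y \<in> quotient_cone P I"
  then obtain i j where "i \<in> I" "j \<in> I" "x + i \<in> P" "y + j \<in> P" by (auto simp: quotient_cone_def)
  then have "i + j \<in> I" "(x + i) + (y + j) \<in> P" using subspace_add[OF sub] cone_add[OF P] by auto
  then show "x + y \<in> quotient_cone P I"
    unfolding quotient_cone_def by (intro CollectI bexI[of _ "i + j"]) (simp_all add: algebra_simps)
next
  fix r :: rat and x assume "0 \<le> r" "x \<in> quotient_cone P I"
  then obtain i where "i \<in> I" "x + i \<in> P" by (auto simp: quotient_cone_def)
  then have "r *\<^sub>Q i \<in> I" "r *\<^sub>Q (x + i) \<in> P"
    using subspace_scale[OF order_idealD(1)[OF I]] cone_scale[OF P \<open>0 \<le> r\<close>] by auto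
  then show "r *\<^sub>Q x \<in> quotient_cone P I"
    unfolding quotient_cone_def by (auto simp: scale_right_distrib)
qed

lemma lineality_quotient:
  assumes P: "cone P" and I: "order_ideal P I" shows "lineality (quotient_cone P I) = I"
proof
  note sub = order_idealD(1)[OF I]
  show "lineality (quotient_cone P I) \<subseteq> I"
  proof
    fix v assume "v \<in> lineality (quotient_cone P I)"
    then obtain i j where ij: "i \<in> I" "j \<in> I" "v + i \<in> P" "- v + j \<in> P"
      by (auto simp: lineality_def quotient_cone_def)
    have "(i + j) - (v + i) \<in> P" using ij(4) by (simp add: algebra_simps)
    then have "v + i \<in> I" using order_idealD(2)[OF I ij(3)] subspace_add[OF sub] ij by blast
    then show "v \<in> I" using subspace_diff[OF sub _ ij(1)] by fastforce
  qed
  show "I \<subseteq> lineality (quotient_cone P I)"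
  proof
    fix v assume "v \<in> I"
    then show "v \<in> lineality (quotient_cone P I)"
      using cone_zero[OF P] subspace_neg[OF sub]
      by (auto simp: lineality_def quotient_cone_def intro: bexI[of _ "- v"] bexI[of _ v])
  qed
qed

text \<open>Lifts of a, b, c to P satisfy c \<le> a + b only up to an element of I. By directedness
  of I a positive w in I, added to the lift of b, restores the inequality, and the decomposition
  found in P is valid modulo I.\<close>

lemma riesz_quotient:
  assumes P: "cone P" and R: "riesz P" and I: "order_ideal P I" shows "riesz (quotient_cone P I)"
  unfolding riesz_def
proof (intro ballI impI)
  note sub = order_idealD(1)[OF I]
  let ?P = "quotient_cone P I"
  fix a b c assume "a \<in> ?P" "b \<in> ?P" "c \<in> ?P" "a + b - c \<in> ?P"
  then obtain i j k l where i: "i \<in> I" "a + i \<in> P" and j: "j \<in> I" "b + j \<in> P"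
    and k: "k \<in> I" "c + k \<in> P" and l: "l \<in> I" "a + b - c + l \<in> P"
    by (auto simp: quotient_cone_def)
  have "i + j - k - l \<in> I" using i j k l by (intro subspace_diff[OF sub] subspace_add[OF sub])
  then obtain w where w: "w \<in> P" "w \<in> I" "(i + j - k - l) + w \<in> P" using order_idealD(3)[OF I] by blast
  have "(a + b - c + l) + ((i + j - k - l) + w) \<in> P" using l(2) w(3) by (rule cone_add[OF P])
  then have le: "(a + i) + ((b + j) + w) - (c + k) \<in> P" by (simp add: algebra_simps)
  have bw: "(b + j) + w \<in> P" using j w cone_add[OF P] by blast
  obtain x where x: "x \<in> P" "(a + i) - x \<in> P" "(c + k) - x \<in> P" "((b + j) + w) - ((c + k) - x) \<in> P"
    using rieszE[OF R i(2) bw k(2) le] .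
  have "(a - x) + i \<in> P" "(c - x) + k \<in> P" "(b - (c - x)) + (j + w - k) \<in> P"
    using x by (simp_all add: algebra_simps)
  moreover have "j + w - k \<in> I" using j k w by (intro subspace_diff[OF sub] subspace_add[OF sub])
  ultimately show "\<exists>x\<in>?P. a - x \<in> ?P \<and> c - x \<in> ?P \<and> b - (c - x) \<in> ?P"
    using i k x(1) subset_quotient_cone[OF I] unfolding quotient_cone_def by blast
qed

lemma cone_Int_ideal:
  assumes P: "cone P" and I: "order_ideal P I" shows "cone (P \<inter> I)"
  using P order_idealD(1)[OF I] by (auto simp: cone_def subspace_def)

lemma lineality_Int_ideal:
  assumes P: "cone P" and I: "order_ideal P I" shows "lineality (P \<inter> I) = lineality P"
  using lineality_subset_ideal[OF P I] subspace_neg[OF order_idealD(1)[OF I]] by (auto simp: lineality_def)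

lemma riesz_Int_ideal:
  assumes P: "cone P" and R: "riesz P" and I: "order_ideal P I" shows "riesz (P \<inter> I)"
  unfolding riesz_def
proof (intro ballI impI)
  note sub = order_idealD(1)[OF I]
  fix a b c assume h: "a \<in> P \<inter> I" "b \<in> P \<inter> I" "c \<in> P \<inter> I" "a + b - c \<in> P \<inter> I"
  then obtain x where x: "x \<in> P" "a - x \<in> P" "c - x \<in> P" "b - (c - x) \<in> P"
    using rieszE[OF R, of a b c] by blast
  have "x \<in> I" using order_idealD(2)[OF I x(1)] h x by blast
  then show "\<exists>x\<in>P \<inter> I. a - x \<in> P \<inter> I \<and> c - x \<in> P \<inter> I \<and> b - (c - x) \<in> P \<inter> I"
    using x h by (intro bexI[of _ x]) (auto intro!: subspace_diff[OF sub])
qed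

lemma in_cone_cong_mod:
  assumes L: "subspace L" and b: "\<And>i. i < k \<Longrightarrow> b i - b' i \<in> L" and p: "in_cone L k b p"
  shows "in_cone L k b' p"
proof -
  obtain c where c: "\<forall>i<k. 0 \<le> c i" "p - (\<Sum>i<k. c i *\<^sub>Q b i) \<in> L" using p by (auto simp: in_cone_def)
  have "(\<Sum>i<k. c i *\<^sub>Q (b i - b' i)) \<in> L"
    using b by (intro subspace_sum[OF L] subspace_scale[OF L]) auto
  then have "(p - (\<Sum>i<k. c i *\<^sub>Q b i)) + (\<Sum>i<k. c i *\<^sub>Q (b i - b' i)) \<in> L"
    using c by (intro subspace_add[OF L])
  then have "p - (\<Sum>i<k. c i *\<^sub>Q b' i) \<in> L"
    by (simp add: scale_right_diff_distrib sum_subtractf)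
  then show ?thesis using c(1) unfolding in_cone_def by blast
qed

text \<open>Modulo I only the first block is seen, so its coefficients vanish, and then the second
  block lies in L. The vectors b' are other lifts of the classes of b; this is needed because
  members of P + I have to be moved into P.\<close>

lemma indep_mod_append:
  assumes sub: "subspace I" and L: "L \<subseteq> I"
    and b: "indep_mod I k b" "\<And>i. i < k \<Longrightarrow> b' i - b i \<in> I"
    and d: "indep_mod L l d" "\<And>i. i < l \<Longrightarrow> d i \<in> I"
  shows "indep_mod L (k + l) (\<lambda>i. if i < k then b' i else d (i - k))"
  unfolding indep_mod_def
proof (intro allI impI)
  fix c i assume "(\<Sum>i<k + l. c i *\<^sub>Q (if i < k then b' i else d (i - k))) \<in> L" and i: "i < k + l"
  then have s: "(\<Sum>i<k. c i *\<^sub>Q b' i) + (\<Sum>i<l. c (k + i) *\<^sub>Q d i) \<in> L"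
    by (simp add: sum_lessThan_append)
  have dI: "(\<Sum>i<l. c (k + i) *\<^sub>Q d i) \<in> I"
    using d by (intro subspace_sum[OF sub] subspace_scale[OF sub]) auto
  have "(\<Sum>i<k. c i *\<^sub>Q b' i) \<in> I" using subspace_diff[OF sub _ dI] s L by fastforce
  moreover have "(\<Sum>i<k. c i *\<^sub>Q (b' i - b i)) \<in> I"
    using b by (intro subspace_sum[OF sub] subspace_scale[OF sub]) auto
  ultimately have "(\<Sum>i<k. c i *\<^sub>Q b' i) - (\<Sum>i<k. c i *\<^sub>Q (b' i - b i)) \<in> I"
    by (rule subspace_diff[OF sub])
  then have "(\<Sum>i<k. c i *\<^sub>Q b i) \<in> I" by (simp add: scale_right_diff_distrib sum_subtractf)
  then have c0: "\<forall>i<k. c i = 0" using b(1) by (simp add: indep_mod_def)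
  then have "(\<Sum>i<l. c (k + i) *\<^sub>Q d i) \<in> L" using s by simp
  then have "\<forall>i<l. c (k + i) = 0" using d(1)[unfolded indep_mod_def, rule_format, of "\<lambda>i. c (k + i)"] by simp
  then show "c i = 0" using c0 i by (metis add_diff_inverse_nat nat_add_left_cancel_less)
qed

lemma indep_mod_single:
  assumes "subspace L" "p \<notin> L" shows "indep_mod L 1 (\<lambda>_. p)"
  unfolding indep_mod_def
proof (intro allI impI)
  fix c :: "nat \<Rightarrow> rat" and i :: nat assume c: "(\<Sum>i<1. c i *\<^sub>Q p) \<in> L" and "i < 1"
  have "c 0 *\<^sub>Q p \<in> L" using c by simp
  then have "inverse (c 0) *\<^sub>Q c 0 *\<^sub>Q p \<in> L" by (rule subspace_scale[OF assms(1)])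
  then have "c 0 = 0" using assms(2) unfolding scale_scale by (cases "c 0 = 0") auto
  then show "c i = 0" using \<open>i < 1\<close> by simp
qed

text \<open>Let l be the largest size of an independent family in P \<inter> I. A family independent
  modulo I, lifted to P, can be put in front of it, so its size is at most m - l. The elements p and
  q make both ranks positive, hence both are smaller than m.\<close>

lemma rank_split:
  assumes P: "cone P" and I: "order_ideal P I" and rank: "rank_le P m"
    and p: "p \<in> P \<inter> I" "p \<notin> lineality P" and q: "q \<in> P" "q \<notin> I"
  obtains k l where "k + l \<le> m" "0 < k" "0 < l" "rank_le (quotient_cone P I) k" "rank_le (P \<inter> I) l"
proof -
  note sub = order_idealD(1)[OF I]
  define Q where "Q l \<longleftrightarrow> (\<exists>b. (\<forall>i<l. b i \<in> P \<inter> I) \<and> indep_mod (lineality P) l b)" for l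
  have "Q 1" using p indep_mod_single[OF subspace_lineality[OF P] p(2)] by (auto simp: Q_def)
  moreover have Qm: "\<forall>l. Q l \<longrightarrow> l \<le> m" using rank by (auto simp: Q_def rank_le_def)
  ultimately obtain l where l: "Q l" "\<And>l'. Q l' \<Longrightarrow> l' \<le> l"
    using ex_has_greatest_nat[of Q 1 "\<lambda>l. l" "Suc m"] by (auto simp: less_Suc_eq_le)
  obtain d where d: "\<forall>i<l. d i \<in> P \<inter> I" "indep_mod (lineality P) l d" using l(1) by (auto simp: Q_def)
  have "rank_le (P \<inter> I) l"
    unfolding rank_le_def lineality_Int_ideal[OF P I] using l(2) by (auto simp: Q_def)
  moreover have quot: "rank_le (quotient_cone P I) (m - l)"
    unfolding rank_le_def lineality_quotient[OF P I]
  proof (intro allI impI)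
    fix k b assume b: "\<forall>i<k. b i \<in> quotient_cone P I" "indep_mod I k b"
    have "\<forall>i. \<exists>j. i < k \<longrightarrow> j \<in> I \<and> b i + j \<in> P" using b(1) by (auto simp: quotient_cone_def)
    then obtain b' where b': "\<And>i. i < k \<Longrightarrow> b' i \<in> I \<and> b i + b' i \<in> P" by metis
    have "indep_mod (lineality P) (k + l) (\<lambda>i. if i < k then b i + b' i else d (i - k))"
    proof (rule indep_mod_append[OF sub lineality_subset_ideal[OF P I] b(2) _ d(2)])
      show "(b i + b' i) - b i \<in> I" if "i < k" for i using b'[OF that] by simp
      show "d i \<in> I" if "i < l" for i using d(1) that by blast
    qed
    moreover have "\<forall>i<k + l. (if i < k then b i + b' i else d (i - k)) \<in> P" using b' d by auto
    ultimately have "k + l \<le> m" by (rule rank_leD[OF rank])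
    then show "k \<le> m - l" by simp
  qed
  moreover have "1 \<le> m - l"
    using quot[unfolded rank_le_def lineality_quotient[OF P I], rule_format, of 1 "\<lambda>_. q"]
      q subset_quotient_cone[OF I] indep_mod_single[OF sub q(2)] by auto
  moreover have "1 \<le> l" using l(2) \<open>Q 1\<close> by blast
  ultimately show ?thesis by (intro that[of "m - l" l]) auto
qed

text \<open>The other summands being positive, y k alone lies below p + w and can be split; the
  rests of p and w still dominate the remaining sum.\<close>

lemma riesz_decompose_sum:
  fixes k :: nat
  assumes P: "cone P" and R: "riesz P"
    and "p \<in> P" "w \<in> P" "\<And>i. i < k \<Longrightarrow> y i \<in> P" "p + w - (\<Sum>i<k. y i) \<in> P"
  shows "\<exists>x. (\<forall>i<k. x i \<in> P \<and> y i - x i \<in> P) \<and> p - (\<Sum>i<k. x i) \<in> P \<and> w - (\<Sum>i<k. y i - x i) \<in> P"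
  using assms(3-)
proof (induction k arbitrary: p w)
  case 0
  then show ?case by simp
next
  case (Suc k)
  have "(p + w - (\<Sum>i<Suc k. y i)) + (\<Sum>i<k. y i) \<in> P"
    using Suc.prems by (intro cone_add[OF P] cone_sum[OF P]) auto
  then have "p + w - y k \<in> P" by (simp add: algebra_simps)
  then obtain x where x: "x \<in> P" "p - x \<in> P" "y k - x \<in> P" "w - (y k - x) \<in> P"
    using rieszE[OF R Suc.prems(1,2)] Suc.prems(3) by blast
  have "(p - x) + (w - (y k - x)) - (\<Sum>i<k. y i) \<in> P" using Suc.prems(4) by (simp add: algebra_simps)
  then obtain z where z: "\<forall>i<k. z i \<in> P \<and> y i - z i \<in> P" "p - x - (\<Sum>i<k. z i) \<in> P"
    "w - (y k - x) - (\<Sum>i<k. y i - z i) \<in> P"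
    using Suc.IH[OF x(2,4)] Suc.prems(3) by auto
  show ?case
  proof (intro exI[of _ "z(k := x)"] conjI allI impI)
    fix i assume "i < Suc k"
    then show "(z(k := x)) i \<in> P" "y i - (z(k := x)) i \<in> P" using x z by (auto simp: less_Suc_eq)
  next
    show "p - (\<Sum>i<Suc k. (z(k := x)) i) \<in> P" using z(2) by (simp add: algebra_simps)
    show "w - (\<Sum>i<Suc k. y i - (z(k := x)) i) \<in> P" using z(3) by (simp add: algebra_simps)
  qed
qed

text \<open>If \<open>w \<in> I\<close> is chosen with \<open>\<Sum> c\<^sub>i b\<^sub>i \<le> p + w\<close>, then Riesz decomposition splits each \<open>c\<^sub>i b\<^sub>i\<close> into a
  part below \<open>p\<close> and a part below \<open>w\<close>, and the latter lies in \<open>I\<close>.\<close>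
lemma shrink_below:
  fixes k :: nat
  assumes P: "cone P" and R: "riesz P" and I: "order_ideal P I"
    and F: "finite F" "F \<subseteq> P" and b: "\<And>i. i < k \<Longrightarrow> b i \<in> P"
    and c: "\<And>p i. p \<in> F \<Longrightarrow> i < k \<Longrightarrow> 0 \<le> c p i"
    and cI: "\<And>p. p \<in> F \<Longrightarrow> p - (\<Sum>i<k. c p i *\<^sub>Q b i) \<in> I"
  shows "\<exists>b'. (\<forall>i<k. b' i \<in> P \<and> b i - b' i \<in> P \<inter> I) \<and> (\<forall>p\<in>F. p - (\<Sum>i<k. c p i *\<^sub>Q b' i) \<in> P \<inter> I)"
  using F c cI
proof (induction F)
  case empty
  show ?case using b cone_zero[OF P] subspace_0[OF order_idealD(1)[OF I]] by (intro exI[of _ b]) simp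
next
  case (insert p F)
  note sub = order_idealD(1)[OF I]
  obtain b' where b': "\<forall>i<k. b' i \<in> P \<and> b i - b' i \<in> P \<inter> I"
      "\<forall>q\<in>F. q - (\<Sum>i<k. c q i *\<^sub>Q b' i) \<in> P \<inter> I"
    using insert by auto
  have p: "p \<in> P" and cp: "\<And>i. i < k \<Longrightarrow> 0 \<le> c p i" using insert by auto
  have move: "q - (\<Sum>i<k. c q i *\<^sub>Q d i) + (\<Sum>i<k. c q i *\<^sub>Q (d i - d' i)) = q - (\<Sum>i<k. c q i *\<^sub>Q d' i)" for q d d'
    by (simp add: scale_right_diff_distrib sum_subtractf)
  have "(\<Sum>i<k. c p i *\<^sub>Q (b i - b' i)) \<in> I"
    using b' by (intro subspace_sum[OF sub] subspace_scale[OF sub]) auto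
  then have "p - (\<Sum>i<k. c p i *\<^sub>Q b i) + (\<Sum>i<k. c p i *\<^sub>Q (b i - b' i)) \<in> I"
    using insert.prems(3) by (intro subspace_add[OF sub]) auto
  then have vI: "p - (\<Sum>i<k. c p i *\<^sub>Q b' i) \<in> I" unfolding move .
  then obtain w where w: "w \<in> P" "w \<in> I" "p - (\<Sum>i<k. c p i *\<^sub>Q b' i) + w \<in> P"
    using order_idealD(3)[OF I] by blast
  obtain x where x: "\<forall>i<k. x i \<in> P \<and> c p i *\<^sub>Q b' i - x i \<in> P" "p - (\<Sum>i<k. x i) \<in> P"
    "w - (\<Sum>i<k. c p i *\<^sub>Q b' i - x i) \<in> P"
    using riesz_decompose_sum[OF P R p w(1), of k "\<lambda>i. c p i *\<^sub>Q b' i"] w(3) b' cp cone_scale[OF P]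
    by (auto simp: algebra_simps)
  \<comment> \<open>One summand of the part below w is itself below w, because the other summands
    are positive; as w is in I, heredity applies.\<close>
  have xI: "c p i *\<^sub>Q b' i - x i \<in> I" if i: "i < k" for i
  proof (rule order_idealD(2)[OF I _ w(2)])
    show "c p i *\<^sub>Q b' i - x i \<in> P" using x i by blast
    have "(\<Sum>j<k. c p j *\<^sub>Q b' j - x j) = (c p i *\<^sub>Q b' i - x i) + (\<Sum>j\<in>{..<k} - {i}. c p j *\<^sub>Q b' j - x j)"
      using i by (intro sum.remove) auto
    moreover have "(w - (\<Sum>j<k. c p j *\<^sub>Q b' j - x j)) + (\<Sum>j\<in>{..<k} - {i}. c p j *\<^sub>Q b' j - x j) \<in> P"
      using x by (intro cone_add[OF P] cone_sum[OF P]) auto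
    moreover have "(w - s) + t = w - y" if "s = y + t" for s t y :: 'v using that by simp
    ultimately show "w - (c p i *\<^sub>Q b' i - x i) \<in> P" by metis
  qed
  define d where "d i = (if c p i = 0 then b' i else inverse (c p i) *\<^sub>Q x i)" for i
  have dP: "d i \<in> P" if "i < k" for i
    using that b' x cp[OF that] cone_scale[OF P] by (simp add: d_def)
  have bd: "b' i - d i \<in> P \<inter> I" if i: "i < k" for i
  proof (cases "c p i = 0")
    case True
    then show ?thesis using cone_zero[OF P] subspace_0[OF sub] by (simp add: d_def)
  next
    case False
    then have "b' i - d i = inverse (c p i) *\<^sub>Q (c p i *\<^sub>Q b' i - x i)"
      by (simp add: d_def scale_right_diff_distrib)
    then show ?thesis
      using x xI[OF i] i cp[OF i] cone_scale[OF P] subspace_scale[OF sub] by simp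
  qed
  have "p - (\<Sum>i<k. c p i *\<^sub>Q d i) \<in> P"
  proof -
    have "x i - c p i *\<^sub>Q d i \<in> P" if "i < k" for i
      using that x cone_zero[OF P] by (simp add: d_def)
    then have "p - (\<Sum>i<k. x i) + (\<Sum>i<k. x i - c p i *\<^sub>Q d i) \<in> P"
      using x by (intro cone_add[OF P] cone_sum[OF P]) auto
    then show ?thesis by (simp add: sum_subtractf)
  qed
  moreover have "p - (\<Sum>i<k. c p i *\<^sub>Q d i) \<in> I"
  proof -
    have "(\<Sum>i<k. c p i *\<^sub>Q (b' i - d i)) \<in> I"
      using bd by (intro subspace_sum[OF sub] subspace_scale[OF sub]) auto
    then show ?thesis unfolding move[symmetric, of p d b'] by (rule subspace_add[OF sub vI])
  qed
  \<comment> \<open>For a q treated earlier, shrinking b' to d adds a positive element of I to the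
    remainder. So the elements of F can be treated one after another.\<close>
  moreover have "q - (\<Sum>i<k. c q i *\<^sub>Q d i) \<in> P \<inter> I" if q: "q \<in> F" for q
  proof -
    have "(\<Sum>i<k. c q i *\<^sub>Q (b' i - d i)) \<in> P \<inter> I"
      using bd q insert.prems(2)[of q]
      by (intro cone_sum[OF cone_Int_ideal[OF P I]] cone_scale[OF cone_Int_ideal[OF P I]]) auto
    then show ?thesis using cone_add[OF cone_Int_ideal[OF P I]] b'(2) q unfolding move[symmetric, of q d b']
      by blast
  qed
  moreover have "b i - d i \<in> P \<inter> I" if "i < k" for i
    using cone_add[OF cone_Int_ideal[OF P I], of "b i - b' i" "b' i - d i"] b' bd that by simp
  ultimately show ?case using dP by (intro exI[of _ d]) auto
qed

theorem riesz_finite_subset_in_cone: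
  assumes "cone P" "riesz P" "rank_le P m" "finite F" "F \<subseteq> P"
  shows "\<exists>d b. d \<le> m \<and> (\<forall>i<d. b i \<in> P) \<and> (\<forall>p\<in>F. in_cone (lineality P) d b p)"
  using assms
proof (induction m arbitrary: P F rule: less_induct)
  case (less m)
  note P = less.prems(1) and R = less.prems(2) and rank = less.prems(3) and F = less.prems(4,5)
  note L = subspace_lineality[OF P]
  \<comment> \<open>If neither of the first two cases holds, some positive p outside the lineality
    space has no multiple above some q in P. The ideal generated by p then contains p but not
    q.\<close>
  consider (linear) "\<forall>u\<in>P. - u \<in> P"
    | (simple) u where "u \<in> P" "- u \<notin> P" "\<forall>p\<in>P. - p \<notin> P \<longrightarrow> (\<forall>q\<in>P. \<exists>r\<ge>0. r *\<^sub>Q p - q \<in> P)"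
    | (ideal) p q where "p \<in> P" "- p \<notin> P" "q \<in> P" "\<forall>r\<ge>0. r *\<^sub>Q p - q \<notin> P"
    by blast
  then show ?case
  proof cases
    case linear
    then have "in_cone (lineality P) 0 b p" if "p \<in> F" for p b
      using that F by (auto simp: in_cone_def lineality_def)
    then show ?thesis by (intro exI[of _ 0]) simp
  next
    case simple
    interpret simple_cone scale P u
      by unfold_locales (use P R simple in auto)
    show ?thesis using finite_subset_in_cone[OF rank F] by metis
  next
    case ideal
    define I where "I = {v. \<exists>r\<ge>0. r *\<^sub>Q p - v \<in> P \<and> r *\<^sub>Q p + v \<in> P}"
    have I: "order_ideal P I" unfolding I_def by (rule principal_order_ideal[OF P ideal(1)])
    note sub = order_idealD(1)[OF I]
    have "p \<in> I"
      unfolding I_def using cone_zero[OF P] cone_add[OF P ideal(1,1)] by (intro CollectI exI[of _ 1]) simp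
    moreover have "q \<notin> I" using ideal(4) by (auto simp: I_def)
    moreover have "p \<notin> lineality P" using ideal(2) by (simp add: lineality_def)
    ultimately obtain k l where kl: "k + l \<le> m" "0 < k" "0 < l"
      and rank1: "rank_le (quotient_cone P I) k" and rank2: "rank_le (P \<inter> I) l"
      using rank_split[OF P I rank, of p q] ideal by blast
    have "k < m" "l < m" using kl by auto
    obtain d1 b1 where d1: "d1 \<le> k" "\<forall>i<d1. b1 i \<in> quotient_cone P I" "\<forall>p\<in>F. in_cone I d1 b1 p"
      using less.IH[OF \<open>k < m\<close> cone_quotient[OF P I] riesz_quotient[OF P R I] rank1 F(1)]
        F(2) subset_quotient_cone[OF I] unfolding lineality_quotient[OF P I] by blast
    have "\<forall>i. \<exists>j. i < d1 \<longrightarrow> j \<in> I \<and> b1 i + j \<in> P" using d1(2) by (auto simp: quotient_cone_def)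
    then obtain j where j: "\<And>i. i < d1 \<Longrightarrow> j i \<in> I \<and> b1 i + j i \<in> P" by metis
    \<comment> \<open>The generators for the quotient lie in P only after a shift by elements of I,
      and cone membership modulo I does not notice the shift.\<close>
    have "in_cone I d1 (\<lambda>i. b1 i + j i) p" if "p \<in> F" for p
      using in_cone_cong_mod[OF sub, of d1 b1 "\<lambda>i. b1 i + j i"] d1(3) that j subspace_neg[OF sub] by simp
    then obtain c where c: "\<And>p i. p \<in> F \<Longrightarrow> i < d1 \<Longrightarrow> 0 \<le> c p i"
      "\<And>p. p \<in> F \<Longrightarrow> p - (\<Sum>i<d1. c p i *\<^sub>Q (b1 i + j i)) \<in> I"
      unfolding in_cone_def by metis
    obtain b where b: "\<forall>i<d1. b i \<in> P" "\<forall>p\<in>F. p - (\<Sum>i<d1. c p i *\<^sub>Q b i) \<in> P \<inter> I"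
      using shrink_below[OF P R I F, of d1 "\<lambda>i. b1 i + j i" c] j c by blast
    let ?F = "(\<lambda>p. p - (\<Sum>i<d1. c p i *\<^sub>Q b i)) ` F"
    have F': "finite ?F" "?F \<subseteq> P \<inter> I" using F(1) b(2) by auto
    note IH2 = less.IH[OF \<open>l < m\<close> cone_Int_ideal[OF P I] riesz_Int_ideal[OF P R I] rank2 F',
        unfolded lineality_Int_ideal[OF P I]]
    obtain d2 b2 where d2': "d2 \<le> l \<and> (\<forall>i<d2. b2 i \<in> P \<inter> I) \<and> (\<forall>p\<in>?F. in_cone (lineality P) d2 b2 p)"
      using IH2 by (elim exE) (rule that)
    then have d2: "d2 \<le> l" "\<forall>i<d2. b2 i \<in> P \<inter> I" "\<forall>p\<in>?F. in_cone (lineality P) d2 b2 p"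
      by (blast, blast, blast)
    let ?b = "\<lambda>i. if i < d1 then b i else b2 (i - d1)"
    have "in_cone (lineality P) (d1 + d2) ?b p" if p: "p \<in> F" for p
    proof -
      obtain e where e: "\<forall>i<d2. 0 \<le> e i"
        "p - (\<Sum>i<d1. c p i *\<^sub>Q b i) - (\<Sum>i<d2. e i *\<^sub>Q b2 i) \<in> lineality P"
        using d2(3) p by (auto simp: in_cone_def)
      let ?c = "\<lambda>i. if i < d1 then c p i else e (i - d1)"
      have "(\<Sum>i<d1 + d2. ?c i *\<^sub>Q ?b i) = (\<Sum>i<d1. c p i *\<^sub>Q b i) + (\<Sum>i<d2. e i *\<^sub>Q b2 i)"
        by (simp add: sum_lessThan_append)
      moreover have "\<forall>i<d1 + d2. 0 \<le> ?c i" using c(1)[OF p] e(1) by auto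
      ultimately show ?thesis
        unfolding in_cone_def using e(2) by (intro exI[of _ ?c]) (simp add: diff_diff_add)
    qed
    then have "\<forall>p\<in>F. in_cone (lineality P) (d1 + d2) ?b p" ..
    moreover have "\<forall>i<d1 + d2. ?b i \<in> P" using b(1) d2(2) by auto
    moreover have "d1 + d2 \<le> m" using d1(1) d2(1) kl(1) by simp
    ultimately show ?thesis by (intro exI[of _ "d1 + d2"] exI[of _ ?b] conjI)
  qed
qed

end

section \<open>Chains of bases of rational vector spaces\<close>

context rat_space begin

lemma indep_mod_zeroD:
  assumes "indep_mod {0} k b"
  shows "inj_on b {..<k}" "independent (b ` {..<k})"
proof -
  show inj: "inj_on b {..<k}"
  proof (rule inj_onI, rule ccontr)
    fix i j assume ij: "i \<in> {..<k}" "j \<in> {..<k}" "b i = b j" "i \<noteq> j"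
    let ?c = "\<lambda>l. (if l = i then 1 else 0) - (if l = j then 1 else 0) :: rat"
    have "(\<Sum>l<k. ?c l *\<^sub>Q b l)
        = (\<Sum>l<k. (if l = i then b l else 0)) - (\<Sum>l<k. (if l = j then b l else 0))"
      by (subst sum_subtractf[symmetric]) (rule sum.cong, auto)
    also have "\<dots> = 0" using ij by simp
    finally have "\<forall>l<k. ?c l = 0" using assms[unfolded indep_mod_def, rule_format, of ?c] by simp
    then show False using ij by auto
  qed
  show "independent (b ` {..<k})"
  proof
    assume "dependent (b ` {..<k})"
    then obtain u v where u: "v \<in> b ` {..<k}" "u v \<noteq> 0" "(\<Sum>v\<in>b ` {..<k}. u v *\<^sub>Q v) = 0"
      by (subst (asm) dependent_finite) auto
    have "(\<Sum>i<k. u (b i) *\<^sub>Q b i) = 0" using u(3) by (simp add: sum.reindex[OF inj])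
    then have "\<forall>i<k. u (b i) = 0"
      using assms[unfolded indep_mod_def, rule_format, of "\<lambda>i. u (b i)"] by simp
    then show False using u by auto
  qed
qed

lemma indep_mod_zeroI:
  assumes inj: "inj_on b {..<k}" and ind: "independent (b ` {..<k})"
  shows "indep_mod {0} k b"
  unfolding indep_mod_def
proof (intro allI impI)
  fix c i assume c: "(\<Sum>i<k. c i *\<^sub>Q b i) \<in> {0}" and i: "i < k"
  let ?u = "\<lambda>v. c (the_inv_into {..<k} b v)"
  have u: "?u (b i) = c i" if "i < k" for i using the_inv_into_f_f[OF inj] that by simp
  have "(\<Sum>v\<in>b ` {..<k}. ?u v *\<^sub>Q v) = 0" using c u by (simp add: sum.reindex[OF inj])
  then have "?u (b i) = 0"
    using i by (intro independentD[OF ind _ order_refl]) auto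
  then show "c i = 0" using u[OF i] by simp
qed

lemma indep_mod_scale:
  assumes "indep_mod {0} k b" "r \<noteq> 0" shows "indep_mod {0} k (\<lambda>i. r *\<^sub>Q b i)"
  unfolding indep_mod_def
proof (intro allI impI)
  fix c i assume "(\<Sum>i<k. c i *\<^sub>Q r *\<^sub>Q b i) \<in> {0}" and i: "i < k"
  then have "\<forall>i<k. c i * r = 0"
    using assms(1)[unfolded indep_mod_def, rule_format, of "\<lambda>i. c i * r"] by simp
  then show "c i = 0" using i assms(2) by simp
qed

end

section \<open>Rational n-space and the monoids spanned by its bases\<close>

definition qscale :: "rat \<Rightarrow> (nat \<Rightarrow> rat) \<Rightarrow> nat \<Rightarrow> rat" where
  "qscale c v = (\<lambda>i. c * v i)"

interpretation qv: rat_space qscale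
  by unfold_locales (auto simp: qscale_def fun_eq_iff algebra_simps)

text \<open>Q^n is placed inside the space of all rational sequences, whose type is an additive
  group, so one vector space structure serves every n.\<close>

definition qvec :: "nat \<Rightarrow> (nat \<Rightarrow> rat) set" where
  "qvec n = {v. \<forall>i\<ge>n. v i = 0}"

definition unit_vec :: "nat \<Rightarrow> nat \<Rightarrow> rat" where
  "unit_vec i = (\<lambda>j. if j = i then 1 else 0)"

lemma sum_fun_apply: "(\<Sum>i\<in>A. f i) x = (\<Sum>i\<in>A. f i x)"
  for f :: "'i \<Rightarrow> 'a \<Rightarrow> 'b::comm_monoid_add"
  by (induction A rule: infinite_finite_induct) auto

lemma subspace_qvec: "qv.subspace (qvec n)"
  by (auto simp: qv.subspace_def qvec_def qscale_def)

lemma qvec_span: "qvec n \<subseteq> qv.span (unit_vec ` {..<n})"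
proof
  fix v assume v: "v \<in> qvec n"
  have "v = (\<Sum>i<n. qscale (v i) (unit_vec i))"
  proof
    fix j
    have "(\<Sum>i<n. qscale (v i) (unit_vec i)) j = (\<Sum>i<n. if j = i then v i else 0)"
      unfolding sum_fun_apply by (rule sum.cong) (auto simp: qscale_def unit_vec_def)
    also have "\<dots> = v j" using v by (auto simp: qvec_def)
    finally show "v j = (\<Sum>i<n. qscale (v i) (unit_vec i)) j" by simp
  qed
  also have "\<dots> \<in> qv.span (unit_vec ` {..<n})"
    by (intro qv.span_sum qv.span_scale qv.span_base) auto
  finally show "v \<in> qv.span (unit_vec ` {..<n})" .
qed

lemma unit_vec_indep: "qv.indep_mod {0} n unit_vec"
  unfolding qv.indep_mod_def
proof (intro allI impI)
  fix c i assume c: "(\<Sum>i<n. qscale (c i) (unit_vec i)) \<in> {0}" and i: "i < n"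
  have "(\<Sum>j<n. qscale (c j) (unit_vec j)) i = (\<Sum>j<n. if i = j then c j else 0)"
    unfolding sum_fun_apply by (rule sum.cong) (auto simp: qscale_def unit_vec_def)
  then show "c i = 0" using c i by simp
qed

lemma indep_qvec_bound:
  assumes "qv.indep_mod {0} k b" "\<forall>i<k. b i \<in> qvec n" shows "k \<le> n"
proof -
  have "card (b ` {..<k}) \<le> card (unit_vec ` {..<n})"
    using assms qvec_span[of n] qv.indep_mod_zeroD(2)[OF assms(1)]
    by (intro qv.independent_span_bound[THEN conjunct2]) auto
  also have "\<dots> \<le> n" using card_image_le[of "{..<n}" unit_vec] by simp
  finally show ?thesis using card_image[OF qv.indep_mod_zeroD(1)[OF assms(1)]] by simp
qed

lemma spanning_qvec_indep:
  assumes span: "qvec n \<subseteq> qv.span (b ` {..<k})" and k: "k \<le> n"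
  shows "k = n" "qv.indep_mod {0} n b"
proof -
  obtain B where B: "B \<subseteq> b ` {..<k}" "qv.independent B" "b ` {..<k} \<subseteq> qv.span B"
    using qv.maximal_independent_subset by blast
  have fin: "finite B" using B(1) finite_subset by blast
  have "unit_vec ` {..<n} \<subseteq> qv.span B"
  proof -
    have "unit_vec ` {..<n} \<subseteq> qvec n" by (auto simp: qvec_def unit_vec_def)
    also have "\<dots> \<subseteq> qv.span (b ` {..<k})" by (rule span)
    also have "\<dots> \<subseteq> qv.span B" using B(3) by (metis qv.span_mono qv.span_span)
    finally show ?thesis .
  qed
  then have "card (unit_vec ` {..<n}) \<le> card B"
    using qv.independent_span_bound[OF fin qv.indep_mod_zeroD(2)[OF unit_vec_indep]] by blast
  then have n: "n \<le> card B" using card_image[OF qv.indep_mod_zeroD(1)[OF unit_vec_indep]] by simp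
  have c: "card B \<le> card (b ` {..<k})" "card (b ` {..<k}) \<le> k"
    using card_mono[OF _ B(1)] card_image_le[of "{..<k}" b] by auto
  then show kn: "k = n" using n k by simp
  have "B = b ` {..<k}" using card_subset_eq[OF _ B(1)] n k c by simp
  moreover have "inj_on b {..<k}" using n k c by (intro eq_card_imp_inj_on) auto
  ultimately show "qv.indep_mod {0} n b" using B(2) kn by (auto intro: qv.indep_mod_zeroI)
qed

lemma countable_qvec: "countable (qvec n)"
proof -
  have "qvec n \<subseteq> (\<lambda>xs i. if i < n then xs ! i else 0) ` (UNIV :: rat list set)"
  proof
    fix v :: "nat \<Rightarrow> rat" assume "v \<in> qvec n"
    then have "v = (\<lambda>i. if i < n then map v [0..<n] ! i else 0)" by (auto simp: qvec_def)
    then show "v \<in> (\<lambda>xs i. if i < n then xs ! i else 0) ` (UNIV :: rat list set)" by blast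
  qed
  then show ?thesis by (rule countable_subset) simp
qed

lemma common_denominator:
  assumes "finite S"
  obtains N :: nat where "N > 0" "\<And>r :: rat. r \<in> S \<Longrightarrow> \<exists>m. of_nat N * r = of_int m"
proof -
  have "\<exists>N>0. \<forall>r\<in>S. \<exists>m. of_nat N * (r :: rat) = of_int m"
    using assms
  proof (induction S)
    case empty
    show ?case by (intro exI[of _ 1]) simp
  next
    case (insert r S)
    then obtain N :: nat where N: "N > 0" "\<forall>r\<in>S. \<exists>m. of_nat N * r = of_int m" by blast
    obtain a b where ab: "r = of_int a / of_int b" "b > 0"
      by (metis Fract_of_int_quotient Rat_cases)
    have "\<exists>m. of_nat (nat b * N) * s = of_int m" if s: "s \<in> insert r S" for s
    proof (cases "s = r")
      case True
      then have "of_nat (nat b * N) * s = of_int (int N * a)" using ab by simp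
      then show ?thesis by blast
    next
      case False
      then obtain m where "of_nat N * s = of_int m" using N s by auto
      then have "of_nat (nat b * N) * s = of_int (b * m)" using ab(2) by simp
      then show ?thesis by blast
    qed
    then show ?case using ab N(1) by (intro exI[of _ "nat b * N"]) auto
  qed
  then show ?thesis using that by blast
qed

text \<open>The image of the positive cone of Z^n under the homomorphism that sends the standard
  basis to b.\<close>

definition nat_span :: "nat \<Rightarrow> (nat \<Rightarrow> nat \<Rightarrow> rat) \<Rightarrow> (nat \<Rightarrow> rat) set" where
  "nat_span n b = {v. \<exists>c :: nat \<Rightarrow> nat. v = (\<Sum>i<n. qscale (of_nat (c i)) (b i))}"

text \<open>Each unit vector is a difference p i - q i in P. With these added to F, the covering
  cone spans Q^n, so its at most n generators form a basis. Dividing them by a common denominator of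
  the coordinates of F turns those coordinates into natural numbers.\<close>

lemma riesz_cone_basis:
  assumes P: "qv.cone P" and R: "qv.riesz P" and lin: "qv.lineality P = {0}" and gen: "qv.gen P = qvec n"
    and F: "finite F" "F \<subseteq> P"
  shows "\<exists>b. (\<forall>i<n. b i \<in> P) \<and> qv.indep_mod {0} n b \<and> F \<subseteq> nat_span n b"
proof -
  have PV: "P \<subseteq> qvec n" using qv.cone_subset_gen[OF P] gen by simp
  have rank: "qv.rank_le P n"
    unfolding qv.rank_le_def lin using indep_qvec_bound PV by blast
  have "\<forall>i. \<exists>p q. i < n \<longrightarrow> p \<in> P \<and> q \<in> P \<and> unit_vec i = p - q"
  proof
    fix i
    have "unit_vec i \<in> qv.gen P" if "i < n" using that unfolding gen by (simp add: qvec_def unit_vec_def)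
    then show "\<exists>p q. i < n \<longrightarrow> p \<in> P \<and> q \<in> P \<and> unit_vec i = p - q" by (auto simp: qv.gen_def)
  qed
  then obtain p q where pq: "\<And>i. i < n \<Longrightarrow> p i \<in> P \<and> q i \<in> P \<and> unit_vec i = p i - q i" by metis
  let ?F = "F \<union> p ` {..<n} \<union> q ` {..<n}"
  have F': "finite ?F" "?F \<subseteq> P" using F pq by auto
  obtain d b where d: "d \<le> n" and b: "\<forall>i<d. b i \<in> P" and cov: "\<forall>p\<in>?F. qv.in_cone {0} d b p"
    using qv.riesz_finite_subset_in_cone[OF P R rank F'] unfolding lin by blast
  obtain c where c: "\<And>p i. p \<in> ?F \<Longrightarrow> i < d \<Longrightarrow> 0 \<le> c p i"
    "\<And>p. p \<in> ?F \<Longrightarrow> p = (\<Sum>i<d. qscale (c p i) (b i))"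
    using cov unfolding qv.in_cone_def singleton_iff right_minus_eq by metis
  have span: "p \<in> qv.span (b ` {..<d})" if "p \<in> ?F" for p
    by (subst c(2)[OF that]) (intro qv.span_sum qv.span_scale qv.span_base, auto)
  have "unit_vec ` {..<n} \<subseteq> qv.span (b ` {..<d})"
  proof
    fix v assume "v \<in> unit_vec ` {..<n}"
    then obtain i where i: "i < n" "v = p i - q i" using pq by auto
    have "p i \<in> ?F" "q i \<in> ?F" using i by auto
    then show "v \<in> qv.span (b ` {..<d})" unfolding i(2) by (intro qv.span_diff span)
  qed
  then have "qvec n \<subseteq> qv.span (b ` {..<d})"
    using qvec_span by (metis order_trans qv.span_mono qv.span_span)
  then have dn: "d = n" and ind: "qv.indep_mod {0} n b" using spanning_qvec_indep d by blast+
  let ?S = "(\<lambda>(p, i). c p i) ` (F \<times> {..<n})"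
  have "finite ?S" using F by blast
  then obtain N :: nat where N: "N > 0" "\<And>r. r \<in> ?S \<Longrightarrow> \<exists>m. of_nat N * r = of_int m"
    using common_denominator by metis
  define b' where "b' i = qscale (inverse (of_nat N)) (b i)" for i
  have "v \<in> nat_span n b'" if v: "v \<in> F" for v
  proof -
    have "\<exists>m::nat. of_nat N * c v i = of_nat m" if "i < n" for i
    proof -
      have "c v i \<in> ?S" using v that by force
      then obtain z where z: "of_nat N * c v i = of_int z" using N(2) by blast
      have "0 \<le> of_nat N * c v i" using c(1)[of v i] v that dn by simp
      then have "of_nat N * c v i = of_nat (nat z)" unfolding z by simp
      then show ?thesis by blast
    qed
    then obtain m :: "nat \<Rightarrow> nat" where m: "\<And>i. i < n \<Longrightarrow> of_nat N * c v i = of_nat (m i)" by metis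
    have "v = (\<Sum>i<n. qscale (c v i) (b i))" using c(2)[of v] v dn by simp
    also have "\<dots> = (\<Sum>i<n. qscale (of_nat (m i)) (b' i))"
      using N(1) by (intro sum.cong) (auto simp: b'_def field_simps simp flip: m)
    finally show ?thesis by (auto simp: nat_span_def)
  qed
  moreover have "qv.indep_mod {0} n b'"
    unfolding b'_def using qv.indep_mod_scale[OF ind] N(1) by simp
  moreover have "\<forall>i<n. b' i \<in> P" using b dn qv.cone_scale[OF P] by (simp add: b'_def)
  ultimately show ?thesis by blast
qed

lemma nat_span_mono:
  assumes "\<forall>i<n. b i \<in> nat_span n b'" shows "nat_span n b \<subseteq> nat_span n b'"
proof -
  have "\<forall>i. \<exists>c :: nat \<Rightarrow> nat. i < n \<longrightarrow> b i = (\<Sum>j<n. qscale (of_nat (c j)) (b' j))"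
    using assms by (auto simp: nat_span_def)
  then obtain c :: "nat \<Rightarrow> nat \<Rightarrow> nat" where c: "\<And>i. i < n \<Longrightarrow> b i = (\<Sum>j<n. qscale (of_nat (c i j)) (b' j))"
    by metis
  show ?thesis
  proof
    fix v assume "v \<in> nat_span n b"
    then obtain d :: "nat \<Rightarrow> nat" where "v = (\<Sum>i<n. qscale (of_nat (d i)) (b i))" by (auto simp: nat_span_def)
    also have "\<dots> = (\<Sum>i<n. \<Sum>j<n. qscale (of_nat (d i * c i j)) (b' j))"
      using c by (simp add: qv.scale_sum_right)
    also have "\<dots> = (\<Sum>j<n. qscale (of_nat (\<Sum>i<n. d i * c i j)) (b' j))"
      by (subst sum.swap) (simp add: qv.scale_sum_left)
    finally show "v \<in> nat_span n b'"
      unfolding nat_span_def by (intro CollectI exI[of _ "\<lambda>j. \<Sum>i<n. d i * c i j"])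
  qed
qed

text \<open>Each new basis is chosen to cover the next element of an enumeration of P and also the
  previous basis, which gives the inclusions.\<close>

lemma riesz_cone_chain:
  assumes P: "qv.cone P" and R: "qv.riesz P" and lin: "qv.lineality P = {0}" and gen: "qv.gen P = qvec n"
  obtains b where "\<And>k. qv.indep_mod {0} n (b k)" "\<And>k. nat_span n (b k) \<subseteq> nat_span n (b (Suc k))"
    "\<And>k. nat_span n (b k) \<subseteq> P" "(\<Union>k\<in>{1..}. nat_span n (b k)) = P"
proof -
  have "P \<subseteq> qvec n" using qv.cone_subset_gen[OF P] gen by simp
  then have "countable P" using countable_qvec countable_subset by blast
  define e where "e = from_nat_into P"
  have "P \<noteq> {}" using qv.cone_zero[OF P] by blast
  then have e: "range e = P" unfolding e_def using \<open>countable P\<close> by (rule range_from_nat_into)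
  define Q where "Q k b \<longleftrightarrow> (\<forall>i<n. b i \<in> P) \<and> qv.indep_mod {0} n b" for k :: nat and b
  define S where "S k b b' \<longleftrightarrow> e k \<in> nat_span n b' \<and> nat_span n b \<subseteq> nat_span n b'" for k b b'
  have "\<exists>b. Q 0 b" using riesz_cone_basis[OF assms, of "{}"] by (auto simp: Q_def)
  moreover have "\<exists>b'. Q (Suc k) b' \<and> S k b b'" if "Q k b" for k b
  proof -
    have "finite (insert (e k) (b ` {..<n}))" "insert (e k) (b ` {..<n}) \<subseteq> P"
      using that e by (auto simp: Q_def)
    then obtain b' where "\<forall>i<n. b' i \<in> P" "qv.indep_mod {0} n b'" "insert (e k) (b ` {..<n}) \<subseteq> nat_span n b'"
      using riesz_cone_basis[OF assms] by meson
    then show ?thesis using nat_span_mono[of n b b'] by (intro exI[of _ b']) (auto simp: Q_def S_def)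
  qed
  ultimately obtain b where b: "\<And>k. Q k (b k)" "\<And>k. S k (b k) (b (Suc k))"
    using dependent_nat_choice[of Q S] by metis
  have bP: "nat_span n (b k) \<subseteq> P" for k
    using b(1)[of k] qv.cone_scale[OF P]
    by (auto simp: nat_span_def Q_def intro!: qv.cone_sum[OF P])
  \<comment> \<open>\<open>e k\<close> is covered from stage Suc k on, so the union may start at 1;
    stage 0 only starts the recursion.\<close>
  have "v \<in> (\<Union>k\<in>{1..}. nat_span n (b k))" if v: "v \<in> P" for v
  proof -
    obtain k where "v = e k" using v e by blast
    then have "v \<in> nat_span n (b (Suc k))" using b(2)[of k] by (simp add: S_def)
    then show ?thesis by (intro UN_I[of "Suc k"]) simp_all
  qed
  then have "(\<Union>k\<in>{1..}. nat_span n (b k)) = P" using bP by blast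
  then show ?thesis using b bP by (intro that[of b]) (auto simp: Q_def S_def)
qed

section \<open>Limits of embeddings\<close>

text \<open>The connecting map from i to j is \<open>\<Phi> i\<close> followed by the inverse of
  \<open>\<Phi> j\<close>. A class of the limit is then a fibre, the set of all (i, x) with
  \<open>\<Phi> i x\<close> equal to a given v, and v is the corresponding element of H.\<close>

lemma inductive_limit_of_embeddings:
  fixes M :: "'b ordgroup" and H :: "'c ordgroup" and \<Phi> :: "nat \<Rightarrow> 'b \<Rightarrow> 'c"
  assumes M: "ordered_group M" and H: "group H"
    and hom: "\<And>k. \<Phi> k \<in> hom M H" and inj: "\<And>k. inj_on (\<Phi> k) (carrier M)"
    and carrier_mono: "\<And>k. \<Phi> k ` carrier M \<subseteq> \<Phi> (Suc k) ` carrier M"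
    and Pos_mono: "\<And>k. \<Phi> k ` pos_cone M \<subseteq> \<Phi> (Suc k) ` pos_cone M"
    and carrier: "(\<Union>k\<in>{1..}. \<Phi> k ` carrier M) = carrier H"
    and Pos: "(\<Union>k\<in>{1..}. \<Phi> k ` pos_cone M) = pos_cone H"
  shows "\<exists>\<phi>. inductive_system {1::nat..} (\<lambda>_. M) \<phi> \<and> inductive_limit {1::nat..} (\<lambda>_. M) \<phi> \<cong>\<^sub>o H"
proof -
  interpret M: ordered_group M by fact
  interpret H: group H by fact
  note Pc = M.Pos_subset
  have mult: "\<Phi> k (x \<otimes>\<^bsub>M\<^esub> y) = \<Phi> k x \<otimes>\<^bsub>H\<^esub> \<Phi> k y" if "x \<in> carrier M" "y \<in> carrier M" for k x y
    using hom_mult[OF hom that] .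
  have cmono: "\<Phi> i ` carrier M \<subseteq> \<Phi> j ` carrier M" if "i \<le> j" for i j
    using that carrier_mono lift_Suc_mono_le[of "\<lambda>k. \<Phi> k ` carrier M"] by blast
  have pmono: "\<Phi> i ` pos_cone M \<subseteq> \<Phi> j ` pos_cone M" if "i \<le> j" for i j
    using that Pos_mono lift_Suc_mono_le[of "\<lambda>k. \<Phi> k ` pos_cone M"] by blast
  define \<phi> where "\<phi> i j x = inv_into (carrier M) (\<Phi> j) (\<Phi> i x)" for i j x
  have \<phi>: "\<phi> i j x \<in> carrier M" "\<Phi> j (\<phi> i j x) = \<Phi> i x" if "i \<le> j" "x \<in> carrier M" for i j x
  proof -
    have "\<Phi> i x \<in> \<Phi> j ` carrier M" using cmono[OF that(1)] that(2) by blast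
    then show "\<phi> i j x \<in> carrier M" "\<Phi> j (\<phi> i j x) = \<Phi> i x"
      unfolding \<phi>_def by (auto intro: inv_into_into f_inv_into_f)
  qed
  have eqI: "x = y" if "\<Phi> k x = \<Phi> k y" "x \<in> carrier M" "y \<in> carrier M" for k x y
    using inj_onD[OF inj that] .
  \<comment> \<open>The inverse is taken on the whole carrier, but by injectivity its value is the
    positive preimage that \<open>Pos_mono\<close> provides.\<close>
  have \<phi>_Pos: "\<phi> i j x \<in> pos_cone M" if ij: "i \<le> j" and x: "x \<in> pos_cone M" for i j x
  proof -
    obtain y where y: "y \<in> pos_cone M" "\<Phi> i x = \<Phi> j y" using pmono[OF ij] x by blast
    have "x \<in> carrier M" "y \<in> carrier M" using x y(1) Pc by auto
    then have "\<phi> i j x = y" using \<phi>[OF ij] y(2) by (intro eqI[of j]) auto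
    then show ?thesis using y(1) by simp
  qed
  have \<phi>_mult: "\<phi> i j (x \<otimes>\<^bsub>M\<^esub> y) = \<phi> i j x \<otimes>\<^bsub>M\<^esub> \<phi> i j y"
    if "i \<le> j" "x \<in> carrier M" "y \<in> carrier M" for i j x y
    using that \<phi>[OF that(1)] by (intro eqI[of j]) (auto simp: mult)
  have sys: "inductive_system {1::nat..} (\<lambda>_. M) \<phi>"
  proof
    show "{1::nat..} \<noteq> {}" by auto
    show "\<exists>\<gamma>\<in>{1::nat..}. \<alpha> \<le> \<gamma> \<and> \<beta> \<le> \<gamma>" if "\<alpha> \<in> {1..}" "\<beta> \<in> {1..}" for \<alpha> \<beta> :: nat
      using that by (intro bexI[of _ "max \<alpha> \<beta>"]) auto
    show "\<phi> \<alpha> \<beta> \<in> ord_hom M M" if "\<alpha> \<le> \<beta>" for \<alpha> \<beta>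
      using that \<phi> \<phi>_Pos \<phi>_mult by (auto simp: ord_hom_def hom_def)
    show "\<phi> \<alpha> \<alpha> x = x" if "x \<in> carrier M" for \<alpha> x
      using that \<phi> by (intro eqI[of \<alpha>]) auto
    show "\<phi> \<beta> \<gamma> (\<phi> \<alpha> \<beta> x) = \<phi> \<alpha> \<gamma> x" if "\<alpha> \<le> \<beta>" "\<beta> \<le> \<gamma>" "x \<in> carrier M" for \<alpha> \<beta> \<gamma> x
      using that \<phi> by (intro eqI[of \<gamma>]) (auto intro: order_trans)
  qed
  define fib where "fib v = {(i, x). 1 \<le> i \<and> x \<in> carrier M \<and> \<Phi> i x = v}" for v
  have rel: "((i, x), (j, y)) \<in> lim_rel {1::nat..} (\<lambda>_. M) \<phi> \<longleftrightarrow>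
      1 \<le> i \<and> 1 \<le> j \<and> x \<in> carrier M \<and> y \<in> carrier M \<and> \<Phi> i x = \<Phi> j y" for i j x y
  proof
    assume "((i, x), (j, y)) \<in> lim_rel {1::nat..} (\<lambda>_. M) \<phi>"
    then obtain k where k: "1 \<le> i" "1 \<le> j" "x \<in> carrier M" "y \<in> carrier M" "i \<le> k" "j \<le> k" "\<phi> i k x = \<phi> j k y"
      by (auto simp: lim_rel_def)
    then have "\<Phi> i x = \<Phi> j y" using \<phi>(2)[of i k x] \<phi>(2)[of j k y] by simp
    then show "1 \<le> i \<and> 1 \<le> j \<and> x \<in> carrier M \<and> y \<in> carrier M \<and> \<Phi> i x = \<Phi> j y" using k by simp
  next
    assume h: "1 \<le> i \<and> 1 \<le> j \<and> x \<in> carrier M \<and> y \<in> carrier M \<and> \<Phi> i x = \<Phi> j y"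
    then have "\<phi> i (max i j) x = \<phi> j (max i j) y" by (simp add: \<phi>_def)
    then show "((i, x), (j, y)) \<in> lim_rel {1::nat..} (\<lambda>_. M) \<phi>"
      using h by (auto simp: lim_rel_def intro!: bexI[of _ "max i j"])
  qed
  have map: "lim_map {1::nat..} (\<lambda>_. M) \<phi> i x = fib (\<Phi> i x)" if "1 \<le> i" "x \<in> carrier M" for i x
    using that rel by (auto simp: lim_map_def fib_def)
  let ?L = "inductive_limit {1::nat..} (\<lambda>_. M) \<phi>"
  have nonempty: "\<exists>i x. (i, x) \<in> fib v" if "v \<in> carrier H" for v
    using that unfolding carrier[symmetric] by (auto simp: fib_def)
  have carrier_L: "carrier ?L = fib ` carrier H"
  proof -
    have "carrier ?L = (\<lambda>(i, x). lim_map {1::nat..} (\<lambda>_. M) \<phi> i x) ` ({1..} \<times> carrier M)"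
      by (force simp: inductive_limit_def quotient_def lim_map_def)
    also have "\<dots> = (\<lambda>(i, x). fib (\<Phi> i x)) ` ({1..} \<times> carrier M)"
      by (rule image_cong) (use map in auto)
    also have "\<dots> = fib ` carrier H" unfolding carrier[symmetric] by force
    finally show ?thesis .
  qed
  have mult_L: "fib v \<otimes>\<^bsub>?L\<^esub> fib w = fib (v \<otimes>\<^bsub>H\<^esub> w)" if v: "v \<in> carrier H" and w: "w \<in> carrier H" for v w
  proof -
    have *: "lim_map {1::nat..} (\<lambda>_. M) \<phi> k (x \<otimes>\<^bsub>M\<^esub> y) = fib (v \<otimes>\<^bsub>H\<^esub> w)"
      if "(k, x) \<in> fib v" "(k, y) \<in> fib w" for k x y
      using that by (subst map) (auto simp: fib_def mult)
    obtain i x j y where ij: "(i, x) \<in> fib v" "(j, y) \<in> fib w" using nonempty v w by blast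
    \<comment> \<open>All products of representatives give the same class; the common index shows
      that there is one, so the union is that class.\<close>
    let ?k = "max i j"
    have "(?k, \<phi> i ?k x) \<in> fib v" "(?k, \<phi> j ?k y) \<in> fib w" using ij \<phi> by (auto simp: fib_def)
    then have "{lim_map {1::nat..} (\<lambda>_. M) \<phi> k (x \<otimes>\<^bsub>M\<^esub> y) |k x y. (k, x) \<in> fib v \<and> (k, y) \<in> fib w}
        = {fib (v \<otimes>\<^bsub>H\<^esub> w)}"
      using * by fastforce
    then show ?thesis by (simp add: inductive_limit_def)
  qed
  have Pos_L: "pos_cone ?L = fib ` pos_cone H"
  proof -
    have "pos_cone ?L = (\<Union>i\<in>{1..}. lim_map {1::nat..} (\<lambda>_. M) \<phi> i ` pos_cone M)"
      by (simp add: inductive_limit_def)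
    also have "\<dots> = (\<Union>i\<in>{1..}. (\<lambda>x. fib (\<Phi> i x)) ` pos_cone M)"
      by (intro SUP_cong image_cong refl map) (use Pc in auto)
    also have "\<dots> = fib ` pos_cone H" unfolding Pos[symmetric] by force
    finally show ?thesis .
  qed
  have inj_fib: "inj_on fib (carrier H)"
  proof (rule inj_onI)
    fix v w assume "v \<in> carrier H" "fib v = fib w"
    then obtain i x where "(i, x) \<in> fib v" "(i, x) \<in> fib w" using nonempty by blast
    then show "v = w" by (auto simp: fib_def)
  qed
  then have iso: "fib \<in> iso H ?L"
    using carrier_L mult_L by (auto simp: iso_def hom_def bij_betw_def)
  have "inv_into (carrier H) fib ` pos_cone ?L = pos_cone H"
  proof -
    have "pos_cone H \<subseteq> carrier H" unfolding Pos[symmetric] carrier[symmetric] using Pc by blast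
    then show ?thesis unfolding Pos_L using inj_fib by (simp add: inv_into_image_cancel)
  qed
  then have "?L \<cong>\<^sub>o H" unfolding ord_isomorphic_def using H.iso_set_sym[OF iso] by blast
  then show ?thesis using sys by blast
qed

section \<open>The ordered group Z^n and its embeddings into Q^n\<close>

definition qvec_group :: "nat \<Rightarrow> (nat \<Rightarrow> rat) set \<Rightarrow> (nat \<Rightarrow> rat) ordgroup" where
  "qvec_group n P = \<lparr>carrier = qvec n, monoid.mult = (+), one = 0, pos_cone = P\<rparr>"

lemma comm_group_qvec_group: "comm_group (qvec_group n P)"
proof (rule comm_groupI)
  fix x assume "x \<in> carrier (qvec_group n P)"
  then show "\<exists>y\<in>carrier (qvec_group n P). y \<otimes>\<^bsub>qvec_group n P\<^esub> x = \<one>\<^bsub>qvec_group n P\<^esub>"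
    by (intro bexI[of _ "- x"]) (auto simp: qvec_group_def qvec_def)
qed (auto simp: qvec_group_def qvec_def algebra_simps)

lemma comm_group_with_cone:
  assumes "comm_group M" shows "comm_group (with_cone M P)"
proof -
  interpret comm_group M by fact
  show ?thesis
    by (rule comm_groupI) (auto simp: with_cone_def m_ac l_inv_ex)
qed

lemma ordered_group_int_power: "ordered_group (int_power n)"
proof -
  have carr: "carrier (int_power n) = {..<n} \<rightarrow>\<^sub>E UNIV" by (simp add: int_power_def with_cone_def)
  have mult: "x \<otimes>\<^bsub>int_power n\<^esub> y = (\<lambda>i\<in>{..<n}. x i + y i)" for x y
    by (simp add: int_power_def with_cone_def)
  have one: "\<one>\<^bsub>int_power n\<^esub> = (\<lambda>i\<in>{..<n}. 0)" by (simp add: int_power_def with_cone_def)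
  have Pos: "pos_cone (int_power n) = {x \<in> {..<n} \<rightarrow>\<^sub>E UNIV. \<forall>i<n. 0 \<le> x i}"
    by (simp add: int_power_def with_cone_def)
  interpret comm_group "int_power n"
    unfolding int_power_def
    by (intro comm_group_with_cone group.group_comm_groupI) (auto simp: add.commute)
  have "x = \<one>\<^bsub>int_power n\<^esub>"
    if x: "x \<in> pos_cone (int_power n)" "x \<in> m_inv (int_power n) ` pos_cone (int_power n)" for x
  proof -
    obtain y where y: "y \<in> pos_cone (int_power n)" "x = inv\<^bsub>int_power n\<^esub> y" using x(2) by blast
    have yc: "y \<in> carrier (int_power n)" using y(1) by (simp add: Pos carr)
    have "x \<otimes>\<^bsub>int_power n\<^esub> y = \<one>\<^bsub>int_power n\<^esub>" using yc y(2) by simp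
    then have eq: "(\<lambda>i\<in>{..<n}. x i + y i) = (\<lambda>i\<in>{..<n}. 0)" unfolding mult one .
    have s: "x i + y i = 0" if "i < n" for i using fun_cong[OF eq, of i] that by simp
    show ?thesis
    proof (rule PiE_ext)
      show "x \<in> {..<n} \<rightarrow>\<^sub>E UNIV" "\<one>\<^bsub>int_power n\<^esub> \<in> {..<n} \<rightarrow>\<^sub>E UNIV" using x by (auto simp: Pos one)
      fix i assume "i \<in> {..<n}"
      then have "0 \<le> x i" "0 \<le> y i" "x i + y i = 0" using x y(1) s by (auto simp: Pos)
      then show "x i = \<one>\<^bsub>int_power n\<^esub> i" using \<open>i \<in> {..<n}\<close> by (simp add: one)
    qed
  qed
  moreover have one_Pos: "\<one>\<^bsub>int_power n\<^esub> \<in> pos_cone (int_power n)" by (auto simp: Pos one)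
  moreover have "\<one>\<^bsub>int_power n\<^esub> \<in> m_inv (int_power n) ` pos_cone (int_power n)"
    using imageI[OF one_Pos, of "m_inv (int_power n)"] unfolding inv_one .
  ultimately have "pos_cone (int_power n) \<inter> m_inv (int_power n) ` pos_cone (int_power n)
      = {\<one>\<^bsub>int_power n\<^esub>}" by blast
  moreover have "pos_cone (int_power n) <#>\<^bsub>int_power n\<^esub> pos_cone (int_power n) \<subseteq> pos_cone (int_power n)"
    by (auto simp: Pos set_mult_def mult)
  moreover have "pos_cone (int_power n) \<subseteq> carrier (int_power n)" by (auto simp: Pos carr)
  ultimately show ?thesis using one_Pos
    by (intro ordered_group.intro ordered_group_axioms.intro comm_group_axioms)
qed

text \<open>\<open>\<Phi> k\<close> reads integer vectors as coordinates in the basis b k. The image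
  of Z^n consists of the differences of elements of the image of its cone, so increase and
  exhaustion of the groups follow from those of the cones, because P generates Q^n.\<close>

lemma qvec_limit:
  assumes P: "qv.cone P" and R: "qv.riesz P" and lin: "qv.lineality P = {0}" and gen: "qv.gen P = qvec n"
  shows "\<exists>\<phi>. inductive_system {1::nat..} (\<lambda>_. int_power n) \<phi> \<and>
    inductive_limit {1::nat..} (\<lambda>_. int_power n) \<phi> \<cong>\<^sub>o qvec_group n P"
proof -
  obtain b where ind: "\<And>k. qv.indep_mod {0} n (b k)"
    and mono: "\<And>k. nat_span n (b k) \<subseteq> nat_span n (b (Suc k))"
    and bsub: "\<And>k. nat_span n (b k) \<subseteq> P"
    and un: "(\<Union>k\<in>{1..}. nat_span n (b k)) = P"
    using riesz_cone_chain[OF assms] by metis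
  define \<Phi> where "\<Phi> k x = (\<Sum>i<n. qscale (of_int (x i)) (b k i))" for k and x :: "nat \<Rightarrow> int"
  have carr: "carrier (int_power n) = {..<n} \<rightarrow>\<^sub>E UNIV" by (simp add: int_power_def with_cone_def)
  have mult: "x \<otimes>\<^bsub>int_power n\<^esub> y = (\<lambda>i\<in>{..<n}. x i + y i)" for x y
    by (simp add: int_power_def with_cone_def)
  have Pos: "pos_cone (int_power n) = {x \<in> {..<n} \<rightarrow>\<^sub>E UNIV. \<forall>i<n. 0 \<le> x i}"
    by (simp add: int_power_def with_cone_def)
  have bP: "b k i \<in> P" if "i < n" for k i
  proof -
    have "b k i = (\<Sum>j<n. qscale (of_nat (if j = i then 1 else 0)) (b k j))"
      using that by (simp add: if_distrib[of of_nat] if_distrib[of "\<lambda>c. qscale c _"] cong: if_cong)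
    then have "b k i \<in> nat_span n (b k)"
      unfolding nat_span_def by (intro CollectI exI[of _ "\<lambda>j. if j = i then 1 else 0"])
    then show ?thesis using bsub by blast
  qed
  have \<Phi>_diff: "\<Phi> k (\<lambda>i\<in>{..<n}. x i - y i) = \<Phi> k x - \<Phi> k y" for k x y
    by (simp add: \<Phi>_def qv.scale_left_diff_distrib sum_subtractf)
  have \<Phi>_Pos: "\<Phi> k ` pos_cone (int_power n) = nat_span n (b k)" for k
  proof
    show "\<Phi> k ` pos_cone (int_power n) \<subseteq> nat_span n (b k)"
    proof
      fix v assume "v \<in> \<Phi> k ` pos_cone (int_power n)"
      then obtain x where x: "\<forall>i<n. 0 \<le> x i" "v = \<Phi> k x" by (auto simp: Pos)
      then have "v = (\<Sum>i<n. qscale (of_nat (nat (x i))) (b k i))" by (simp add: \<Phi>_def)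
      then show "v \<in> nat_span n (b k)" unfolding nat_span_def by (intro CollectI exI[of _ "\<lambda>i. nat (x i)"])
    qed
    show "nat_span n (b k) \<subseteq> \<Phi> k ` pos_cone (int_power n)"
    proof
      fix v assume "v \<in> nat_span n (b k)"
      then obtain c :: "nat \<Rightarrow> nat" where "v = (\<Sum>i<n. qscale (of_nat (c i)) (b k i))" by (auto simp: nat_span_def)
      then have "v = \<Phi> k (\<lambda>i\<in>{..<n}. int (c i))" by (simp add: \<Phi>_def)
      then show "v \<in> \<Phi> k ` pos_cone (int_power n)" by (auto simp: Pos)
    qed
  qed
  have \<Phi>_carrier: "\<Phi> k ` carrier (int_power n) = {v - w |v w. v \<in> nat_span n (b k) \<and> w \<in> nat_span n (b k)}" for k
  proof
    show "\<Phi> k ` carrier (int_power n) \<subseteq> {v - w |v w. v \<in> nat_span n (b k) \<and> w \<in> nat_span n (b k)}"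
    proof
      fix v assume "v \<in> \<Phi> k ` carrier (int_power n)"
      then obtain x where x: "v = \<Phi> k x" by blast
      let ?p = "\<lambda>i\<in>{..<n}. max (x i) 0" and ?q = "\<lambda>i\<in>{..<n}. max (- x i) 0"
      have "v = \<Phi> k (\<lambda>i\<in>{..<n}. ?p i - ?q i)" unfolding x \<Phi>_def by (intro sum.cong) (auto simp: max_def)
      then have "v = \<Phi> k ?p - \<Phi> k ?q" unfolding \<Phi>_diff .
      moreover have "?p \<in> pos_cone (int_power n)" "?q \<in> pos_cone (int_power n)" by (auto simp: Pos)
      ultimately show "v \<in> {v - w |v w. v \<in> nat_span n (b k) \<and> w \<in> nat_span n (b k)}"
        unfolding \<Phi>_Pos[symmetric] by blast
    qed
    show "{v - w |v w. v \<in> nat_span n (b k) \<and> w \<in> nat_span n (b k)} \<subseteq> \<Phi> k ` carrier (int_power n)"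
    proof
      fix v assume "v \<in> {v - w |v w. v \<in> nat_span n (b k) \<and> w \<in> nat_span n (b k)}"
      then obtain x y where "v = \<Phi> k x - \<Phi> k y" unfolding \<Phi>_Pos[symmetric] by blast
      then have "v = \<Phi> k (\<lambda>i\<in>{..<n}. x i - y i)" by (simp only: \<Phi>_diff)
      then show "v \<in> \<Phi> k ` carrier (int_power n)" by (auto simp: carr)
    qed
  qed
  show ?thesis
  proof (rule inductive_limit_of_embeddings[where \<Phi> = \<Phi>])
    show "ordered_group (int_power n)" by (rule ordered_group_int_power)
    show "group (qvec_group n P)" using comm_group_qvec_group by (rule comm_group.axioms)
    fix k
    have PV: "P \<subseteq> qvec n" using qv.cone_subset_gen[OF P] gen by simp
    show "\<Phi> k \<in> hom (int_power n) (qvec_group n P)"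
    proof (rule homI)
      fix x
      show "\<Phi> k x \<in> carrier (qvec_group n P)"
        unfolding \<Phi>_def qvec_group_def using bP PV
        by (auto intro!: qv.subspace_sum[OF subspace_qvec] qv.subspace_scale[OF subspace_qvec])
    next
      fix x y
      show "\<Phi> k (x \<otimes>\<^bsub>int_power n\<^esub> y) = \<Phi> k x \<otimes>\<^bsub>qvec_group n P\<^esub> \<Phi> k y"
        by (simp add: mult \<Phi>_def qvec_group_def qv.scale_left_distrib sum.distrib)
    qed
    show "inj_on (\<Phi> k) (carrier (int_power n))"
    proof (rule inj_onI)
      fix x y assume xy: "x \<in> carrier (int_power n)" "y \<in> carrier (int_power n)" "\<Phi> k x = \<Phi> k y"
      then have "(\<Sum>i<n. qscale (of_int (x i) - of_int (y i)) (b k i)) \<in> {0}"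
        by (simp add: \<Phi>_def qv.scale_left_diff_distrib sum_subtractf)
      then have "\<forall>i<n. (of_int (x i) - of_int (y i) :: rat) = 0"
        using ind[of k, unfolded qv.indep_mod_def, rule_format,
          of "\<lambda>i. of_int (x i) - of_int (y i)"] by blast
      then have "x i = y i" if "i < n" for i using that by simp
      then show "x = y" using xy(1,2) unfolding carr by (intro PiE_ext) auto
    qed
    show "\<Phi> k ` carrier (int_power n) \<subseteq> \<Phi> (Suc k) ` carrier (int_power n)"
      "\<Phi> k ` pos_cone (int_power n) \<subseteq> \<Phi> (Suc k) ` pos_cone (int_power n)"
      using mono[of k] unfolding \<Phi>_carrier \<Phi>_Pos by blast+
  next
    show "(\<Union>k\<in>{1..}. \<Phi> k ` pos_cone (int_power n)) = pos_cone (qvec_group n P)"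
      unfolding \<Phi>_Pos using un by (simp add: qvec_group_def)
    show "(\<Union>k\<in>{1..}. \<Phi> k ` carrier (int_power n)) = carrier (qvec_group n P)"
    proof
      show "(\<Union>k\<in>{1..}. \<Phi> k ` carrier (int_power n)) \<subseteq> carrier (qvec_group n P)"
        unfolding \<Phi>_carrier qvec_group_def using bsub by (fastforce simp: gen[symmetric] qv.gen_def)
      show "carrier (qvec_group n P) \<subseteq> (\<Union>k\<in>{1..}. \<Phi> k ` carrier (int_power n))"
      proof
        fix v assume "v \<in> carrier (qvec_group n P)"
        then obtain x y where xy: "v = x - y" "x \<in> P" "y \<in> P"
          by (auto simp: qvec_group_def gen[symmetric] qv.gen_def)
        obtain i j where ij: "1 \<le> i" "x \<in> nat_span n (b i)" "1 \<le> j" "y \<in> nat_span n (b j)"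
          using xy(2,3) unfolding un[symmetric] by auto
        have "nat_span n (b l) \<subseteq> nat_span n (b (max i j))" if "l \<le> max i j" for l
          using lift_Suc_mono_le[of "\<lambda>k. nat_span n (b k)", OF mono that] .
        then have "x \<in> nat_span n (b (max i j))" "y \<in> nat_span n (b (max i j))"
          using ij(2,4) max.cobounded1[of i j] max.cobounded2[of j i] by blast+
        then show "v \<in> (\<Union>k\<in>{1..}. \<Phi> k ` carrier (int_power n))"
          unfolding \<Phi>_carrier using xy(1) ij by (intro UN_I[of "max i j"]) auto
      qed
    qed
  qed
qed

section \<open>Embedded ordered groups\<close>

text \<open>The map \<open>\<theta>\<close> gives the coordinates with respect to a basis of \<open>G\<close> (or of an overlattice of full rank).\<close>
locale embedded_group = ordered_group G for G :: "('a, 'm) ordgroup_scheme" (structure) +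
  fixes n :: nat and \<theta> :: "'a \<Rightarrow> nat \<Rightarrow> rat"
  assumes directed: "directed_group G" and interpolation: "riesz_interpolation G"
    and \<theta>_mult: "x \<in> carrier G \<Longrightarrow> y \<in> carrier G \<Longrightarrow> \<theta> (x \<otimes> y) = \<theta> x + \<theta> y"
    and \<theta>_inj: "inj_on \<theta> (carrier G)"
    and \<theta>_qvec: "x \<in> carrier G \<Longrightarrow> \<theta> x \<in> qvec n"
    and \<theta>_dense: "v \<in> qvec n \<Longrightarrow> \<exists>N>0. \<exists>x\<in>carrier G. qscale (of_nat N) v = \<theta> x"
begin

text \<open>The rational cone generated by the image of Pos: a nonnegative combination of positive
  elements enters the image once its denominators are cleared.\<close>

definition rat_cone :: "(nat \<Rightarrow> rat) set" where
  "rat_cone = {v. \<exists>N>0. \<exists>x\<in>Pos. qscale (of_nat N) v = \<theta> x}"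

lemma Pos_carrier: "x \<in> Pos \<Longrightarrow> x \<in> carrier G"
  using Pos_subset by blast

lemma Pos_mult: "x \<in> Pos \<Longrightarrow> y \<in> Pos \<Longrightarrow> x \<otimes> y \<in> Pos"
  using Pos_closed by (auto simp: set_mult_def)

lemma Pos_pow: "x \<in> Pos \<Longrightarrow> x [^] (m::nat) \<in> Pos"
  by (induction m) (auto simp: one_Pos Pos_mult)

lemma \<theta>_one: "\<theta> \<one> = 0"
  using \<theta>_mult[of \<one> \<one>] by simp

lemma \<theta>_inv: "x \<in> carrier G \<Longrightarrow> \<theta> (inv x) = - \<theta> x"
  using \<theta>_mult[of "inv x" x] by (simp add: \<theta>_one eq_neg_iff_add_eq_0)

lemma \<theta>_pow: "x \<in> carrier G \<Longrightarrow> \<theta> (x [^] (m::nat)) = qscale (of_nat m) (\<theta> x)"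
  by (induction m) (auto simp: \<theta>_one \<theta>_mult qv.scale_left_distrib add.commute)

lemma \<theta>_eqI: "x \<in> carrier G \<Longrightarrow> y \<in> carrier G \<Longrightarrow> \<theta> x = \<theta> y \<Longrightarrow> x = y"
  using inj_onD[OF \<theta>_inj] by blast

lemma rat_coneI: "0 < N \<Longrightarrow> x \<in> Pos \<Longrightarrow> qscale (of_nat N) v = \<theta> x \<Longrightarrow> v \<in> rat_cone"
  by (auto simp: rat_cone_def)

text \<open>Transfers a statement about finitely many vectors of the cone to G by a single
  scaling.\<close>

lemma rat_cone_common:
  assumes "finite A" "A \<subseteq> rat_cone"
  shows "\<exists>N>0. \<forall>v\<in>A. \<exists>x\<in>Pos. qscale (of_nat N) v = \<theta> x"
  using assms
proof (induction A)
  case empty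
  show ?case by (intro exI[of _ 1]) simp
next
  case (insert v A)
  then obtain N :: nat where N: "0 < N" "\<forall>v\<in>A. \<exists>x\<in>Pos. qscale (of_nat N) v = \<theta> x" by auto
  obtain M :: nat and x where M: "0 < M" "x \<in> Pos" "qscale (of_nat M) v = \<theta> x"
    using insert.prems by (auto simp: rat_cone_def)
  have *: "\<exists>y\<in>Pos. qscale (of_nat (k * l)) w = \<theta> y"
    if x: "x \<in> Pos" and w: "qscale (of_nat l) w = \<theta> x" for k l :: nat and w x
  proof -
    have "qscale (of_nat (k * l)) w = qscale (of_nat k) (qscale (of_nat l) w)" by simp
    also have "\<dots> = \<theta> (x [^] k)" using Pos_carrier[OF x] by (simp add: w \<theta>_pow)
    finally show ?thesis using Pos_pow[OF x] by blast
  qed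
  have "\<exists>y\<in>Pos. qscale (of_nat (M * N)) w = \<theta> y" if w: "w \<in> insert v A" for w
  proof (cases "w = v")
    case True
    then show ?thesis using *[OF M(2,3), of N] by (simp add: mult.commute)
  next
    case False
    then obtain z where "z \<in> Pos" "qscale (of_nat N) w = \<theta> z" using N(2) w by auto
    then show ?thesis by (rule *)
  qed
  then show ?case using N(1) M(1) by (intro exI[of _ "M * N"]) simp
qed

lemma cone_rat_cone: "qv.cone rat_cone"
  unfolding qv.cone_def
proof (intro conjI ballI allI impI)
  show "0 \<in> rat_cone" by (rule rat_coneI[of 1 \<one>]) (simp_all add: one_Pos \<theta>_one)
next
  fix v w assume "v \<in> rat_cone" "w \<in> rat_cone"
  then obtain N x y where N: "0 < N" "x \<in> Pos" "qscale (of_nat N) v = \<theta> x" "y \<in> Pos" "qscale (of_nat N) w = \<theta> y"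
    using rat_cone_common[of "{v, w}"] by auto
  then show "v + w \<in> rat_cone"
    by (intro rat_coneI[of N "x \<otimes> y"]) (simp_all add: Pos_mult Pos_carrier \<theta>_mult qv.scale_right_distrib)
next
  fix r :: rat and v assume r: "0 \<le> r" and "v \<in> rat_cone"
  then obtain N x where N: "0 < N" "x \<in> Pos" "qscale (of_nat N) v = \<theta> x" by (auto simp: rat_cone_def)
  obtain M m where M: "0 < M" "of_nat M * r = of_int m"
    using common_denominator[of "{r}"] by (metis finite.emptyI finite.insertI singletonI)
  have "0 \<le> of_nat M * r" using r by simp
  then have "0 \<le> (of_int m :: rat)" unfolding M(2) .
  then have m: "of_nat M * r = of_nat (nat m)" using M(2) by simp
  have "qscale (of_nat (N * M)) (qscale r v) = qscale (of_nat (nat m)) (qscale (of_nat N) v)"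
    by (simp add: mult.commute mult.left_commute flip: m)
  then show "qscale r v \<in> rat_cone"
    using N M(1) by (intro rat_coneI[of "N * M" "x [^] nat m"]) (simp_all add: Pos_pow Pos_carrier \<theta>_pow)
qed

lemma Pos_inv_eq_one: "x \<in> Pos \<Longrightarrow> inv x \<in> Pos \<Longrightarrow> x = \<one>"
  using Pos_antisym Pos_carrier[of x] by (metis IntI imageI inv_inv singletonD)

lemma lineality_rat_cone: "qv.lineality rat_cone = {0}"
proof -
  have "v = 0" if v: "v \<in> rat_cone" "- v \<in> rat_cone" for v
  proof -
    obtain N x y where N: "0 < N" "x \<in> Pos" "qscale (of_nat N) v = \<theta> x" "y \<in> Pos" "qscale (of_nat N) (- v) = \<theta> y"
      using rat_cone_common[of "{v, - v}"] v by auto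
    then have "\<theta> y = \<theta> (inv x)" using Pos_carrier by (simp add: \<theta>_inv)
    then have "y = inv x" using N Pos_carrier by (intro \<theta>_eqI) auto
    then have "x = \<one>" using Pos_inv_eq_one N by simp
    then show ?thesis using N(1,3) by (simp add: \<theta>_one)
  qed
  then show ?thesis using qv.cone_zero[OF cone_rat_cone] by (auto simp: qv.lineality_def)
qed

lemma gen_rat_cone: "qv.gen rat_cone = qvec n"
proof
  show "qv.gen rat_cone \<subseteq> qvec n"
  proof -
    have "v \<in> qvec n" if v: "v \<in> rat_cone" for v
    proof -
      obtain N x where N: "0 < N" "x \<in> Pos" "qscale (of_nat N) v = \<theta> x"
        using v by (auto simp: rat_cone_def)
      then have "qscale (inverse (of_nat N)) (\<theta> x) = v" by (simp flip: N(3))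
      then show ?thesis
        using qv.subspace_scale[OF subspace_qvec \<theta>_qvec[OF Pos_carrier[OF N(2)]]] by metis
    qed
    then show ?thesis using qv.subspace_diff[OF subspace_qvec] by (auto simp: qv.gen_def)
  qed
  show "qvec n \<subseteq> qv.gen rat_cone"
  proof
    fix v assume "v \<in> qvec n"
    then obtain N x where N: "0 < N" "x \<in> carrier G" "qscale (of_nat N) v = \<theta> x" using \<theta>_dense by blast
    \<comment> \<open>By directedness some z lies above both x and the unit, so x is the quotient of
      the positive elements z and z \<otimes> inv x.\<close>
    obtain z where z: "z \<in> carrier G" "z \<otimes> inv x \<in> Pos" "z \<otimes> inv \<one> \<in> Pos"
      using directed N(2) one_closed unfolding directed_group_def ord_le_def by blast
    let ?p = "qscale (inverse (of_nat N)) (\<theta> z)" and ?q = "qscale (inverse (of_nat N)) (\<theta> (z \<otimes> inv x))"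
    have "?p \<in> rat_cone" using z N by (intro rat_coneI[of N z]) auto
    moreover have "?q \<in> rat_cone" using z N by (intro rat_coneI[of N "z \<otimes> inv x"]) auto
    moreover have "?p - ?q = qscale (inverse (of_nat N)) (\<theta> x)"
      using z N(2) by (simp add: \<theta>_mult \<theta>_inv flip: qv.scale_right_diff_distrib)
    then have "v = ?p - ?q" using N(1) by (simp flip: N(3))
    ultimately show "v \<in> qv.gen rat_cone" unfolding qv.gen_def by blast
  qed
qed

text \<open>Interpolation yields decomposition. In additive notation, after scaling into G, c \<le>
  a + b reads z - y \<le> x. An element t between {0, z - y} and {x, z} splits z into t \<le> x and
  z - t \<le> y.\<close>

lemma riesz_rat_cone: "qv.riesz rat_cone"
  unfolding qv.riesz_def
proof (intro ballI impI)
  fix a b c assume "a \<in> rat_cone" "b \<in> rat_cone" "c \<in> rat_cone" "a + b - c \<in> rat_cone"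
  then obtain N where N: "0 < N" "\<forall>v\<in>{a, b, c, a + b - c}. \<exists>x\<in>Pos. qscale (of_nat N) v = \<theta> x"
    using rat_cone_common[of "{a, b, c, a + b - c}"] by auto
  then obtain x y z w where x: "x \<in> Pos" "qscale (of_nat N) a = \<theta> x"
    and y: "y \<in> Pos" "qscale (of_nat N) b = \<theta> y" and z: "z \<in> Pos" "qscale (of_nat N) c = \<theta> z"
    and w: "w \<in> Pos" "qscale (of_nat N) (a + b - c) = \<theta> w"
    by auto
  have carr: "x \<in> carrier G" "y \<in> carrier G" "z \<in> carrier G" "w \<in> carrier G"
    using x y z w Pos_carrier by auto
  have \<theta>w: "\<theta> w = \<theta> x + \<theta> y - \<theta> z"
    by (simp add: qv.scale_right_distrib qv.scale_right_diff_distrib flip: x(2) y(2) z(2) w(2))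
  note simps = \<theta>_mult \<theta>_inv \<theta>_one carr \<theta>w
  have "x \<otimes> inv \<one> = x" "z \<otimes> inv \<one> = z" "x \<otimes> inv (z \<otimes> inv y) = w" "z \<otimes> inv (z \<otimes> inv y) = y"
    by (rule \<theta>_eqI; simp add: simps)+
  then have "\<forall>a\<in>{\<one>, z \<otimes> inv y}. \<forall>c\<in>{x, z}. a \<sqsubseteq>\<^bsub>G\<^esub> c"
    using x y z w by (simp add: ord_le_def)
  then obtain t where t: "t \<in> carrier G" "\<one> \<sqsubseteq>\<^bsub>G\<^esub> t" "z \<otimes> inv y \<sqsubseteq>\<^bsub>G\<^esub> t" "t \<sqsubseteq>\<^bsub>G\<^esub> x" "t \<sqsubseteq>\<^bsub>G\<^esub> z"
    using interpolation[unfolded riesz_interpolation_def, rule_format, of \<one> "z \<otimes> inv y" x z] carr by auto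
  let ?t = "qscale (inverse (of_nat N)) (\<theta> t)"
  have Nt: "qscale (of_nat N) ?t = \<theta> t" using N(1) by simp
  have "?t \<in> rat_cone" "a - ?t \<in> rat_cone" "c - ?t \<in> rat_cone" "b - (c - ?t) \<in> rat_cone"
  proof -
    have "t \<otimes> inv \<one> = t" using t(1) by simp
    then have "t \<in> Pos" using t(2) by (simp add: ord_le_def)
    then show "?t \<in> rat_cone" using Nt N(1) by (intro rat_coneI)
    show "a - ?t \<in> rat_cone"
      using t N(1) by (intro rat_coneI[of N "x \<otimes> inv t"])
        (simp_all add: ord_le_def qv.scale_right_diff_distrib Nt x(2) simps)
    show "c - ?t \<in> rat_cone"
      using t N(1) by (intro rat_coneI[of N "z \<otimes> inv t"])
        (simp_all add: ord_le_def qv.scale_right_diff_distrib Nt z(2) simps)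
    show "b - (c - ?t) \<in> rat_cone"
      using t N(1) by (intro rat_coneI[of N "t \<otimes> inv (z \<otimes> inv y)"])
        (simp_all add: ord_le_def qv.scale_right_diff_distrib Nt y(2) z(2) simps)
  qed
  then show "\<exists>x\<in>rat_cone. a - x \<in> rat_cone \<and> c - x \<in> rat_cone \<and> b - (c - x) \<in> rat_cone" by blast
qed

end

section \<open>Tensoring with the rationals\<close>

context embedded_group begin

text \<open>Equality in the tensor product, expressed on formal sums, so that chains of equations
  need no coset arithmetic.\<close>

definition tensor_rel :: "('a \<times> rat \<Rightarrow>\<^sub>0 int) \<Rightarrow> ('a \<times> rat \<Rightarrow>\<^sub>0 int) \<Rightarrow> bool" (infix \<open>\<sim>\<^sub>T\<close> 50) where
  "a \<sim>\<^sub>T b \<longleftrightarrow> a - b \<in> tensor_kernel G rat_ordgroup"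

abbreviation tensor_base :: "('a \<times> rat \<Rightarrow>\<^sub>0 int) monoid" where
  "tensor_base \<equiv> free_Abelian_group (carrier G \<times> UNIV)"

lemma carrier_rat: "carrier rat_ordgroup = UNIV"
  by (simp add: rat_ordgroup_def)

lemma tensor_relators_carrier: "tensor_relators G rat_ordgroup \<subseteq> carrier tensor_base"
proof -
  have "frag_of (x, q) - (frag_of (y, r) + frag_of (z, s)) \<in> carrier tensor_base"
    if "x \<in> carrier G" "y \<in> carrier G" "z \<in> carrier G" for x y z and q r s :: rat
  proof -
    have "frag_of (x, q) \<in> carrier tensor_base" "frag_of (y, r) + frag_of (z, s) \<in> carrier tensor_base"
      using that keys_add[of "frag_of (y, r)" "frag_of (z, s)"] by (auto simp: keys_frag_of)
    then show ?thesis using keys_diff by fastforce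
  qed
  then show ?thesis by (auto simp: tensor_relators_def rat_ordgroup_def)
qed

lemma subgroup_tensor_kernel: "subgroup (tensor_kernel G rat_ordgroup) tensor_base"
  unfolding tensor_kernel_def carrier_rat
  by (rule group.generate_is_subgroup[OF group_free_Abelian_group tensor_relators_carrier])

lemma tensor_kernel_zero: "0 \<in> tensor_kernel G rat_ordgroup"
  using subgroup.one_closed[OF subgroup_tensor_kernel] by simp

lemma tensor_kernel_add:
  "a \<in> tensor_kernel G rat_ordgroup \<Longrightarrow> b \<in> tensor_kernel G rat_ordgroup \<Longrightarrow> a + b \<in> tensor_kernel G rat_ordgroup"
  using subgroup.m_closed[OF subgroup_tensor_kernel] by simp

lemma tensor_kernel_neg:
  assumes "a \<in> tensor_kernel G rat_ordgroup" shows "- a \<in> tensor_kernel G rat_ordgroup"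
proof -
  have "Poly_Mapping.keys a \<subseteq> carrier G \<times> UNIV"
    using subgroup.mem_carrier[OF subgroup_tensor_kernel assms] by simp
  then show ?thesis using subgroup.m_inv_closed[OF subgroup_tensor_kernel assms] by simp
qed

lemma tensor_rel_refl: "a \<sim>\<^sub>T a"
  by (simp add: tensor_rel_def tensor_kernel_zero)

lemma tensor_rel_sym: "a \<sim>\<^sub>T b \<Longrightarrow> b \<sim>\<^sub>T a"
  using tensor_kernel_neg[of "a - b"] by (simp add: tensor_rel_def)

lemma tensor_rel_trans [trans]: "a \<sim>\<^sub>T b \<Longrightarrow> b \<sim>\<^sub>T c \<Longrightarrow> a \<sim>\<^sub>T c"
  using tensor_kernel_add[of "a - b" "b - c"] by (simp add: tensor_rel_def)

lemma tensor_rel_add: "a \<sim>\<^sub>T b \<Longrightarrow> c \<sim>\<^sub>T d \<Longrightarrow> a + c \<sim>\<^sub>T b + d"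
  using tensor_kernel_add[of "a - b" "c - d"] by (simp add: tensor_rel_def algebra_simps)

lemma tensor_rel_uminus: "a \<sim>\<^sub>T b \<Longrightarrow> - a \<sim>\<^sub>T - b"
  using tensor_kernel_neg[of "a - b"] by (simp add: tensor_rel_def)

lemma tensor_rel_diff: "a \<sim>\<^sub>T b \<Longrightarrow> c \<sim>\<^sub>T d \<Longrightarrow> a - c \<sim>\<^sub>T b - d"
  using tensor_rel_add[of a b "- c" "- d"] tensor_rel_uminus[of c d] by simp

lemma tensor_rel_cancel: "a + b \<sim>\<^sub>T a \<longleftrightarrow> b \<sim>\<^sub>T 0" "a \<sim>\<^sub>T a + b \<longleftrightarrow> - b \<sim>\<^sub>T 0" "a + b \<sim>\<^sub>T 0 \<longleftrightarrow> a \<sim>\<^sub>T - b"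
  by (simp_all add: tensor_rel_def)

lemma tensor_add_left:
  "x \<in> carrier G \<Longrightarrow> y \<in> carrier G \<Longrightarrow> frag_of (x \<otimes> y, q) \<sim>\<^sub>T frag_of (x, q) + frag_of (y, q)"
  unfolding tensor_kernel_def tensor_rel_def
  by (rule generate.incl) (auto simp: tensor_relators_def rat_ordgroup_def)

lemma tensor_add_right:
  assumes "x \<in> carrier G" shows "frag_of (x, q + r) \<sim>\<^sub>T frag_of (x, q) + frag_of (x, r)"
  unfolding tensor_kernel_def tensor_rel_def
proof (rule generate.incl)
  show "frag_of (x, q + r) - (frag_of (x, q) + frag_of (x, r)) \<in> tensor_relators G rat_ordgroup"
    unfolding tensor_relators_def rat_ordgroup_def using assms by auto
qed

lemma tensor_zero_left: "frag_of (\<one>, q) \<sim>\<^sub>T 0"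
  using tensor_rel_uminus[of "- frag_of (\<one>, q)" 0] tensor_add_left[of \<one> \<one> q]
  by (simp add: tensor_rel_cancel)

lemma tensor_zero_right: "x \<in> carrier G \<Longrightarrow> frag_of (x, 0) \<sim>\<^sub>T 0"
  using tensor_rel_uminus[of "- frag_of (x, 0)" 0] tensor_add_right[of x 0 0]
  by (simp add: tensor_rel_cancel)

lemma tensor_inv_left:
  assumes x: "x \<in> carrier G" shows "frag_of (inv x, q) \<sim>\<^sub>T - frag_of (x, q)"
proof -
  have "0 \<sim>\<^sub>T frag_of (inv x \<otimes> x, q)" using tensor_rel_sym[OF tensor_zero_left] x by simp
  also have "frag_of (inv x \<otimes> x, q) \<sim>\<^sub>T frag_of (inv x, q) + frag_of (x, q)"
    using x by (intro tensor_add_left) auto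
  finally show ?thesis using tensor_rel_sym by (simp flip: tensor_rel_cancel(3))
qed

lemma tensor_neg_right:
  assumes x: "x \<in> carrier G" shows "frag_of (x, - q) \<sim>\<^sub>T - frag_of (x, q)"
proof -
  have "0 \<sim>\<^sub>T frag_of (x, - q + q)" using tensor_rel_sym[OF tensor_zero_right[OF x]] by simp
  also have "frag_of (x, - q + q) \<sim>\<^sub>T frag_of (x, - q) + frag_of (x, q)"
    using x by (rule tensor_add_right)
  finally show ?thesis using tensor_rel_sym by (simp flip: tensor_rel_cancel(3))
qed

lemma tensor_pow_left:
  assumes x: "x \<in> carrier G"
  shows "frag_of (x [^] (m::nat), q) \<sim>\<^sub>T frag_of (x, of_nat m * q)"
proof (induction m)
  case 0
  show ?case using tensor_rel_trans[OF tensor_zero_left tensor_rel_sym[OF tensor_zero_right[OF x]]] by simp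
next
  case (Suc m)
  have "frag_of (x [^] Suc m, q) \<sim>\<^sub>T frag_of (x [^] m, q) + frag_of (x, q)"
    using tensor_add_left[of "x [^] m" x q] x by simp
  also have "frag_of (x [^] m, q) + frag_of (x, q) \<sim>\<^sub>T frag_of (x, of_nat m * q) + frag_of (x, q)"
    by (rule tensor_rel_add[OF Suc tensor_rel_refl])
  also have "frag_of (x, of_nat m * q) + frag_of (x, q) \<sim>\<^sub>T frag_of (x, of_nat m * q + q)"
    by (rule tensor_rel_sym[OF tensor_add_right[OF x]])
  finally show ?case by (simp add: algebra_simps)
qed

text \<open>This works because finitely many fractions have a common denominator.\<close>
lemma tensor_rel_pure:
  assumes "Poly_Mapping.keys z \<subseteq> carrier G \<times> UNIV"
  shows "\<exists>N>0. \<exists>x\<in>carrier G. z \<sim>\<^sub>T frag_of (x, 1 / of_nat N)"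
  using assms
proof (induction z rule: frag_induction)
  case zero
  show ?case
    using tensor_rel_sym[OF tensor_zero_left[of 1]] by (intro exI[of _ 1] conjI bexI[of _ \<one>]) simp_all
next
  case (one p)
  obtain x q where p: "p = (x, q)" "x \<in> carrier G" using one by auto
  \<comment> \<open>Powers are taken with natural exponents, so |q| is treated first and the sign is
    moved to the inverse in G.\<close>
  obtain N m where N: "0 < N" "of_nat N * \<bar>q\<bar> = of_int m"
    using common_denominator[of "{\<bar>q\<bar>}"] by (metis finite.emptyI finite.insertI singletonI)
  have "0 \<le> of_nat N * \<bar>q\<bar>" by simp
  then have "0 \<le> m" unfolding N(2) by simp
  then have q: "of_nat (nat m) * (1 / of_nat N) = \<bar>q\<bar>" using N by (simp add: field_simps)
  have abs: "frag_of (x, \<bar>q\<bar>) \<sim>\<^sub>T frag_of (x [^] nat m, 1 / of_nat N)"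
    using tensor_rel_sym[OF tensor_pow_left[OF p(2), of "nat m" "1 / of_nat N"]] unfolding q .
  show ?case
  proof (cases "0 \<le> q")
    case True
    then show ?thesis using abs p N(1) by (intro exI[of _ N] conjI bexI[of _ "x [^] nat m"]) simp_all
  next
    case False
    then have "frag_of (x, q) \<sim>\<^sub>T - frag_of (x, \<bar>q\<bar>)" using tensor_neg_right[OF p(2), of "\<bar>q\<bar>"] by simp
    also have "- frag_of (x, \<bar>q\<bar>) \<sim>\<^sub>T - frag_of (x [^] nat m, 1 / of_nat N)"
      by (rule tensor_rel_uminus[OF abs])
    also have "- frag_of (x [^] nat m, 1 / of_nat N) \<sim>\<^sub>T frag_of (inv (x [^] nat m), 1 / of_nat N)"
      using p(2) by (intro tensor_rel_sym[OF tensor_inv_left]) simp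
    finally show ?thesis
      using p N(1) by (intro exI[of _ N] conjI bexI[of _ "inv (x [^] nat m)"]) simp_all
  qed
next
  case (diff a b)
  then obtain N M x y where N: "0 < N" "x \<in> carrier G" "a \<sim>\<^sub>T frag_of (x, 1 / of_nat N)"
    and M: "0 < M" "y \<in> carrier G" "b \<sim>\<^sub>T frag_of (y, 1 / of_nat M)"
    by blast
  let ?q = "1 / of_nat (N * M) :: rat"
  have q: "of_nat M * ?q = 1 / of_nat N" "of_nat N * ?q = 1 / of_nat M"
    using N(1) M(1) by (auto simp: field_simps)
  have "a \<sim>\<^sub>T frag_of (x [^] M, ?q)"
    using tensor_rel_trans[OF N(3) tensor_rel_sym] tensor_pow_left[OF N(2), of M ?q] unfolding q by blast
  moreover have "b \<sim>\<^sub>T frag_of (y [^] N, ?q)"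
    using tensor_rel_trans[OF M(3) tensor_rel_sym] tensor_pow_left[OF M(2), of N ?q] unfolding q by blast
  ultimately have "a - b \<sim>\<^sub>T frag_of (x [^] M, ?q) - frag_of (y [^] N, ?q)" by (rule tensor_rel_diff)
  also have "frag_of (x [^] M, ?q) - frag_of (y [^] N, ?q)
      \<sim>\<^sub>T frag_of (x [^] M, ?q) + frag_of (inv (y [^] N), ?q)"
    using tensor_rel_add[OF tensor_rel_refl[of "frag_of (x [^] M, ?q)"]
        tensor_rel_sym[OF tensor_inv_left[of "y [^] N" ?q]]] M(2) by simp
  also have "frag_of (x [^] M, ?q) + frag_of (inv (y [^] N), ?q)
      \<sim>\<^sub>T frag_of (x [^] M \<otimes> inv (y [^] N), ?q)"
    using N(2) M(2) by (intro tensor_rel_sym[OF tensor_add_left]) auto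
  finally show ?case
    using N M by (intro exI[of _ "N * M"] conjI bexI[of _ "x [^] M \<otimes> inv (y [^] N)"]) simp_all
qed

text \<open>The pairing of x and q to q times \<open>\<theta> x\<close> induces
  \<open>\<Theta>\<close> on formal sums. Modulo the tensor relations every sum is a single pair (x,
  1/N), so injectivity of \<open>\<theta>\<close> shows that the kernel consists of these relations
  only; \<open>\<theta>_dense\<close> gives surjectivity. The cones agree because a vector of
  \<open>rat_cone\<close> is already the image of one pure tensor of x in Pos and 1/N.\<close>

lemma qvec_group_isomorphic_tensor: "qvec_group n rat_cone \<cong>\<^sub>o tensor_product G rat_ordgroup"
proof -
  let ?V = "qvec_group n rat_cone" and ?T = "tensor_group G rat_ordgroup"
  let ?K = "tensor_kernel G rat_ordgroup"
  interpret V: comm_group ?V by (rule comm_group_qvec_group)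
  interpret B: comm_group tensor_base by (rule abelian_free_Abelian_group)
  have V: "carrier ?V = qvec n" "\<one>\<^bsub>?V\<^esub> = 0" "\<And>v w. v \<otimes>\<^bsub>?V\<^esub> w = v + w"
    by (simp_all add: qvec_group_def)
  have "(\<lambda>(x, q). qscale q (\<theta> x)) ` (carrier G \<times> UNIV) \<subseteq> carrier ?V"
    unfolding V using \<theta>_qvec qv.subspace_scale[OF subspace_qvec] by auto
  then obtain \<Theta> where \<Theta>: "\<Theta> \<in> hom tensor_base ?V"
    and \<Theta>_frag': "\<And>p. p \<in> carrier G \<times> UNIV \<Longrightarrow> \<Theta> (frag_of p) = (\<lambda>(x, q). qscale q (\<theta> x)) p"
    by (metis V.free_Abelian_group_universal)
  have \<Theta>_frag: "\<Theta> (frag_of (x, q)) = qscale q (\<theta> x)" if "x \<in> carrier G" for x q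
    using \<Theta>_frag'[of "(x, q)"] that by simp
  interpret \<Theta>: group_hom tensor_base ?V \<Theta>
    by unfold_locales (rule \<Theta>)
  have \<Theta>_add: "\<Theta> (a + b) = \<Theta> a + \<Theta> b" if "a \<in> carrier tensor_base" "b \<in> carrier tensor_base" for a b
    using \<Theta>.hom_mult[OF that] by (simp add: V)
  have \<Theta>_diff: "\<Theta> (a - b) = \<Theta> a - \<Theta> b" if ab: "a \<in> carrier tensor_base" "b \<in> carrier tensor_base" for a b
  proof -
    have "a - b \<in> carrier tensor_base" using ab keys_diff[of a b] by auto
    then have "\<Theta> ((a - b) + b) = \<Theta> (a - b) + \<Theta> b" using ab(2) by (rule \<Theta>_add)
    then show ?thesis by simp
  qed
  have \<Theta>_zero: "\<Theta> 0 = 0" using \<Theta>.hom_one by (simp add: V)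
  have frag: "frag_of (x, q) \<in> carrier tensor_base" if "x \<in> carrier G" for x and q :: rat
    using that by simp
  have rel_kernel: "tensor_relators G rat_ordgroup \<subseteq> kernel tensor_base ?V \<Theta>"
  proof -
    have "frag_of (x, q) - (frag_of (y, r) + frag_of (z, s)) \<in> kernel tensor_base ?V \<Theta>"
      if c: "x \<in> carrier G" "y \<in> carrier G" "z \<in> carrier G"
        and rel: "frag_of (x, q) - (frag_of (y, r) + frag_of (z, s)) \<in> tensor_relators G rat_ordgroup"
        and eq: "qscale q (\<theta> x) = qscale r (\<theta> y) + qscale s (\<theta> z)" for x y z and q r s :: rat
    proof -
      have "frag_of (y, r) + frag_of (z, s) \<in> carrier tensor_base"
        using B.m_closed[OF frag[OF c(2)] frag[OF c(3)]] by simp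
      then have "\<Theta> (frag_of (x, q) - (frag_of (y, r) + frag_of (z, s))) = 0"
        using c eq by (simp only: \<Theta>_diff[OF frag] \<Theta>_add[OF frag frag] \<Theta>_frag) simp
      then show ?thesis
        unfolding kernel_def V mem_Collect_eq by (intro conjI subsetD[OF tensor_relators_carrier rel])
    qed
    moreover have "\<exists>x y z q r s. p = frag_of (x, q) - (frag_of (y, r) + frag_of (z, s)) \<and>
        x \<in> carrier G \<and> y \<in> carrier G \<and> z \<in> carrier G \<and> qscale q (\<theta> x) = qscale r (\<theta> y) + qscale s (\<theta> z)"
      if "p \<in> tensor_relators G rat_ordgroup" for p
      using that unfolding tensor_relators_def
    proof (elim UnE CollectE exE conjE)
      fix x x' q assume "p = frag_of (x \<otimes> x', q) - (frag_of (x, q) + frag_of (x', q))" "x \<in> carrier G" "x' \<in> carrier G"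
      then show ?thesis
        by (intro exI[of _ "x \<otimes> x'"] exI[of _ x] exI[of _ x'] exI[of _ q]) (simp add: \<theta>_mult qv.scale_right_distrib)
    next
      fix x q r assume "p = frag_of (x, q \<otimes>\<^bsub>rat_ordgroup\<^esub> r) - (frag_of (x, q) + frag_of (x, r))"
        "x \<in> carrier G"
      then show ?thesis
        by (intro exI[of _ x] exI[of _ "q + r"] exI[of _ q] exI[of _ r]) (simp add: rat_ordgroup_def qv.scale_left_distrib)
    qed
    ultimately show ?thesis by blast
  qed
  have K_kernel: "?K = kernel tensor_base ?V \<Theta>"
  proof
    show sub: "?K \<subseteq> kernel tensor_base ?V \<Theta>"
      unfolding tensor_kernel_def carrier_rat
      by (rule B.generate_subgroup_incl[OF rel_kernel \<Theta>.subgroup_kernel])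
    show "kernel tensor_base ?V \<Theta> \<subseteq> ?K"
    proof
      fix z assume "z \<in> kernel tensor_base ?V \<Theta>"
      then have z: "z \<in> carrier tensor_base" "\<Theta> z = 0" by (auto simp: kernel_def V)
      then obtain N x where N: "0 < N" "x \<in> carrier G" "z \<sim>\<^sub>T frag_of (x, 1 / of_nat N)"
        using tensor_rel_pure[of z] by auto
      have "\<Theta> (z - frag_of (x, 1 / of_nat N)) = 0" using sub N(3) by (auto simp: tensor_rel_def kernel_def V)
      then have "qscale (1 / of_nat N) (\<theta> x) = 0"
        using \<Theta>_diff[OF z(1) frag[OF N(2)]] z(2) \<Theta>_frag[OF N(2)] by simp
      then have "\<theta> x = \<theta> \<one>" using N(1) by (simp add: \<theta>_one)
      then have "x = \<one>" using N(2) by (intro \<theta>_eqI) auto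
      then have "z \<sim>\<^sub>T 0" using tensor_rel_trans[OF N(3)] tensor_zero_left by blast
      then show "z \<in> ?K" by (simp add: tensor_rel_def)
    qed
  qed
  have surj: "\<Theta> ` carrier tensor_base = carrier ?V"
  proof
    show "\<Theta> ` carrier tensor_base \<subseteq> carrier ?V" using \<Theta> by (auto simp: hom_def)
    show "carrier ?V \<subseteq> \<Theta> ` carrier tensor_base"
    proof
      fix v assume "v \<in> carrier ?V"
      then obtain N x where N: "0 < N" "x \<in> carrier G" "qscale (of_nat N) v = \<theta> x"
        using \<theta>_dense unfolding V by blast
      then have "\<Theta> (frag_of (x, 1 / of_nat N)) = v" by (simp add: \<Theta>_frag flip: N(3))
      then show "v \<in> \<Theta> ` carrier tensor_base" using frag[OF N(2)] by blast
    qed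
  qed
  define \<tau> where "\<tau> C = the_elem (\<Theta> ` C)" for C
  have T: "?T = tensor_base Mod ?K" by (simp add: tensor_group_def carrier_rat)
  have \<tau>: "\<tau> \<in> iso ?T ?V"
    unfolding T \<tau>_def[abs_def] K_kernel by (rule \<Theta>.FactGroup_iso_set[OF surj])
  interpret T: comm_group ?T
    unfolding T by (rule B.abelian_FactGroup[OF subgroup_tensor_kernel])
  have pure_carrier: "pure_tensor G rat_ordgroup x q \<in> carrier ?T" if "x \<in> carrier G" for x q
    using frag[OF that] by (auto simp: T pure_tensor_def carrier_rat FactGroup_def RCOSETS_def)
  have \<tau>_pure: "\<tau> (pure_tensor G rat_ordgroup x q) = qscale q (\<theta> x)" if x: "x \<in> carrier G" for x q
  proof -
    have "\<Theta> (k + frag_of (x, q)) = qscale q (\<theta> x)" if "k \<in> ?K" for k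
    proof -
      have "k \<in> carrier tensor_base" "\<Theta> k = 0" using that unfolding K_kernel by (auto simp: kernel_def V)
      then show ?thesis using \<Theta>_add[OF _ frag[OF x]] \<Theta>_frag[OF x] by simp
    qed
    then have "(\<lambda>k. \<Theta> (k + frag_of (x, q))) ` ?K = {qscale q (\<theta> x)}"
      using tensor_kernel_zero by force
    moreover have "pure_tensor G rat_ordgroup x q = (\<lambda>k. k + frag_of (x, q)) ` ?K"
      by (auto simp: pure_tensor_def carrier_rat r_coset_def)
    ultimately have "\<Theta> ` pure_tensor G rat_ordgroup x q = {qscale q (\<theta> x)}" by (simp add: image_image)
    then show ?thesis by (simp add: \<tau>_def)
  qed
  have hom: "\<tau> \<in> hom ?T ?V" using \<tau> by (simp add: iso_def)
  have \<tau>_sum: "\<tau> (finprod ?T (\<lambda>i. pure_tensor G rat_ordgroup (g i) (h i)) {..<k}) = (\<Sum>i<k. qscale (h i) (\<theta> (g i)))"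
    if "\<forall>i<k. g i \<in> carrier G" for k :: nat and g h
    using that
  proof (induction k)
    case 0
    show ?case using hom_one[OF hom] by (simp add: V T.group_axioms V.group_axioms)
  next
    case (Suc k)
    have fin: "finprod ?T (\<lambda>i. pure_tensor G rat_ordgroup (g i) (h i)) {..<k} \<in> carrier ?T"
      using Suc.prems pure_carrier by (intro T.finprod_closed) auto
    have "finprod ?T (\<lambda>i. pure_tensor G rat_ordgroup (g i) (h i)) {..<Suc k}
        = pure_tensor G rat_ordgroup (g k) (h k) \<otimes>\<^bsub>?T\<^esub> finprod ?T (\<lambda>i. pure_tensor G rat_ordgroup (g i) (h i)) {..<k}"
      unfolding lessThan_Suc using Suc.prems pure_carrier by (intro T.finprod_insert) auto
    then show ?case
      using hom_mult[OF hom pure_carrier fin, of "g k" "h k"] Suc by (simp add: V \<tau>_pure add.commute)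
  qed
  have Pos: "pos_cone (tensor_product G rat_ordgroup) =
      {finprod ?T (\<lambda>i. pure_tensor G rat_ordgroup (g i) (h i)) {..<k} |k (g :: nat \<Rightarrow> 'a) (h :: nat \<Rightarrow> rat).
        \<forall>i<k. g i \<in> Pos \<and> 0 \<le> h i}"
    by (simp add: tensor_product_def with_cone_def rat_ordgroup_def)
  have "\<tau> ` pos_cone (tensor_product G rat_ordgroup) = rat_cone"
  proof
    show "\<tau> ` pos_cone (tensor_product G rat_ordgroup) \<subseteq> rat_cone"
    proof
      fix v assume "v \<in> \<tau> ` pos_cone (tensor_product G rat_ordgroup)"
      then obtain k :: nat and g :: "nat \<Rightarrow> 'a" and h :: "nat \<Rightarrow> rat" where g: "\<forall>i<k. g i \<in> Pos \<and> 0 \<le> h i"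
        and v: "v = \<tau> (finprod ?T (\<lambda>i. pure_tensor G rat_ordgroup (g i) (h i)) {..<k})"
        unfolding Pos by blast
      have "v = (\<Sum>i<k. qscale (h i) (\<theta> (g i)))" unfolding v using g Pos_carrier by (intro \<tau>_sum) auto
      moreover have "\<theta> x \<in> rat_cone" if "x \<in> Pos" for x using that by (intro rat_coneI[of 1 x]) auto
      ultimately show "v \<in> rat_cone"
        using g by (auto intro!: qv.cone_sum[OF cone_rat_cone] qv.cone_scale[OF cone_rat_cone])
    qed
    show "rat_cone \<subseteq> \<tau> ` pos_cone (tensor_product G rat_ordgroup)"
    proof
      fix v assume "v \<in> rat_cone"
      then obtain N x where N: "0 < N" "x \<in> Pos" "qscale (of_nat N) v = \<theta> x" by (auto simp: rat_cone_def)
      let ?g = "\<lambda>_::nat. x" and ?h = "\<lambda>_::nat. 1 / of_nat N :: rat"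
      have "\<tau> (finprod ?T (\<lambda>i. pure_tensor G rat_ordgroup (?g i) (?h i)) {..<1}) = (\<Sum>i<(1::nat). qscale (?h i) (\<theta> (?g i)))"
        using N(2) Pos_carrier by (intro \<tau>_sum) auto
      also have "\<dots> = v" using N(1) by (simp flip: N(3))
      finally have v: "v = \<tau> (finprod ?T (\<lambda>i. pure_tensor G rat_ordgroup (?g i) (?h i)) {..<1})" by simp
      have "finprod ?T (\<lambda>i. pure_tensor G rat_ordgroup (?g i) (?h i)) {..<1} \<in> pos_cone (tensor_product G rat_ordgroup)"
        unfolding Pos using N by (intro CollectI exI[of _ 1] exI[of _ ?g] exI[of _ ?h]) simp
      then show "v \<in> \<tau> ` pos_cone (tensor_product G rat_ordgroup)" unfolding v by (rule imageI)
    qed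
  qed
  moreover have "pos_cone (tensor_product G rat_ordgroup) \<subseteq> carrier ?T"
    unfolding Pos using Pos_carrier pure_carrier by (auto intro!: T.finprod_closed)
  moreover have "inj_on \<tau> (carrier ?T)" using \<tau> by (auto simp: iso_def bij_betw_def)
  ultimately have "inv_into (carrier ?T) \<tau> ` rat_cone = pos_cone (tensor_product G rat_ordgroup)"
    by (metis inv_into_image_cancel)
  moreover have "inv_into (carrier ?T) \<tau> \<in> iso ?V (tensor_product G rat_ordgroup)"
    using T.iso_set_sym[OF \<tau>] by (simp add: iso_def hom_def tensor_product_def with_cone_def)
  ultimately show ?thesis by (auto simp: ord_isomorphic_def qvec_group_def)
qed

end

section \<open>Choice of coordinates and conclusion\<close>

lemma ord_isomorphic_trans: "A \<cong>\<^sub>o B \<Longrightarrow> B \<cong>\<^sub>o C \<Longrightarrow> A \<cong>\<^sub>o C"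
  unfolding ord_isomorphic_def by (metis image_comp iso_set_trans)

text \<open>Integer coordinates in a basis of G are read as rational numbers. A rational vector
  times a common denominator of its entries has integer entries and therefore comes from G.\<close>

lemma free_abelian_embedded:
  assumes "ordered_group G" "free_abelian_of_rank n G" "directed_group G" "riesz_interpolation G"
  obtains \<theta> where "embedded_group G n \<theta>"
proof -
  interpret ordered_group G by fact
  let ?F = "free_Abelian_group {..<n}"
  obtain \<psi> where \<psi>: "\<psi> \<in> iso G ?F" using assms(2) by (auto simp: free_abelian_of_rank_def is_iso_def)
  have hom: "\<psi> \<in> hom G ?F" and bij: "bij_betw \<psi> (carrier G) (carrier ?F)" using \<psi> by (auto simp: iso_def)
  define \<theta> where "\<theta> x = (\<lambda>i. rat_of_int (Poly_Mapping.lookup (\<psi> x) i))" for x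
  have keys: "Poly_Mapping.keys (\<psi> x) \<subseteq> {..<n}" if "x \<in> carrier G" for x
    using bij_betwE[OF bij] that by simp
  have "embedded_group G n \<theta>"
  proof
    show "\<theta> (x \<otimes>\<^bsub>G\<^esub> y) = \<theta> x + \<theta> y" if "x \<in> carrier G" "y \<in> carrier G" for x y
      using hom_mult[OF hom that] by (simp add: \<theta>_def fun_eq_iff lookup_add)
    show "inj_on \<theta> (carrier G)"
    proof (rule inj_onI)
      fix x y assume xy: "x \<in> carrier G" "y \<in> carrier G" "\<theta> x = \<theta> y"
      have "Poly_Mapping.lookup (\<psi> x) i = Poly_Mapping.lookup (\<psi> y) i" for i
        using fun_cong[OF xy(3), of i] by (simp add: \<theta>_def)
      then have "\<psi> x = \<psi> y" by (rule poly_mapping_eqI)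
      then show "x = y" using bij_betw_imp_inj_on[OF bij] xy by (auto dest: inj_onD)
    qed
    show "\<theta> x \<in> qvec n" if "x \<in> carrier G" for x
    proof -
      have "i \<notin> Poly_Mapping.keys (\<psi> x)" if "n \<le> i" for i using keys[OF \<open>x \<in> carrier G\<close>] that by auto
      then show ?thesis by (auto simp: qvec_def \<theta>_def in_keys_iff)
    qed
    show "\<exists>N>0. \<exists>x\<in>carrier G. qscale (of_nat N) v = \<theta> x" if v: "v \<in> qvec n" for v
    proof -
      obtain N where N: "N > 0" "\<And>r. r \<in> v ` {..<n} \<Longrightarrow> \<exists>m. of_nat N * r = of_int m"
        using common_denominator[of "v ` {..<n}"] by auto
      then have "\<forall>i. \<exists>m. i < n \<longrightarrow> of_nat N * v i = of_int m" by blast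
      then obtain m where m: "\<And>i. i < n \<Longrightarrow> of_nat N * v i = of_int (m i)" by metis
      define z where "z = (\<Sum>i<n. frag_cmul (m i) (frag_of i))"
      have z: "Poly_Mapping.lookup z i = (if i < n then m i else 0)" for i
        by (simp add: z_def lookup_sum if_distrib cong: if_cong)
      have "Poly_Mapping.keys z \<subseteq> {..<n}" by (auto simp: in_keys_iff z split: if_splits)
      then have "z \<in> carrier ?F" by simp
      then have "z \<in> \<psi> ` carrier G" using bij_betw_imp_surj_on[OF bij] by (simp only:)
      then obtain x where x: "x \<in> carrier G" "\<psi> x = z" by blast
      have "qscale (of_nat N) v = \<theta> x"
        using v m by (auto simp: fun_eq_iff qscale_def \<theta>_def x(2) z qvec_def)
      then show ?thesis using N(1) x(1) by blast
    qed
  qed (use assms in auto)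
  then show ?thesis by (rule that)
qed

theorem corollary5p2:
  fixes G :: "'a ordgroup" and n :: nat
  assumes "ordered_group G"
    and "free_abelian_of_rank n G"
    and "directed_group G"
    and "riesz_interpolation G"
  shows "\<exists>\<phi>. inductive_system {1::nat..} (\<lambda>_. int_power n) \<phi> \<and>
             inductive_limit {1::nat..} (\<lambda>_. int_power n) \<phi> \<cong>\<^sub>o tensor_product G rat_ordgroup"
proof -
  obtain \<theta> where "embedded_group G n \<theta>" using free_abelian_embedded[OF assms] .
  then interpret embedded_group G n \<theta> .
  show ?thesis
    using qvec_limit[OF cone_rat_cone riesz_rat_cone lineality_rat_cone gen_rat_cone]
      ord_isomorphic_trans[OF _ qvec_group_isomorphic_tensor] by blast
qed

end
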